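(* Let $\mathcal{A}$ be the $3$-dimensional associative algebra over $\mathbb{C}$ with basis $\{e_1,e_2,e_3\}$ and multiplication $e_ie_j=e_{\max(i,j)}$ for $i,j\in\{1,2,3\}$ (so $e_1$ is the unit). Every $3$-dimensional weak Hopf algebra over $\mathbb{C}$ is isomorphic to one of the following weak Hopf algebras, whose underlying algebra is $\mathcal{A}$: (1) $\Delta(e_1)=e_1\otimes e_1$, $\Delta(e_2)=e_1\otimes e_2+e_2\otimes e_1-e_2\otimes e_2-e_2\otimes e_3-e_3\otimes e_2+2e_3\otimes e_3$, $\Delta(e_3)=e_1\otimes e_3+e_2\otimes e_2-2e_2\otimes e_3+e_3\otimes e_1-2e_3\otimes e_2+e_3\otimes e_3$, $\varepsilon(e_1)=1$, $\varepsilon(e_2)=\varepsilon(e_3)=0$, $S(e_1)=e_1$, $S(e_2)=e_2$, $S(e_3)=e_2-e_3$; (2) $\Delta(e_1)=(e_1-e_2)\otimes(e_1-e_2)+e_2\otimes e_2$, $\Delta(e_2)=e_2\otimes e_2$, $\Delta(e_3)=(e_2-e_3)\otimes e_3+e_3\otimes(e_2-e_3)$, $\varepsilon(e_1)=2$, $\varepsilon(e_2)=1$, $\varepsilon(e_3)=0$, $S(e_1)=e_1$, $S(e_2)=e_2$, $S(e_3)=e_3$; (3) $\Delta(e_1)=(e_1-e_2)\otimes(e_1-e_2)+(e_2-e_3)\otimes(e_2-e_3)+e_3\otimes e_3$, $\Delta(e_2)=(e_2-e_3)\otimes(e_2-e_3)+e_3\otimes e_3$, $\Delta(e_3)=e_3\otimes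 e_3$, $\varepsilon(e_1)=3$, $\varepsilon(e_2)=2$, $\varepsilon(e_3)=1$, $S(e_1)=e_1$, $S(e_2)=e_2$, $S(e_3)=e_3$.
   Context: Weak bialgebra (here $\mathbb{K}=\mathbb{C}$). Write $xy=m(x\otimes y)$ and use Sweedler notation $\Delta(x)=x_{(1)}\otimes x_{(2)}$ (summation understood). A weak bialgebra is a quintuple $(V,m,\eta,\Delta,\varepsilon)$ with linear maps $m:V\otimes V\to V$, $\eta:\mathbb{K}\to V$ (write $1=\eta(1)$), $\Delta:V\to V\otimes V$, $\varepsilon:V\to\mathbb{K}$ such that: (1) $(V,m,\eta)$ is a unital associative algebra; (2) $(V,\Delta,\varepsilon)$ is a coassociative counital coalgebra; (3) for all $x,y,z\in V$: $\Delta(xy)=\Delta(x)\bullet\Delta(y)$; $(\Delta\otimes \mathrm{id})\Delta(1)=(\Delta(1)\otimes 1)\bullet(1\otimes\Delta(1))=(1\otimes\Delta(1))\bullet(\Delta(1)\otimes 1)$; and $\varepsilon(xyz)=\varepsilon(xy_{(1)})\,\varepsilon(y_{(2)}z)$. Here $\bullet$ is the usual componentwise multiplication on tensor powers of $V$. Weak Hopf algebra: a weak bialgebra together with a linear endomorphism $S$ of $V$ (antipode) such that for all $x\in V$: $m(\mathrm{id}\otimes S)\Delta(x)=(\varepsilon\otimes \mathrm{id})(\Delta(1)\bullet(x\otimes 1))$; $m(S\otimes \mathrm{id})\Delta(x)=(\mathrm{id}\otimes\varepsilon)((1\otimes x)\bullet\Delta(1))$; $m(m\otimes \mathrm{id})(S\otimes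 \mathrm{id}\otimes S)(\Delta\otimes \mathrm{id})\Delta(x)=S(x)$. Two weak Hopf algebras are isomorphic if there is a linear bijection between them compatible with multiplications, comultiplications, counits and antipodes. *)

theory Defs
  imports "HOL-Analysis.Cartesian_Space" "HOL-Library.Poly_Mapping"
begin

section \<open>Complex vector spaces\<close>

class complex_vector = ab_group_add +
  fixes scaleC :: "complex \<Rightarrow> 'a \<Rightarrow> 'a"  (infixr \<open>*\<^sub>C\<close> 75)
  assumes scaleC_add_right: "a *\<^sub>C (x + y) = a *\<^sub>C x + a *\<^sub>C y"
    and scaleC_add_left: "(a + b) *\<^sub>C x = a *\<^sub>C x + b *\<^sub>C x"
    and scaleC_scaleC: "a *\<^sub>C b *\<^sub>C x = (a * b) *\<^sub>C x"
    and scaleC_one: "1 *\<^sub>C x = x"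

global_interpretation complex_vector: vector_space "scaleC :: complex \<Rightarrow> 'a \<Rightarrow> 'a::complex_vector"
  by unfold_locales (simp_all add: scaleC_add_right scaleC_add_left scaleC_scaleC scaleC_one)

abbreviation cspan :: "'a::complex_vector set \<Rightarrow> 'a set"
  where "cspan \<equiv> complex_vector.span"

abbreviation cdim :: "'a::complex_vector set \<Rightarrow> nat"
  where "cdim \<equiv> complex_vector.dim"

abbreviation clinear :: "('a::complex_vector \<Rightarrow> 'b::complex_vector) \<Rightarrow> bool"
  where "clinear \<equiv> Vector_Spaces.linear scaleC scaleC"

definition cbilinear :: "('a::complex_vector \<Rightarrow> 'b::complex_vector \<Rightarrow> 'c::complex_vector) \<Rightarrow> bool"
  where "cbilinear B \<longleftrightarrow> (\<forall>x. clinear (\<lambda>y. B x y)) \<and> (\<forall>y. clinear (\<lambda>x. B x y))"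

lemma clinear_iff:
  "clinear f \<longleftrightarrow> (\<forall>x y. f (x + y) = f x + f y) \<and> (\<forall>c x. f (c *\<^sub>C x) = c *\<^sub>C f x)"
  by (simp add: Vector_Spaces.linear_iff complex_vector.vector_space_axioms)

instantiation complex :: complex_vector
begin
definition "c *\<^sub>C (x::complex) = c * x"
instance by standard (simp_all add: scaleC_complex_def algebra_simps)
end

instantiation vec :: (complex_vector, finite) complex_vector
begin
definition "c *\<^sub>C x = (\<chi> i. c *\<^sub>C (x $ i))"
instance
  by standard (simp_all add: scaleC_vec_def vec_eq_iff
      scaleC_add_right scaleC_add_left scaleC_scaleC scaleC_one)
end

instantiation poly_mapping :: (type, complex_vector) complex_vector
begin
lift_definition scaleC_poly_mapping :: "complex \<Rightarrow> ('a \<Rightarrow>\<^sub>0 'b) \<Rightarrow> ('a \<Rightarrow>\<^sub>0 'b)"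
  is "\<lambda>c f k. c *\<^sub>C f k"
proof -
  fix c :: complex and f :: "'a \<Rightarrow> 'b"
  assume "finite {x. f x \<noteq> 0}"
  then show "finite {x. c *\<^sub>C f x \<noteq> 0}"
    by (rule rev_finite_subset) auto
qed
instance
  by standard (transfer; simp add: scaleC_add_right scaleC_add_left scaleC_scaleC scaleC_one)+
end


section \<open>Tensor products\<close>

text \<open>The tensor product is the free vector space on the set of pairs, modulo the bilinear relations.\<close>

definition tensor_relations :: "(('a::complex_vector \<times> 'b::complex_vector) \<Rightarrow>\<^sub>0 complex) set" where
  "tensor_relations =
     {Poly_Mapping.single (x + x', y) 1
        - (Poly_Mapping.single (x, y) 1 + Poly_Mapping.single (x', y) 1) | x x' y. True}
   \<union> {Poly_Mapping.single (x, y + y') 1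
        - (Poly_Mapping.single (x, y) 1 + Poly_Mapping.single (x, y') 1) | x y y'. True}
   \<union> {Poly_Mapping.single (c *\<^sub>C x, y) 1 - c *\<^sub>C Poly_Mapping.single (x, y) 1 | c x y. True}
   \<union> {Poly_Mapping.single (x, c *\<^sub>C y) 1 - c *\<^sub>C Poly_Mapping.single (x, y) 1 | c x y. True}"

definition tensor_rel ::
  "(('a::complex_vector \<times> 'b::complex_vector) \<Rightarrow>\<^sub>0 complex) \<Rightarrow> ('a \<times> 'b \<Rightarrow>\<^sub>0 complex) \<Rightarrow> bool"
  where "tensor_rel p q \<longleftrightarrow> p - q \<in> cspan tensor_relations"

lemma equivp_tensor_rel: "equivp tensor_rel"
proof (rule equivpI)
  show "reflp tensor_rel"
    by (simp add: reflp_def tensor_rel_def complex_vector.span_zero)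
  show "symp tensor_rel"
    unfolding symp_def tensor_rel_def using complex_vector.span_neg by fastforce
  show "transp tensor_rel"
    unfolding transp_def tensor_rel_def using complex_vector.span_add by fastforce
qed

quotient_type (overloaded) ('a, 'b) tensor (infixl \<open>\<otimes>\<close> 70) =
    "('a::complex_vector \<times> 'b::complex_vector) \<Rightarrow>\<^sub>0 complex" / tensor_rel
  by (rule equivp_tensor_rel)

instantiation tensor :: (complex_vector, complex_vector) complex_vector
begin

lift_definition zero_tensor :: "'a \<otimes> 'b" is 0 .

lift_definition plus_tensor :: "'a \<otimes> 'b \<Rightarrow> 'a \<otimes> 'b \<Rightarrow> 'a \<otimes> 'b" is "(+)"
  unfolding tensor_rel_def by (simp add: add_diff_add complex_vector.span_add)

lift_definition minus_tensor :: "'a \<otimes> 'b \<Rightarrow> 'a \<otimes> 'b \<Rightarrow> 'a \<otimes> 'b" is "(-)"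
proof -
  fix p p' q q' :: "('a \<times> 'b) \<Rightarrow>\<^sub>0 complex"
  assume "tensor_rel p p'" "tensor_rel q q'"
  then have "(p - p') - (q - q') \<in> cspan tensor_relations"
    unfolding tensor_rel_def by (rule complex_vector.span_diff)
  then show "tensor_rel (p - q) (p' - q')"
    unfolding tensor_rel_def by (simp add: algebra_simps)
qed

lift_definition uminus_tensor :: "'a \<otimes> 'b \<Rightarrow> 'a \<otimes> 'b" is uminus
  unfolding tensor_rel_def using complex_vector.span_neg by fastforce

lift_definition scaleC_tensor :: "complex \<Rightarrow> 'a \<otimes> 'b \<Rightarrow> 'a \<otimes> 'b" is scaleC
  unfolding tensor_rel_def
  by (metis complex_vector.scale_right_diff_distrib complex_vector.span_scale)

instance
  by standard
    (transfer; simp add: tensor_rel_def algebra_simps complex_vector.span_zero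
      scaleC_add_right scaleC_add_left scaleC_scaleC scaleC_one)+

end

lift_definition tensor_elem :: "'a::complex_vector \<Rightarrow> 'b::complex_vector \<Rightarrow> 'a \<otimes> 'b"
    (infixl \<open>\<otimes>\<close> 70)
  is "\<lambda>x y. Poly_Mapping.single (x, y) 1" .

text \<open>
  The linear map on the tensor product induced by \<open>B\<close>.  It is meaningful only for bilinear \<open>B\<close>,
  in which case it does not depend on the chosen representative.
\<close>

definition free_lift ::
  "('a::complex_vector \<Rightarrow> 'b::complex_vector \<Rightarrow> 'c::complex_vector) \<Rightarrow> ('a \<times> 'b \<Rightarrow>\<^sub>0 complex) \<Rightarrow> 'c"
  where "free_lift B p =
    (\<Sum>k\<in>Poly_Mapping.keys p. Poly_Mapping.lookup p k *\<^sub>C B (fst k) (snd k))"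

definition tensor_lift ::
  "('a::complex_vector \<Rightarrow> 'b::complex_vector \<Rightarrow> 'c::complex_vector) \<Rightarrow> 'a \<otimes> 'b \<Rightarrow> 'c"
  where "tensor_lift B t = free_lift B (rep_tensor t)"

lemma lookup_scaleC [simp]: "Poly_Mapping.lookup (c *\<^sub>C p) k = c *\<^sub>C Poly_Mapping.lookup p k"
  by transfer simp

lemma free_lift_superset:
  assumes "finite K" "Poly_Mapping.keys p \<subseteq> K"
  shows "free_lift B p = (\<Sum>k\<in>K. Poly_Mapping.lookup p k *\<^sub>C B (fst k) (snd k))"
  unfolding free_lift_def using assms
  by (intro sum.mono_neutral_left) (auto simp: in_keys_iff)

lemma clinear_free_lift: "clinear (free_lift B)"
proof -
  have "free_lift B (p + q) = free_lift B p + free_lift B q" for p q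
  proof -
    have "free_lift B r = (\<Sum>k\<in>Poly_Mapping.keys p \<union> Poly_Mapping.keys q. Poly_Mapping.lookup r k *\<^sub>C B (fst k) (snd k))"
      if "r \<in> {p, q, p + q}" for r
      using that keys_add[of p q] by (intro free_lift_superset) auto
    then show ?thesis
      by (simp add: lookup_add scaleC_add_left sum.distrib)
  qed
  moreover have "free_lift B (c *\<^sub>C p) = c *\<^sub>C free_lift B p" for c p
  proof -
    have "Poly_Mapping.keys (c *\<^sub>C p) \<subseteq> Poly_Mapping.keys p"
      by (auto simp: in_keys_iff)
    then have "free_lift B (c *\<^sub>C p)
        = (\<Sum>k\<in>Poly_Mapping.keys p. Poly_Mapping.lookup (c *\<^sub>C p) k *\<^sub>C B (fst k) (snd k))"
      by (intro free_lift_superset) auto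
    then show ?thesis
      by (simp add: free_lift_def scaleC_complex_def complex_vector.scale_sum_right scaleC_scaleC)
  qed
  ultimately show ?thesis
    by (simp add: clinear_iff)
qed

lemma free_lift_single [simp]: "free_lift B (Poly_Mapping.single (x, y) c) = c *\<^sub>C B x y"
  by (simp add: free_lift_def)

lemma free_lift_respects:
  assumes B: "cbilinear B" and "tensor_rel p q"
  shows "free_lift B p = free_lift B q"
proof -
  interpret L: Vector_Spaces.linear scaleC scaleC "free_lift B"
    by (rule clinear_free_lift)
  have "free_lift B r = 0" if "r \<in> tensor_relations" for r
    using that B
    by (auto simp: tensor_relations_def cbilinear_def clinear_iff L.diff L.add L.scale scaleC_one)
  then have "free_lift B r = 0" if "r \<in> cspan tensor_relations" for r
    using L.eq_0_on_span that by blast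
  then have "free_lift B (p - q) = 0"
    using assms(2) by (simp add: tensor_rel_def)
  then show ?thesis
    by (simp add: L.diff)
qed

lemma tensor_lift_abs:
  assumes "cbilinear B"
  shows "tensor_lift B (abs_tensor p) = free_lift B p"
  unfolding tensor_lift_def
  by (rule free_lift_respects[OF assms])
    (metis Quotient3_rel_rep Quotient3_abs_rep Quotient3_tensor tensor.abs_eq_iff)

lemma cbilinear_tensor_elem: "cbilinear (\<otimes>)"
proof -
  have 1: "(x + x') \<otimes> y = x \<otimes> y + x' \<otimes> y"
    for x x' :: 'a and y :: 'b
    by transfer (unfold tensor_rel_def tensor_relations_def, rule complex_vector.span_base, blast)
  have 2: "x \<otimes> (y + y') = x \<otimes> y + x \<otimes> y'"
    for x :: 'a and y y' :: 'b
    by transfer (unfold tensor_rel_def tensor_relations_def, rule complex_vector.span_base, blast)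
  have 3: "(c *\<^sub>C x) \<otimes> y = c *\<^sub>C (x \<otimes> y)"
    for c and x :: 'a and y :: 'b
    by transfer (unfold tensor_rel_def tensor_relations_def, rule complex_vector.span_base, blast)
  have 4: "x \<otimes> (c *\<^sub>C y) = c *\<^sub>C (x \<otimes> y)"
    for c and x :: 'a and y :: 'b
    by transfer (unfold tensor_rel_def tensor_relations_def, rule complex_vector.span_base, blast)
  show ?thesis
    by (simp add: cbilinear_def clinear_iff 1 2 3 4)
qed

theorem clinear_tensor_lift:
  assumes "cbilinear B"
  shows "clinear (tensor_lift B)"
proof -
  have "tensor_lift B (s + t) = tensor_lift B s + tensor_lift B t" for s t
  proof (induction s rule: tensor.abs_induct, induction t rule: tensor.abs_induct)
    fix p q
    show "tensor_lift B (abs_tensor q + abs_tensor p)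
        = tensor_lift B (abs_tensor q) + tensor_lift B (abs_tensor p)"
      using clinear_free_lift[of B]
      by (simp add: plus_tensor.abs_eq tensor_lift_abs[OF assms] clinear_iff)
  qed
  moreover have "tensor_lift B (c *\<^sub>C s) = c *\<^sub>C tensor_lift B s" for c s
  proof (induction s rule: tensor.abs_induct)
    fix p
    show "tensor_lift B (c *\<^sub>C abs_tensor p) = c *\<^sub>C tensor_lift B (abs_tensor p)"
      using clinear_free_lift[of B]
      by (simp add: scaleC_tensor.abs_eq tensor_lift_abs[OF assms] clinear_iff)
  qed
  ultimately show ?thesis
    by (simp add: clinear_iff)
qed

theorem tensor_lift_elem:
  assumes "cbilinear B"
  shows "tensor_lift B (x \<otimes> y) = B x y"
  by (simp add: tensor_elem.abs_eq tensor_lift_abs[OF assms] scaleC_one)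

theorem tensor_ext:
  assumes f: "clinear f" and g: "clinear g" and eq: "\<And>x y. f (x \<otimes> y) = g (x \<otimes> y)"
  shows "f = g"
proof
  interpret f: Vector_Spaces.linear scaleC scaleC f by (rule f)
  interpret g: Vector_Spaces.linear scaleC scaleC g by (rule g)
  fix t :: "'a \<otimes> 'b"
  obtain p where t: "t = abs_tensor p"
    by (induction t rule: tensor.abs_induct) blast
  have "f (abs_tensor p) = g (abs_tensor p)"
  proof (induction p rule: Poly_Mapping.update_induct)
    case const
    then show ?case
      by (simp add: zero_tensor.abs_eq[symmetric] f.zero g.zero)
  next
    case (update p k v)
    have "Poly_Mapping.update k v p = p + v *\<^sub>C Poly_Mapping.single k 1"
      using update.hyps(1)
      by (intro poly_mapping_eqI)
        (auto simp: lookup_add lookup_update lookup_single in_keys_iff when_def scaleC_complex_def)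
    then have "abs_tensor (Poly_Mapping.update k v p) = abs_tensor p + v *\<^sub>C (fst k \<otimes> snd k)"
      by (simp add: plus_tensor.abs_eq scaleC_tensor.abs_eq tensor_elem.abs_eq)
    then show ?case
      by (simp add: f.add g.add f.scale g.scale eq update.IH)
  qed
  then show "f t = g t"
    by (simp add: t)
qed

definition tensor_map ::
  "('a::complex_vector \<Rightarrow> 'c::complex_vector) \<Rightarrow> ('b::complex_vector \<Rightarrow> 'd::complex_vector)
     \<Rightarrow> 'a \<otimes> 'b \<Rightarrow> 'c \<otimes> 'd"
  where "tensor_map f g = tensor_lift (\<lambda>x y. f x \<otimes> g y)"

definition assoc ::
  "'a::complex_vector \<otimes> ('b::complex_vector \<otimes> 'c::complex_vector) \<Rightarrow> ('a \<otimes> 'b) \<otimes> 'c"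
  where "assoc = tensor_lift (\<lambda>x. tensor_lift (\<lambda>y z. (x \<otimes> y) \<otimes> z))"

definition left_unitor :: "complex \<otimes> 'a::complex_vector \<Rightarrow> 'a"
  where "left_unitor = tensor_lift (\<lambda>c x. c *\<^sub>C x)"

definition right_unitor :: "'a::complex_vector \<otimes> complex \<Rightarrow> 'a"
  where "right_unitor = tensor_lift (\<lambda>x c. c *\<^sub>C x)"

text \<open>Componentwise multiplication \<open>(a \<otimes> b) \<bullet> (a' \<otimes> b') = \<mu> a a' \<otimes> \<nu> b b'\<close>.\<close>

definition tensor_mult ::
  "('a::complex_vector \<Rightarrow> 'a \<Rightarrow> 'a) \<Rightarrow> ('b::complex_vector \<Rightarrow> 'b \<Rightarrow> 'b)
     \<Rightarrow> 'a \<otimes> 'b \<Rightarrow> 'a \<otimes> 'b \<Rightarrow> 'a \<otimes> 'b"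
  where "tensor_mult \<mu> \<nu> s t =
    tensor_lift (\<lambda>a b. tensor_lift (\<lambda>a' b'. \<mu> a a' \<otimes> \<nu> b b') t) s"


section \<open>Weak Hopf algebras\<close>

record (overloaded) ('a::complex_vector) weak_hopf_data =
  mult :: "'a \<otimes> 'a \<Rightarrow> 'a"
  unit_map :: "complex \<Rightarrow> 'a"
  comult :: "'a \<Rightarrow> 'a \<otimes> 'a"
  counit :: "'a \<Rightarrow> complex"
  antipode :: "'a \<Rightarrow> 'a"

definition unital_algebra ::
  "('a::complex_vector \<otimes> 'a \<Rightarrow> 'a) \<Rightarrow> (complex \<Rightarrow> 'a) \<Rightarrow> bool"
  where "unital_algebra m \<eta> \<longleftrightarrow>
     clinear m \<and> clinear \<eta>
   \<and> (\<forall>x y z. m (m (x \<otimes> y) \<otimes> z) = m (x \<otimes> m (y \<otimes> z)))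
   \<and> (\<forall>x. m (\<eta> 1 \<otimes> x) = x \<and> m (x \<otimes> \<eta> 1) = x)"

definition counital_coalgebra ::
  "('a::complex_vector \<Rightarrow> 'a \<otimes> 'a) \<Rightarrow> ('a \<Rightarrow> complex) \<Rightarrow> bool"
  where "counital_coalgebra \<Delta> \<epsilon> \<longleftrightarrow>
     clinear \<Delta> \<and> clinear \<epsilon>
   \<and> (\<forall>x. tensor_map \<Delta> id (\<Delta> x) = assoc (tensor_map id \<Delta> (\<Delta> x)))
   \<and> (\<forall>x. left_unitor (tensor_map \<epsilon> id (\<Delta> x)) = x
        \<and> right_unitor (tensor_map id \<epsilon> (\<Delta> x)) = x)"

text \<open>
  In the weak bialgebra axioms, \<open>V \<otimes> V \<otimes> V\<close> is bracketed to the left, and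
  \<open>1 \<otimes> \<Delta>(1)\<close> is transported there by \<^const>\<open>assoc\<close>.
\<close>

definition weak_bialgebra ::
  "('a::complex_vector \<otimes> 'a \<Rightarrow> 'a) \<Rightarrow> (complex \<Rightarrow> 'a) \<Rightarrow> ('a \<Rightarrow> 'a \<otimes> 'a) \<Rightarrow> ('a \<Rightarrow> complex) \<Rightarrow> bool"
  where "weak_bialgebra m \<eta> \<Delta> \<epsilon> \<longleftrightarrow>
    (let mul = (\<lambda>x y. m (x \<otimes> y));
         mul2 = tensor_mult mul mul;
         mul3 = tensor_mult mul2 mul;
         one = \<eta> 1
     in unital_algebra m \<eta> \<and> counital_coalgebra \<Delta> \<epsilon>
      \<and> (\<forall>x y. \<Delta> (mul x y) = mul2 (\<Delta> x) (\<Delta> y))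
      \<and> tensor_map \<Delta> id (\<Delta> one) = mul3 (\<Delta> one \<otimes> one) (assoc (one \<otimes> \<Delta> one))
      \<and> tensor_map \<Delta> id (\<Delta> one) = mul3 (assoc (one \<otimes> \<Delta> one)) (\<Delta> one \<otimes> one)
      \<and> (\<forall>x y z. \<epsilon> (mul (mul x y) z)
            = tensor_lift (\<lambda>y\<^sub>1 y\<^sub>2. \<epsilon> (mul x y\<^sub>1) * \<epsilon> (mul y\<^sub>2 z)) (\<Delta> y)))"

definition weak_hopf_algebra :: "'a::complex_vector weak_hopf_data \<Rightarrow> bool"
  where "weak_hopf_algebra H \<longleftrightarrow>
    (let m = mult H; \<eta> = unit_map H; \<Delta> = comult H; \<epsilon> = counit H; S = antipode H;
         mul = (\<lambda>x y. m (x \<otimes> y));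
         mul2 = tensor_mult mul mul;
         one = \<eta> 1
     in weak_bialgebra m \<eta> \<Delta> \<epsilon> \<and> clinear S
      \<and> (\<forall>x. m (tensor_map id S (\<Delta> x)) = left_unitor (tensor_map \<epsilon> id (mul2 (\<Delta> one) (x \<otimes> one))))
      \<and> (\<forall>x. m (tensor_map S id (\<Delta> x)) = right_unitor (tensor_map id \<epsilon> (mul2 (one \<otimes> x) (\<Delta> one))))
      \<and> (\<forall>x. m (tensor_map m id
                 (tensor_map (tensor_map S id) S (tensor_map \<Delta> id (\<Delta> x)))) = S x))"

definition weak_hopf_isomorphic ::
  "'a::complex_vector weak_hopf_data \<Rightarrow> 'b::complex_vector weak_hopf_data \<Rightarrow> bool"
  where "weak_hopf_isomorphic H K \<longleftrightarrow>
    (\<exists>\<phi>. clinear \<phi> \<and> bij \<phi>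
       \<and> (\<forall>t. \<phi> (mult H t) = mult K (tensor_map \<phi> \<phi> t))
       \<and> (\<forall>x. tensor_map \<phi> \<phi> (comult H x) = comult K (\<phi> x))
       \<and> (\<forall>x. counit H x = counit K (\<phi> x))
       \<and> (\<forall>x. \<phi> (antipode H x) = antipode K (\<phi> x)))"


section \<open>The algebra and the three weak Hopf structures\<close>

text \<open>
  The coordinates of \<^typ>\<open>complex^3\<close> are written 1, 2, 3, where 3 denotes the element 0 of the
  index type; the indices of the basis vectors below are therefore taken in \<^typ>\<open>nat\<close>, so that
  \<open>max\<close> is the usual maximum.
\<close>

definition \<e> :: "nat \<Rightarrow> complex^3"
  where "\<e> i = axis (of_nat i) 1"

definition A_mult :: "(complex^3) \<otimes> (complex^3) \<Rightarrow> complex^3"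
  where "A_mult = tensor_lift (\<lambda>x y.
    \<Sum>i\<in>{1..3}. \<Sum>j\<in>{1..3}. (x $ of_nat i * y $ of_nat j) *\<^sub>C \<e> (max i j))"

definition A_unit :: "complex \<Rightarrow> complex^3"
  where "A_unit c = c *\<^sub>C \<e> 1"

text \<open>The linear map with values \<open>a\<close>, \<open>b\<close>, \<open>c\<close> on \<open>\<e> 1\<close>, \<open>\<e> 2\<close>, \<open>\<e> 3\<close>.\<close>

definition on_basis :: "'a::complex_vector \<Rightarrow> 'a \<Rightarrow> 'a \<Rightarrow> complex^3 \<Rightarrow> 'a"
  where "on_basis a b c x = (x $ 1) *\<^sub>C a + (x $ 2) *\<^sub>C b + (x $ 3) *\<^sub>C c"

definition weak_hopf_1 :: "(complex^3) weak_hopf_data"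
  where "weak_hopf_1 = \<lparr>
    mult = A_mult,
    unit_map = A_unit,
    comult = on_basis
      (\<e> 1 \<otimes> \<e> 1)
      (\<e> 1 \<otimes> \<e> 2 + \<e> 2 \<otimes> \<e> 1 - \<e> 2 \<otimes> \<e> 2 - \<e> 2 \<otimes> \<e> 3 - \<e> 3 \<otimes> \<e> 2 + 2 *\<^sub>C (\<e> 3 \<otimes> \<e> 3))
      (\<e> 1 \<otimes> \<e> 3 + \<e> 2 \<otimes> \<e> 2 - 2 *\<^sub>C (\<e> 2 \<otimes> \<e> 3) + \<e> 3 \<otimes> \<e> 1 - 2 *\<^sub>C (\<e> 3 \<otimes> \<e> 2) + \<e> 3 \<otimes> \<e> 3),
    counit = on_basis 1 0 0,
    antipode = on_basis (\<e> 1) (\<e> 2) (\<e> 2 - \<e> 3)\<rparr>"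

definition weak_hopf_2 :: "(complex^3) weak_hopf_data"
  where "weak_hopf_2 = \<lparr>
    mult = A_mult,
    unit_map = A_unit,
    comult = on_basis
      ((\<e> 1 - \<e> 2) \<otimes> (\<e> 1 - \<e> 2) + \<e> 2 \<otimes> \<e> 2)
      (\<e> 2 \<otimes> \<e> 2)
      ((\<e> 2 - \<e> 3) \<otimes> \<e> 3 + \<e> 3 \<otimes> (\<e> 2 - \<e> 3)),
    counit = on_basis 2 1 0,
    antipode = on_basis (\<e> 1) (\<e> 2) (\<e> 3)\<rparr>"

definition weak_hopf_3 :: "(complex^3) weak_hopf_data"
  where "weak_hopf_3 = \<lparr>
    mult = A_mult,
    unit_map = A_unit,
    comult = on_basis
      ((\<e> 1 - \<e> 2) \<otimes> (\<e> 1 - \<e> 2) + (\<e> 2 - \<e> 3) \<otimes> (\<e> 2 - \<e> 3) + \<e> 3 \<otimes> \<e> 3)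
      ((\<e> 2 - \<e> 3) \<otimes> (\<e> 2 - \<e> 3) + \<e> 3 \<otimes> \<e> 3)
      (\<e> 3 \<otimes> \<e> 3),
    counit = on_basis 3 2 1,
    antipode = on_basis (\<e> 1) (\<e> 2) (\<e> 3)\<rparr>"

lemma basis_nth [simp]:
  "\<e> 1 $ 1 = 1" "\<e> 1 $ 2 = 0" "\<e> 1 $ 3 = 0"
  "\<e> 2 $ 1 = 0" "\<e> 2 $ 2 = 1" "\<e> 2 $ 3 = 0"
  "\<e> 3 $ 1 = 0" "\<e> 3 $ 2 = 0" "\<e> 3 $ 3 = 1"
  by (simp_all add: \<e>_def axis_def)

lemma on_basis_basis:
  "on_basis a b c (\<e> 1) = a" "on_basis a b c (\<e> 2) = b" "on_basis a b c (\<e> 3) = c"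
  by (simp_all add: on_basis_def scaleC_one del: One_nat_def)

lemma clinear_on_basis: "clinear (on_basis a b c)"
  by (simp add: clinear_iff on_basis_def scaleC_vec_def scaleC_complex_def
      scaleC_add_left scaleC_add_right scaleC_scaleC algebra_simps)

lemma on_basis_id: "on_basis (\<e> 1) (\<e> 2) (\<e> 3) x = x"
  by (simp add: on_basis_def vec_eq_iff forall_3 scaleC_vec_def scaleC_complex_def del: One_nat_def)

lemma A_mult_basis:
  assumes "i \<in> {1..3}" "j \<in> {1..3}"
  shows "A_mult (\<e> i \<otimes> \<e> j) = \<e> (max i j)"
proof -
  have nth: "(c *\<^sub>C x) $ i = c * x $ i" for c and x :: "complex^3" and i
    by (simp add: scaleC_vec_def scaleC_complex_def)
  have "cbilinear (\<lambda>(x::complex^3) (y::complex^3).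
      \<Sum>i\<in>{1..3}. \<Sum>j\<in>{1..3}. (x $ of_nat i * y $ of_nat j) *\<^sub>C \<e> (max i j))"
    by (simp add: cbilinear_def clinear_iff nth algebra_simps
        scaleC_add_left sum.distrib complex_vector.scale_sum_right scaleC_scaleC)
  moreover have "{1..3::nat} = {1, 2, 3}" by auto
  ultimately show ?thesis
    using assms by (auto simp: A_mult_def tensor_lift_elem scaleC_one simp del: One_nat_def)
qed

end

theory Submission
  imports "HOL-Computational_Algebra.Fundamental_Theorem_Algebra" Defs
begin

text \<open>
  A three-dimensional weak Hopf algebra is the algebra of functions on a groupoid with three arrows,
  and there are three such groupoids: the group of order three, the disjoint union of a point and the
  group of order two, and three points. In the basis of minimal idempotents of \<open>\<A>\<close> these are the
  three weak Hopf algebras of the list.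

  The main point is that the underlying algebra is isomorphic to \<open>\<complex>\<^sup>3\<close> (\<open>algebra_splits\<close>).
  Write \<open>E = \<Delta>(1)\<close>. The legs of \<open>E\<close> lie in two commuting base algebras \<open>Hs\<close> and \<open>Ht\<close>, on which
  the comultiplication is multiplication of \<open>E\<close> in one leg; idempotency of \<open>E\<close> keeps suitable
  nilpotents out of them (\<open>square_zero_not_in_Hs\<close>). There are three cases.

  If one of the base algebras is trivial, then \<open>E = 1 \<otimes> 1\<close> and the structure is a Hopf algebra
  (\<open>hopf_split\<close>). In a nilpotent augmentation ideal, a derivation along the counit would be a
  nilpotent primitive element of the dual, which characteristic zero excludes. If the ideal
  contains an idempotent and the algebra does not split, then there are exactly two characters, and
  translation by the second one would be an automorphism that exchanges them, which a third basis
  vector of square zero does not allow.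

  If \<open>Hs\<close> and \<open>Ht\<close> together span the algebra, then the algebra is commutative and equations for the
  generators produce idempotents (\<open>distinct_bases_split\<close>).

  In the remaining case both are spanned by the same two orthogonal idempotents, which act as the
  objects of a category with the corners of the algebra as spaces of arrows. The third dimension
  is either a loop at one of the two objects or an arrow between them; the latter would need an
  inverse, for which there is no room, and the former leads to a split algebra by the same argument
  with derivations as for Hopf algebras (\<open>base_of_two_idempotents_split\<close>).

  For a split algebra with minimal idempotents \<open>p\<^sub>i\<close>, all axioms become identities between structure
  constants (\<open>weak_hopf_iff\<close>). Multiplicativity of \<open>\<Delta>\<close> makes the constants \<open>0\<close> or \<open>1\<close>, so they are
  the multiplication table of a partial operation on three elements, and the remaining axioms say
  that this is a groupoid (\<open>groupoid_constants_table\<close>). A case distinction on the number of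
  identities finishes the classification, and the same dictionary verifies that the three listed
  structures are weak Hopf algebras.
\<close>

section \<open>Linear and bilinear maps on tensor products\<close>

lemma clinearI:
  assumes "\<And>x y. f (x + y) = f x + f y" "\<And>c x. f (c *\<^sub>C x) = c *\<^sub>C f x"
  shows "clinear f"
  using assms by (simp add: clinear_iff)

lemma
  assumes "clinear f"
  shows clinear_add: "f (x + y) = f x + f y"
    and clinear_scale: "f (c *\<^sub>C x) = c *\<^sub>C f x"
    and clinear_zero: "f 0 = 0"
    and clinear_diff: "f (x - y) = f x - f y"
    and clinear_uminus: "f (- x) = - f x"
    and clinear_sum: "f (sum g A) = (\<Sum>i\<in>A. f (g i))"
proof -
  interpret Vector_Spaces.linear scaleC scaleC f by (rule assms)
  show "f (x + y) = f x + f y" "f (c *\<^sub>C x) = c *\<^sub>C f x" "f 0 = 0" "f (x - y) = f x - f y"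
    "f (- x) = - f x" "f (sum g A) = (\<Sum>i\<in>A. f (g i))"
    by (simp_all add: add scale zero diff neg sum)
qed

lemmas clinear_rules = clinear_add clinear_scale clinear_zero clinear_diff clinear_uminus clinear_sum

lemma clinear_compose: "clinear f \<Longrightarrow> clinear g \<Longrightarrow> clinear (\<lambda>x. f (g x))"
  by (simp add: clinear_iff)

lemma clinear_plus: "clinear f \<Longrightarrow> clinear g \<Longrightarrow> clinear (\<lambda>x. f x + g x)"
  by (simp add: clinear_iff scaleC_add_right)

lemma clinear_ident: "clinear (\<lambda>x. x)"
  by (simp add: clinear_iff)

lemma clinear_id: "clinear id"
  by (simp add: clinear_iff)

lemma cbilinearI:
  assumes "\<And>x. clinear (\<lambda>y. B x y)" "\<And>y. clinear (\<lambda>x. B x y)"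
  shows "cbilinear B"
  using assms by (simp add: cbilinear_def)

lemma cbilinear_right: "cbilinear B \<Longrightarrow> clinear (\<lambda>y. B x y)"
  and cbilinear_left: "cbilinear B \<Longrightarrow> clinear (\<lambda>x. B x y)"
  by (simp_all add: cbilinear_def)

lemmas cbilinear_rules =
  clinear_rules[OF cbilinear_left] clinear_rules[OF cbilinear_right]

lemmas tensor_simps = cbilinear_rules[OF cbilinear_tensor_elem]

lemma cbilinear_compose:
  assumes B: "cbilinear B" and f: "clinear f" and g: "clinear g"
  shows "cbilinear (\<lambda>x y. B (f x) (g y))"
  by (intro cbilinearI clinear_compose[OF cbilinear_right[OF B] g]
      clinear_compose[OF cbilinear_left[OF B] f])

lemma cbilinear_post:
  assumes "cbilinear B" "clinear f"
  shows "cbilinear (\<lambda>x y. f (B x y))"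
  by (intro cbilinearI clinear_compose[OF assms(2)] cbilinear_right[OF assms(1)] cbilinear_left[OF assms(1)])

lemma cbilinear_scaleC: "cbilinear (\<lambda>c x. c *\<^sub>C (x :: 'a :: complex_vector))"
  by (intro cbilinearI)
    (simp_all add: clinear_iff scaleC_add_left scaleC_add_right scaleC_scaleC scaleC_complex_def mult.commute)

lemma cbilinear_flip: "cbilinear B \<Longrightarrow> cbilinear (\<lambda>x y. B y x)"
  by (simp add: cbilinear_def)

lemma cbilinear_times: "cbilinear (\<lambda>c d :: complex. c * d)"
  by (intro cbilinearI) (simp_all add: clinear_iff scaleC_complex_def algebra_simps)

lemma scaleC_complex [simp]: "c *\<^sub>C (x :: complex) = c * x"
  by (rule scaleC_complex_def)

text \<open>
  Every tensor is a sum of pure tensors: the coefficient of a pure tensor is absorbed into its first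
  factor, so an induction over tensors needs no case for scalar multiples.
\<close>

lemma tensor_induct [case_names elem add]:
  assumes "\<And>x y. P (x \<otimes> y)" and add: "\<And>s t. P s \<Longrightarrow> P t \<Longrightarrow> P (s + t)"
  shows "P t"
proof -
  obtain p where t: "t = abs_tensor p"
    by (induction t rule: tensor.abs_induct) blast
  have "P (abs_tensor p)"
  proof (induction p rule: Poly_Mapping.update_induct)
    case const
    have "(0::'a) \<otimes> (0::'b) = 0" by (simp add: tensor_simps)
    then show ?case
      using assms(1)[of 0 0] by (simp add: zero_tensor.abs_eq[symmetric])
  next
    case (update p k v)
    have "Poly_Mapping.update k v p = p + v *\<^sub>C Poly_Mapping.single k 1"
      using update.hyps(1)
      by (intro poly_mapping_eqI)
        (auto simp: lookup_add lookup_update lookup_single in_keys_iff when_def)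
    then have "abs_tensor (Poly_Mapping.update k v p) = abs_tensor p + (v *\<^sub>C fst k) \<otimes> snd k"
      by (simp only: tensor_simps) (simp add: plus_tensor.abs_eq scaleC_tensor.abs_eq tensor_elem.abs_eq)
    then show ?case
      by (simp add: add assms(1) update.IH)
  qed
  then show ?thesis by (simp add: t)
qed

lemma tensor_eqI:
  assumes "clinear f" "clinear g" "\<And>x y. f (x \<otimes> y) = g (x \<otimes> y)"
  shows "f t = g t"
  using tensor_ext[OF assms] by simp

lemma
  assumes f: "clinear f" and g: "clinear g"
  shows clinear_tensor_map: "clinear (tensor_map f g)"
    and tensor_map_elem [simp]: "tensor_map f g (x \<otimes> y) = f x \<otimes> g y"
proof -
  have B: "cbilinear (\<lambda>x y. f x \<otimes> g y)"
    by (rule cbilinear_compose[OF cbilinear_tensor_elem f g])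
  show "clinear (tensor_map f g)" "tensor_map f g (x \<otimes> y) = f x \<otimes> g y"
    unfolding tensor_map_def by (rule clinear_tensor_lift[OF B], rule tensor_lift_elem[OF B])
qed

lemma tensor_map_id_right: "clinear f \<Longrightarrow> tensor_map f id (x \<otimes> y) = f x \<otimes> y"
  and tensor_map_id_left: "clinear f \<Longrightarrow> tensor_map id f (y \<otimes> x) = y \<otimes> f x"
  by (rule trans[OF tensor_map_elem[OF _ clinear_id]], assumption, simp)
    (rule trans[OF tensor_map_elem[OF clinear_id]], assumption, simp)

lemma cbilinear_tensor_lift_family:
  assumes B: "\<And>x. cbilinear (B x)" and lin: "\<And>y z. clinear (\<lambda>x. B x y z)"
  shows "cbilinear (\<lambda>x. tensor_lift (B x))"
proof (intro cbilinearI)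
  show "clinear (tensor_lift (B x))" for x
    by (rule clinear_tensor_lift[OF B])
  show "clinear (\<lambda>x. tensor_lift (B x) t)" for t
  proof (induction t rule: tensor_induct)
    case (elem y z)
    then show ?case by (simp add: tensor_lift_elem[OF B] lin)
  next
    case (add s t)
    then show ?case by (simp add: clinear_add[OF clinear_tensor_lift[OF B]] clinear_plus)
  qed
qed

lemma cbilinear_assoc_inner:
  "cbilinear (\<lambda>x. tensor_lift (\<lambda>y z. (x \<otimes> y) \<otimes> z))"
  by (intro cbilinear_tensor_lift_family cbilinearI)
    (simp_all add: clinear_iff tensor_simps)

lemma clinear_assoc: "clinear assoc"
  unfolding assoc_def by (rule clinear_tensor_lift[OF cbilinear_assoc_inner])

lemma assoc_elem [simp]: "assoc (x \<otimes> (y \<otimes> z)) = (x \<otimes> y) \<otimes> z"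
proof -
  have "cbilinear (\<lambda>y z. (x \<otimes> y) \<otimes> z)"
    by (intro cbilinearI) (simp_all add: clinear_iff tensor_simps)
  then have "tensor_lift (\<lambda>y z. (x \<otimes> y) \<otimes> z) (y \<otimes> z) = (x \<otimes> y) \<otimes> z"
    by (rule tensor_lift_elem)
  then show ?thesis
    unfolding assoc_def by (rule trans[OF tensor_lift_elem[OF cbilinear_assoc_inner]])
qed

lemma
  assumes \<mu>: "cbilinear \<mu>" and \<nu>: "cbilinear \<nu>"
  shows cbilinear_tensor_mult: "cbilinear (tensor_mult \<mu> \<nu>)"
    and tensor_mult_elem [simp]: "tensor_mult \<mu> \<nu> (x \<otimes> y) (x' \<otimes> y') = \<mu> x x' \<otimes> \<nu> y y'"
proof -
  have inner: "cbilinear (\<lambda>a' b'. \<mu> a a' \<otimes> \<nu> b b')" for a b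
    by (rule cbilinear_compose[OF cbilinear_tensor_elem cbilinear_right[OF \<mu>] cbilinear_right[OF \<nu>]])
  have lift: "clinear (tensor_lift (\<lambda>a' b'. \<mu> a a' \<otimes> \<nu> b b'))" for a b
    by (rule clinear_tensor_lift[OF inner])
  have "cbilinear (\<lambda>a. tensor_lift (\<lambda>a' b'. \<mu> a a' \<otimes> \<nu> b b'))" for b
    by (intro cbilinear_tensor_lift_family inner)
      (rule clinear_compose[OF cbilinear_left[OF cbilinear_tensor_elem] cbilinear_left[OF \<mu>]])
  moreover have "cbilinear (\<lambda>b. tensor_lift (\<lambda>a' b'. \<mu> a a' \<otimes> \<nu> b b'))" for a
    by (intro cbilinear_tensor_lift_family inner)
      (rule clinear_compose[OF cbilinear_right[OF cbilinear_tensor_elem] cbilinear_left[OF \<nu>]])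
  ultimately have outer: "cbilinear (\<lambda>a b. tensor_lift (\<lambda>a' b'. \<mu> a a' \<otimes> \<nu> b b') t)" for t
    by (auto simp: cbilinear_def)
  show elem: "tensor_mult \<mu> \<nu> (x \<otimes> y) (x' \<otimes> y') = \<mu> x x' \<otimes> \<nu> y y'"
    unfolding tensor_mult_def
    by (rule trans[OF tensor_lift_elem[OF outer] tensor_lift_elem[OF inner]])
  show "cbilinear (tensor_mult \<mu> \<nu>)"
  proof (intro cbilinearI)
    show "clinear (\<lambda>s. tensor_mult \<mu> \<nu> s t)" for t
      unfolding tensor_mult_def by (rule clinear_tensor_lift[OF outer])
    show "clinear (tensor_mult \<mu> \<nu> s)" for s
    proof (induction s rule: tensor_induct)
      case (elem a b)
      then show ?case
        unfolding tensor_mult_def by (simp add: tensor_lift_elem[OF outer] lift)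
    next
      case (add s t)
      then show ?case
        by (simp add: tensor_mult_def clinear_add[OF clinear_tensor_lift[OF outer]] clinear_plus)
    qed
  qed
qed

text \<open>
  The maps \<open>f \<otimes> g\<close>, \<open>f \<otimes> id\<close> and \<open>id \<otimes> g\<close> for functionals \<open>f\<close> and \<open>g\<close>, followed by the
  canonical identifications that remove the factors \<open>\<complex>\<close>.
\<close>

definition pairing :: "('a::complex_vector \<Rightarrow> complex) \<Rightarrow> ('b::complex_vector \<Rightarrow> complex) \<Rightarrow> 'a \<otimes> 'b \<Rightarrow> complex"
  where "pairing f g = tensor_lift (\<lambda>x y. f x * g y)"

definition lcontr :: "('a::complex_vector \<Rightarrow> complex) \<Rightarrow> 'a \<otimes> 'b::complex_vector \<Rightarrow> 'b"
  where "lcontr f = tensor_lift (\<lambda>x y. f x *\<^sub>C y)"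

definition rcontr :: "('b::complex_vector \<Rightarrow> complex) \<Rightarrow> 'a::complex_vector \<otimes> 'b \<Rightarrow> 'a"
  where "rcontr g = tensor_lift (\<lambda>x y. g y *\<^sub>C x)"

lemma
  assumes f: "clinear f" and g: "clinear g"
  shows clinear_pairing: "clinear (pairing f g)"
    and pairing_elem [simp]: "pairing f g (x \<otimes> y) = f x * g y"
proof -
  have "cbilinear (\<lambda>x y. f x * g y)"
    by (rule cbilinear_compose[OF cbilinear_times f g])
  then show "clinear (pairing f g)" "pairing f g (x \<otimes> y) = f x * g y"
    unfolding pairing_def by (simp_all add: clinear_tensor_lift tensor_lift_elem)
qed

lemma
  assumes f: "clinear f"
  shows clinear_lcontr: "clinear (lcontr f)"
    and lcontr_elem [simp]: "lcontr f (x \<otimes> y) = f x *\<^sub>C y"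
    and clinear_rcontr: "clinear (rcontr f)"
    and rcontr_elem [simp]: "rcontr f (y \<otimes> x) = f x *\<^sub>C y"
proof -
  have "cbilinear (\<lambda>x y. f x *\<^sub>C y)" "cbilinear (\<lambda>y x. f x *\<^sub>C y)"
    by (rule cbilinear_compose[OF cbilinear_scaleC f clinear_ident],
        rule cbilinear_compose[OF cbilinear_flip[OF cbilinear_scaleC] clinear_ident f])
  note B = this
  show "clinear (lcontr f)" "lcontr f (x \<otimes> y) = f x *\<^sub>C y"
    unfolding lcontr_def by (rule clinear_tensor_lift[OF B(1)], rule tensor_lift_elem[OF B(1)])
  show "clinear (rcontr f)" "rcontr f (y \<otimes> x) = f x *\<^sub>C y"
    unfolding rcontr_def by (rule clinear_tensor_lift[OF B(2)], rule tensor_lift_elem[OF B(2)])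
qed

lemma left_unitor_elem [simp]: "left_unitor (c \<otimes> x) = c *\<^sub>C x"
  and clinear_left_unitor: "clinear left_unitor"
  and right_unitor_elem [simp]: "right_unitor (x \<otimes> c) = c *\<^sub>C x"
  and clinear_right_unitor: "clinear right_unitor"
  unfolding left_unitor_def right_unitor_def
  by (rule tensor_lift_elem[OF cbilinear_scaleC], rule clinear_tensor_lift[OF cbilinear_scaleC],
      rule tensor_lift_elem[OF cbilinear_flip[OF cbilinear_scaleC]],
      rule clinear_tensor_lift[OF cbilinear_flip[OF cbilinear_scaleC]])

lemma left_unitor_tensor_map: "clinear f \<Longrightarrow> left_unitor (tensor_map f id t) = lcontr f t"
  by (rule tensor_eqI[OF clinear_compose[OF clinear_left_unitor clinear_tensor_map[OF _ clinear_id]] clinear_lcontr])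
    (simp_all only: tensor_map_id_right left_unitor_elem lcontr_elem)

lemma right_unitor_tensor_map: "clinear f \<Longrightarrow> right_unitor (tensor_map id f t) = rcontr f t"
  by (rule tensor_eqI[OF clinear_compose[OF clinear_right_unitor clinear_tensor_map[OF clinear_id]] clinear_rcontr])
    (simp_all only: tensor_map_id_left right_unitor_elem rcontr_elem)

lemma pairing_lcontr: "clinear f \<Longrightarrow> clinear g \<Longrightarrow> pairing f g t = g (lcontr f t)"
  by (rule tensor_eqI) (simp_all add: clinear_pairing clinear_compose clinear_lcontr clinear_scale)

lemma pairing_rcontr: "clinear f \<Longrightarrow> clinear g \<Longrightarrow> pairing f g t = f (rcontr g t)"
  by (rule tensor_eqI) (simp_all add: clinear_pairing clinear_compose clinear_rcontr clinear_scale)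


section \<open>Bases and coordinates\<close>

text \<open>
  A finite basis is given together with its coordinate functionals, because coordinates of tensors are
  computed by contracting with them.
\<close>

definition dual_basis :: "('n::finite \<Rightarrow> 'a::complex_vector) \<Rightarrow> ('n \<Rightarrow> 'a \<Rightarrow> complex) \<Rightarrow> bool"
  where "dual_basis p c \<longleftrightarrow> (\<forall>i. clinear (c i)) \<and> (\<forall>i j. c i (p j) = of_bool (i = j))
    \<and> (\<forall>x. (\<Sum>i\<in>UNIV. c i x *\<^sub>C p i) = x)"

lemma dual_basisD:
  assumes "dual_basis p c"
  shows "clinear (c i)" "c i (p j) = of_bool (i = j)" "(\<Sum>i\<in>UNIV. c i x *\<^sub>C p i) = x"
  using assms by (auto simp: dual_basis_def)

lemma dual_basis_eqI:
  assumes "dual_basis p c" "\<And>i. c i x = c i y"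
  shows "x = y"
proof -
  have "(\<Sum>i\<in>UNIV. c i x *\<^sub>C p i) = (\<Sum>i\<in>UNIV. c i y *\<^sub>C p i)"
    by (simp only: assms(2))
  then show ?thesis by (simp only: dual_basisD(3)[OF assms(1)])
qed

lemma dual_basis_clinear_eq_iff:
  assumes p: "dual_basis p c" and "clinear f" "clinear g"
  shows "(\<forall>x. f x = g x) \<longleftrightarrow> (\<forall>i. f (p i) = g (p i))"
proof (intro iffI allI)
  fix x
  assume "\<forall>i. f (p i) = g (p i)"
  then have "f (\<Sum>i\<in>UNIV. c i x *\<^sub>C p i) = g (\<Sum>i\<in>UNIV. c i x *\<^sub>C p i)"
    using assms(2,3) by (simp add: clinear_sum clinear_scale)
  then show "f x = g x" by (simp add: dual_basisD(3)[OF p])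
qed simp

text \<open>
  The coefficients of a tensor with respect to a basis of one leg are contractions of the tensor.
  For \<open>\<Delta>(1)\<close> these contractions lie in the base algebras.
\<close>

lemma tensor_expand_left:
  assumes p: "dual_basis p c"
  shows "(\<Sum>i\<in>UNIV. p i \<otimes> lcontr (c i) t) = t"
proof (induction t rule: tensor_induct)
  case (elem x y)
  have "(\<Sum>i\<in>UNIV. p i \<otimes> lcontr (c i) (x \<otimes> y)) = (\<Sum>i\<in>UNIV. c i x *\<^sub>C p i) \<otimes> y"
    by (simp add: dual_basisD(1)[OF p] tensor_simps)
  then show ?case by (simp add: dual_basisD(3)[OF p])
next
  case (add s t)
  then show ?case
    by (simp add: clinear_add[OF clinear_lcontr] dual_basisD(1)[OF p] tensor_simps sum.distrib)
qed

lemma tensor_expand_right: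
  assumes p: "dual_basis p c"
  shows "(\<Sum>i\<in>UNIV. rcontr (c i) t \<otimes> p i) = t"
proof (induction t rule: tensor_induct)
  case (elem x y)
  have "(\<Sum>i\<in>UNIV. rcontr (c i) (x \<otimes> y) \<otimes> p i) = x \<otimes> (\<Sum>i\<in>UNIV. c i y *\<^sub>C p i)"
    by (simp add: dual_basisD(1)[OF p] tensor_simps)
  then show ?case by (simp add: dual_basisD(3)[OF p])
next
  case (add s t)
  then show ?case
    by (simp add: clinear_add[OF clinear_rcontr] dual_basisD(1)[OF p] tensor_simps sum.distrib)
qed

lemma dual_basis_tensor:
  assumes p: "dual_basis p c" and q: "dual_basis q d"
  shows "dual_basis (\<lambda>(i, j). p i \<otimes> q j) (\<lambda>(i, j). pairing (c i) (d j))"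
  unfolding dual_basis_def
proof (intro conjI allI)
  note cl = dual_basisD(1)[OF p] dual_basisD(1)[OF q]
  show "clinear (case ij of (i, j) \<Rightarrow> pairing (c i) (d j))" for ij
    by (cases ij) (simp add: clinear_pairing cl)
  show "(case ij of (i, j) \<Rightarrow> pairing (c i) (d j)) (case kl of (k, l) \<Rightarrow> p k \<otimes> q l) = of_bool (ij = kl)" for ij kl
    by (cases ij; cases kl) (simp add: cl dual_basisD(2)[OF p] dual_basisD(2)[OF q])
  show "(\<Sum>ij\<in>UNIV. (case ij of (i, j) \<Rightarrow> pairing (c i) (d j)) t *\<^sub>C (case ij of (i, j) \<Rightarrow> p i \<otimes> q j)) = t" for t
  proof -
    have "(\<Sum>ij\<in>UNIV. (case ij of (i, j) \<Rightarrow> pairing (c i) (d j)) t *\<^sub>C (case ij of (i, j) \<Rightarrow> p i \<otimes> q j))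
      = (\<Sum>i\<in>UNIV. \<Sum>j\<in>UNIV. pairing (c i) (d j) t *\<^sub>C (p i \<otimes> q j))"
      by (simp add: UNIV_Times_UNIV[symmetric] sum.cartesian_product split_def del: UNIV_Times_UNIV)
    also have "\<dots> = (\<Sum>i\<in>UNIV. p i \<otimes> (\<Sum>j\<in>UNIV. d j (lcontr (c i) t) *\<^sub>C q j))"
      by (simp add: tensor_simps pairing_lcontr cl)
    also have "\<dots> = t"
      by (simp add: dual_basisD(3)[OF q] tensor_expand_left[OF p])
    finally show ?thesis .
  qed
qed

text \<open>
  By exchange: a vector outside the span of \<open>u\<close>, \<open>v\<close>, \<open>w\<close> would give four independent vectors in
  the span of three.
\<close>

lemma basis_of_independent_triple:
  fixes u v w :: "'a::complex_vector"
  assumes dim: "cdim (UNIV :: 'a set) = 3"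
    and ind: "\<And>a b c. a *\<^sub>C u + b *\<^sub>C v + c *\<^sub>C w = 0 \<Longrightarrow> a = 0 \<and> b = 0 \<and> c = 0"
  obtains f g h :: "'a \<Rightarrow> complex" where
    "clinear f" "clinear g" "clinear h"
    "f u = 1" "f v = 0" "f w = 0" "g u = 0" "g v = 1" "g w = 0" "h u = 0" "h v = 0" "h w = 1"
    "\<And>x. x = f x *\<^sub>C u + g x *\<^sub>C v + h x *\<^sub>C w"
proof -
  have ne: "u \<noteq> v" "u \<noteq> w" "v \<noteq> w"
    using ind[of 1 "-1" 0] ind[of 1 0 "-1"] ind[of 0 1 "-1"] by (auto simp: scaleC_one)
  let ?B = "{u, v, w}"
  have indep: "complex_vector.independent ?B"
    unfolding complex_vector.independent_explicit_finite_subsets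
  proof (intro allI impI ballI)
    fix S r x
    assume S: "S \<subseteq> ?B" "finite S" and 0: "(\<Sum>x\<in>S. r x *\<^sub>C x) = 0" and x: "x \<in> S"
    define r' where "r' x = (if x \<in> S then r x else 0)" for x
    have "(\<Sum>x\<in>S. r x *\<^sub>C x) = (\<Sum>x\<in>S. r' x *\<^sub>C x)"
      by (rule sum.cong) (auto simp: r'_def)
    also have "\<dots> = (\<Sum>x\<in>?B. r' x *\<^sub>C x)"
      by (rule sum.mono_neutral_left) (use S in \<open>auto simp: r'_def\<close>)
    also have "\<dots> = r' u *\<^sub>C u + r' v *\<^sub>C v + r' w *\<^sub>C w"
      using ne by (simp add: add.assoc)
    finally have "r' u = 0 \<and> r' v = 0 \<and> r' w = 0"
      using 0 by (intro ind) simp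
    moreover have "x = u \<or> x = v \<or> x = w" using S x by auto
    ultimately show "r x = 0"
      using x by (auto simp: r'_def)
  qed
  have card: "card ?B = 3" using ne by simp
  obtain C where C: "complex_vector.independent C" "(UNIV :: 'a set) \<subseteq> cspan C" "card C = 3"
    using complex_vector.basis_exists[of "UNIV :: 'a set"] dim by metis
  then have "finite C" by (metis card.infinite zero_neq_numeral)
  have span: "x \<in> cspan ?B" for x
  proof (rule ccontr)
    assume x: "x \<notin> cspan ?B"
    then have "complex_vector.independent (insert x ?B)"
      by (rule complex_vector.independent_insertI) (rule indep)
    then have "card (insert x ?B) \<le> card C"
      using complex_vector.independent_span_bound[OF \<open>finite C\<close>] C(2) by blast
    moreover have "x \<notin> ?B" using x complex_vector.span_base[of x ?B] by argo
    ultimately show False using card C(3) by simp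
  qed
  define R where "R b x = complex_vector.representation ?B x b" for b x
  have lin: "clinear (R b)" for b
    by (rule clinearI)
      (simp_all add: R_def complex_vector.representation_add complex_vector.representation_scale indep span)
  have R: "R b b' = of_bool (b = b')" if "b' \<in> ?B" for b b'
    using complex_vector.representation_basis[OF indep that] by (auto simp: R_def)
  have exp: "x = R u x *\<^sub>C u + R v x *\<^sub>C v + R w x *\<^sub>C w" for x
  proof -
    have "(\<Sum>b\<in>?B. R b x *\<^sub>C b) = x"
      unfolding R_def
      by (rule complex_vector.sum_representation_eq[OF indep span]) auto
    then show ?thesis using ne by (simp add: add.assoc)
  qed
  show thesis
    by (rule that[of "R u" "R v" "R w", OF lin lin lin]) (rule exp | use ne R in simp)+
qed

definition triple :: "'a \<Rightarrow> 'a \<Rightarrow> 'a \<Rightarrow> 3 \<Rightarrow> 'a"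
  where "triple u v w i = (if i = 1 then u else if i = 2 then v else w)"

lemma triple_simps [simp]: "triple u v w 1 = u" "triple u v w 2 = v" "triple u v w 3 = w"
  by (simp_all add: triple_def)

lemma dual_basis_triple:
  assumes "clinear f" "clinear g" "clinear h"
    "f u = 1" "f v = 0" "f w = 0" "g u = 0" "g v = 1" "g w = 0" "h u = 0" "h v = 0" "h w = 1"
    "\<And>x. x = f x *\<^sub>C u + g x *\<^sub>C v + h x *\<^sub>C w"
  shows "dual_basis (triple u v w) (triple f g h)"
proof -
  have "clinear (triple f g h i)" for i
    using exhaust_3[of i] assms(1-3) by auto
  moreover have "triple f g h i (triple u v w j) = of_bool (i = j)" for i j
    using exhaust_3[of i] exhaust_3[of j] assms(4-12) by auto
  moreover have "(\<Sum>i\<in>UNIV. triple f g h i x *\<^sub>C triple u v w i) = x" for x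
    by (simp only: sum_3 triple_simps) (rule assms(13)[symmetric])
  ultimately show ?thesis by (simp add: dual_basis_def)
qed

definition independent_triple :: "'a::complex_vector \<Rightarrow> 'a \<Rightarrow> 'a \<Rightarrow> bool"
  where "independent_triple u v w \<longleftrightarrow>
    (\<forall>a b c. a *\<^sub>C u + b *\<^sub>C v + c *\<^sub>C w = 0 \<longrightarrow> a = 0 \<and> b = 0 \<and> c = 0)"

lemma scaleC_cancel: "a *\<^sub>C x = y \<Longrightarrow> a \<noteq> 0 \<Longrightarrow> x = inverse a *\<^sub>C y"
  by (auto simp: scaleC_scaleC scaleC_one)

lemma independent_tripleI:
  assumes uv: "\<And>a b. a *\<^sub>C u + b *\<^sub>C v = 0 \<Longrightarrow> a = 0 \<and> b = 0" and w: "\<And>a b. w \<noteq> a *\<^sub>C u + b *\<^sub>C v"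
  shows "independent_triple u v w"
  unfolding independent_triple_def
proof (intro allI impI)
  fix a b c
  assume 0: "a *\<^sub>C u + b *\<^sub>C v + c *\<^sub>C w = 0"
  have "c = 0"
  proof (rule ccontr)
    assume c: "c \<noteq> 0"
    have "c *\<^sub>C w = - (a *\<^sub>C u + b *\<^sub>C v)"
      using 0 by (simp add: add_eq_0_iff)
    from scaleC_cancel[OF this c] have "w = (- inverse c * a) *\<^sub>C u + (- inverse c * b) *\<^sub>C v"
      by (simp add: scaleC_add_right scaleC_scaleC complex_vector.scale_right_diff_distrib)
    with w show False by blast
  qed
  with 0 uv show "a = 0 \<and> b = 0 \<and> c = 0" by simp
qed

lemma independent_triple_nonzero:
  assumes "independent_triple u v w"
  shows "w \<noteq> 0"
proof
  assume "w = 0"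
  then have "0 *\<^sub>C u + 0 *\<^sub>C v + 1 *\<^sub>C w = 0" by simp
  with assms have "(1 :: complex) = 0" unfolding independent_triple_def by blast
  then show False by simp
qed

section \<open>The base algebras of a weak Hopf algebra\<close>

lemmas contraction_simps =
  clinear_rules[OF clinear_lcontr] clinear_rules[OF clinear_rcontr]
  clinear_rules[OF clinear_pairing] clinear_rules[OF clinear_tensor_map]
  clinear_rules[OF clinear_assoc]

locale weak_hopf =
  fixes H :: "'a::complex_vector weak_hopf_data"
  assumes weak_hopf: "weak_hopf_algebra H"
begin

definition mul :: "'a \<Rightarrow> 'a \<Rightarrow> 'a" (infixl \<open>\<cdot>\<close> 70)
  where "mul = (\<lambda>x y. mult H (x \<otimes> y))"

definition mul2 :: "'a \<otimes> 'a \<Rightarrow> 'a \<otimes> 'a \<Rightarrow> 'a \<otimes> 'a" (infixl \<open>\<odot>\<close> 70)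
  where "mul2 = tensor_mult mul mul"

abbreviation \<Delta> :: "'a \<Rightarrow> 'a \<otimes> 'a" where "\<Delta> \<equiv> comult H"
abbreviation \<epsilon> :: "'a \<Rightarrow> complex" where "\<epsilon> \<equiv> counit H"
abbreviation S :: "'a \<Rightarrow> 'a" where "S \<equiv> antipode H"

definition one :: 'a (\<open>\<one>\<close>) where "\<one> = unit_map H 1"

abbreviation E :: "'a \<otimes> 'a" where "E \<equiv> \<Delta> \<one>"

lemma axioms_unfolded:
  shows clinear_mult: "clinear (mult H)"
    and mul_assoc: "(x \<cdot> y) \<cdot> z = x \<cdot> (y \<cdot> z)"
    and one_mul [simp]: "\<one> \<cdot> x = x"
    and mul_one [simp]: "x \<cdot> \<one> = x"
    and clinear_comult: "clinear \<Delta>"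
    and clinear_counit: "clinear \<epsilon>"
    and clinear_antipode: "clinear S"
    and coassoc: "tensor_map \<Delta> id (\<Delta> x) = assoc (tensor_map id \<Delta> (\<Delta> x))"
    and counit_left': "left_unitor (tensor_map \<epsilon> id (\<Delta> x)) = x"
    and counit_right': "right_unitor (tensor_map id \<epsilon> (\<Delta> x)) = x"
    and comult_mul: "\<Delta> (x \<cdot> y) = \<Delta> x \<odot> \<Delta> y"
    and comult_one: "tensor_map \<Delta> id E = tensor_mult mul2 mul (E \<otimes> \<one>) (assoc (\<one> \<otimes> E))"
    and comult_one': "tensor_map \<Delta> id E = tensor_mult mul2 mul (assoc (\<one> \<otimes> E)) (E \<otimes> \<one>)"
    and counit_mul: "\<epsilon> ((x \<cdot> y) \<cdot> z) = tensor_lift (\<lambda>u v. \<epsilon> (x \<cdot> u) * \<epsilon> (v \<cdot> z)) (\<Delta> y)"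
    and antipode_right': "mult H (tensor_map id S (\<Delta> x)) = left_unitor (tensor_map \<epsilon> id (E \<odot> (x \<otimes> \<one>)))"
  using weak_hopf
  unfolding weak_hopf_algebra_def weak_bialgebra_def unital_algebra_def counital_coalgebra_def Let_def
    mul2_def mul_def one_def
  by blast+

lemma cbilinear_mul: "cbilinear mul"
  unfolding mul_def by (rule cbilinear_post[OF cbilinear_tensor_elem clinear_mult])

lemma cbilinear_mul2: "cbilinear mul2"
  unfolding mul2_def by (intro cbilinear_tensor_mult cbilinear_mul)

lemma mul2_elem [simp]: "(x \<otimes> y) \<odot> (x' \<otimes> y') = (x \<cdot> x') \<otimes> (y \<cdot> y')"
  unfolding mul2_def by (rule tensor_mult_elem[OF cbilinear_mul cbilinear_mul])

lemma mul3_elem: "tensor_mult mul2 mul (s \<otimes> x) (t \<otimes> y) = (s \<odot> t) \<otimes> (x \<cdot> y)"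
  by (rule tensor_mult_elem[OF cbilinear_mul2 cbilinear_mul])

lemma cbilinear_mul3: "cbilinear (tensor_mult mul2 mul)"
  by (intro cbilinear_tensor_mult cbilinear_mul cbilinear_mul2)

lemmas mul_simps = cbilinear_rules[OF cbilinear_mul]
lemmas mul2_simps = cbilinear_rules[OF cbilinear_mul2]
lemmas mul3_simps = cbilinear_rules[OF cbilinear_mul3]
lemmas comult_simps = clinear_rules[OF clinear_comult]
lemmas counit_simps = clinear_rules[OF clinear_counit]
lemmas antipode_simps = clinear_rules[OF clinear_antipode]

lemmas multilinear_simps = mul_simps mul2_simps mul3_simps comult_simps counit_simps antipode_simps
  tensor_simps contraction_simps scaleC_add_right scaleC_add_left scaleC_scaleC

lemma mul2_assoc: "(r \<odot> s) \<odot> t = r \<odot> (s \<odot> t)"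
proof (induction r rule: tensor_induct)
  case (elem x y)
  show ?case
  proof (induction s rule: tensor_induct)
    case (elem x' y')
    show ?case
      by (induction t rule: tensor_induct) (simp_all add: mul_assoc mul2_simps)
  qed (simp add: mul2_simps)
qed (simp add: mul2_simps)

lemma one_mul2 [simp]: "(\<one> \<otimes> \<one>) \<odot> t = t"
  by (induction t rule: tensor_induct) (simp_all add: mul2_simps)

lemma mul2_one [simp]: "t \<odot> (\<one> \<otimes> \<one>) = t"
  by (induction t rule: tensor_induct) (simp_all add: mul2_simps)

lemma counit_left: "lcontr \<epsilon> (\<Delta> x) = x"
  and counit_right: "rcontr \<epsilon> (\<Delta> x) = x"
  using counit_left'[of x] counit_right'[of x]
  by (simp_all only: left_unitor_tensor_map[OF clinear_counit] right_unitor_tensor_map[OF clinear_counit])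

lemma E_idem: "E \<odot> E = E"
  using comult_mul[of \<one> \<one>] by simp

lemma counit_weak: "\<epsilon> (x \<cdot> z) = pairing (\<lambda>u. \<epsilon> (x \<cdot> u)) (\<lambda>v. \<epsilon> (v \<cdot> z)) E"
  using counit_mul[of x \<one> z] by (simp add: pairing_def)

lemma antipode_right: "tensor_lift (\<lambda>u v. u \<cdot> S v) (\<Delta> x) = lcontr \<epsilon> (E \<odot> (x \<otimes> \<one>))"
proof -
  have B: "cbilinear (\<lambda>u v. u \<cdot> S v)"
    by (rule cbilinear_compose[OF cbilinear_mul clinear_ident clinear_antipode])
  have "tensor_lift (\<lambda>u v. u \<cdot> S v) t = mult H (tensor_map id S t)" for t
    by (rule tensor_eqI[OF clinear_tensor_lift[OF B]
          clinear_compose[OF clinear_mult clinear_tensor_map[OF clinear_id clinear_antipode]]])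
      (rule trans[OF tensor_lift_elem[OF B]], simp only: tensor_map_id_left[OF clinear_antipode] mul_def)
  then show ?thesis
    using antipode_right'[of x] by (simp only: left_unitor_tensor_map[OF clinear_counit])
qed

text \<open>
  The functional \<open>f\<close> acts on \<open>H\<close> by \<open>lcontr f \<circ> \<Delta>\<close>. Coassociativity says that composing two such
  actions is acting by the convolution product, so convolution inverses give inverse maps.
\<close>

lemma lcontr_coassoc:
  assumes f: "clinear f" and g: "clinear g"
  shows "lcontr g (\<Delta> (lcontr f (\<Delta> x))) = lcontr (\<lambda>z. pairing f g (\<Delta> z)) (\<Delta> x)"
proof -
  have fg: "clinear (\<lambda>z. pairing f g (\<Delta> z))"
    by (rule clinear_compose[OF clinear_pairing[OF f g] clinear_comult])
  have 1: "lcontr (pairing f g) (tensor_map \<Delta> id t) = lcontr (\<lambda>z. pairing f g (\<Delta> z)) t" for t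
    by (rule tensor_eqI[OF clinear_compose[OF clinear_lcontr[OF clinear_pairing[OF f g]]
          clinear_tensor_map[OF clinear_comult clinear_id]] clinear_lcontr[OF fg]])
      (simp only: tensor_map_id_right[OF clinear_comult] lcontr_elem[OF fg]
        lcontr_elem[OF clinear_pairing[OF f g]])
  have 2: "lcontr (pairing f g) (assoc (u \<otimes> s)) = f u *\<^sub>C lcontr g s" for u s
    by (induction s rule: tensor_induct)
      (simp_all add: f g clinear_pairing contraction_simps tensor_simps scaleC_scaleC scaleC_add_right)
  have 3: "lcontr (pairing f g) (assoc (tensor_map id \<Delta> t)) = lcontr g (\<Delta> (lcontr f t))" for t
  proof (induction t rule: tensor_induct)
    case (elem u v)
    then show ?case
      by (simp only: tensor_map_id_left[OF clinear_comult] 2)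
        (simp add: f g comult_simps contraction_simps)
  next
    case (add s t)
    then show ?case
      by (simp only: contraction_simps clinear_id clinear_comult f g comult_simps clinear_pairing)
  qed
  show ?thesis
    using coassoc[of x] by (simp only: 1[symmetric] 3[symmetric])
qed

text \<open>
  The source and target base algebras. They are usually introduced as the images of the projections
  \<open>x \<mapsto> 1\<^sub>1 \<epsilon>(x 1\<^sub>2)\<close> and \<open>x \<mapsto> \<epsilon>(1\<^sub>1 x) 1\<^sub>2\<close>; the description by the comultiplication makes
  it evident that they are subalgebras, and it is the form in which they are used.
\<close>

definition Hs :: "'a set" where "Hs = {a. (\<one> \<otimes> a) \<odot> E = \<Delta> a \<and> E \<odot> (\<one> \<otimes> a) = \<Delta> a}"
definition Ht :: "'a set" where "Ht = {b. (b \<otimes> \<one>) \<odot> E = \<Delta> b \<and> E \<odot> (b \<otimes> \<one>) = \<Delta> b}"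

text \<open>
  The two axioms on \<open>(\<Delta> \<otimes> id) \<Delta>(1)\<close>, contracted in the third leg.
\<close>

lemma rcontr_E_in_Hs:
  assumes f: "clinear f"
  shows "rcontr f E \<in> Hs"
proof -
  have 1: "rcontr f (tensor_map \<Delta> id t) = \<Delta> (rcontr f t)" for t :: "'a \<otimes> 'a"
    by (rule tensor_eqI[OF clinear_compose[OF clinear_rcontr[OF f]
          clinear_tensor_map[OF clinear_comult clinear_id]] clinear_compose[OF clinear_comult clinear_rcontr[OF f]]])
      (simp only: tensor_map_id_right[OF clinear_comult] rcontr_elem[OF f] comult_simps)
  have 2: "rcontr f (tensor_mult mul2 mul (s \<otimes> \<one>) (assoc (\<one> \<otimes> t))) = s \<odot> (\<one> \<otimes> rcontr f t)" for s t
    by (induction t rule: tensor_induct) (simp_all add: f mul3_elem multilinear_simps)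
  have 3: "rcontr f (tensor_mult mul2 mul (assoc (\<one> \<otimes> t)) (s \<otimes> \<one>)) = (\<one> \<otimes> rcontr f t) \<odot> s" for s t
    by (induction t rule: tensor_induct) (simp_all add: f mul3_elem multilinear_simps)
  show ?thesis
    unfolding Hs_def using comult_one comult_one' 1[of E] 2[of E E] 3[of E E] by simp
qed

text \<open>
  The same axioms contracted in the first leg, once coassociativity has turned
  \<open>(\<Delta> \<otimes> id) \<Delta>(1)\<close> into \<open>(id \<otimes> \<Delta>) \<Delta>(1)\<close>.
\<close>

lemma lcontr_E_in_Ht:
  assumes f: "clinear f"
  shows "lcontr f E \<in> Ht"
proof -
  let ?F = "tensor_map (lcontr f) id :: ('a \<otimes> 'a) \<otimes> 'a \<Rightarrow> 'a \<otimes> 'a"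
  note F = clinear_tensor_map[OF clinear_lcontr[OF f] clinear_id]
  note F_elem = tensor_map_id_right[OF clinear_lcontr[OF f]]
  have 0: "?F (assoc (x \<otimes> s)) = f x *\<^sub>C s" for x and s :: "'a \<otimes> 'a"
  proof (induction s rule: tensor_induct)
    case (elem y z)
    show ?case by (simp only: assoc_elem F_elem lcontr_elem[OF f] tensor_simps)
  next
    case (add s t)
    then show ?case by (simp only: multilinear_simps clinear_rules[OF F])
  qed
  have 1: "?F (assoc (tensor_map id \<Delta> t)) = \<Delta> (lcontr f t)" for t :: "'a \<otimes> 'a"
  proof (induction t rule: tensor_induct)
    case (elem x y)
    show ?case
      by (simp only: tensor_map_id_left[OF clinear_comult] 0 lcontr_elem[OF f] comult_simps)
  next
    case (add s t)
    then show ?case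
      by (simp only: clinear_add[OF clinear_tensor_map[OF clinear_id clinear_comult]]
          clinear_add[OF clinear_assoc] clinear_rules[OF F] clinear_add[OF clinear_lcontr[OF f]] comult_simps)
  qed
  have 2: "?F (tensor_mult mul2 mul (s \<otimes> \<one>) (assoc (\<one> \<otimes> t))) = (lcontr f s \<otimes> \<one>) \<odot> t"
    and 3: "?F (tensor_mult mul2 mul (assoc (\<one> \<otimes> t)) (s \<otimes> \<one>)) = t \<odot> (lcontr f s \<otimes> \<one>)" for s t
  proof (atomize (full), induction t rule: tensor_induct)
    case (elem x y)
    show ?case
    proof (induction s rule: tensor_induct)
      case (elem x' y')
      show ?case
        by (simp only: assoc_elem mul3_elem mul2_elem F_elem lcontr_elem[OF f] multilinear_simps
            one_mul mul_one simp_thms)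
    next
      case (add s s')
      then show ?case
        by (simp only: multilinear_simps clinear_rules[OF F] clinear_add[OF clinear_lcontr[OF f]] simp_thms)
    qed
  next
    case (add t t')
    then show ?case
      by (simp only: multilinear_simps clinear_rules[OF F] clinear_add[OF clinear_lcontr[OF f]] simp_thms)
  qed
  have "\<Delta> (lcontr f E) = ?F (tensor_map \<Delta> id E)"
    using coassoc[of \<one>] 1[of E] by simp
  then show ?thesis
    unfolding Ht_def using comult_one comult_one' 2[of E E] 3[of E E] by simp
qed

text \<open>
  Since \<open>\<Delta> b\<close> is \<open>E\<close> multiplied by \<open>b\<close> in the first leg only, and \<open>\<one> \<otimes> a\<close> commutes with \<open>E\<close>,
  it commutes with \<open>\<Delta> b\<close> as well. The counit in the first leg turns this into a statement about
  \<open>a\<close> and \<open>b\<close>.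
\<close>

lemma Hs_Ht_commute:
  assumes a: "a \<in> Hs" and b: "b \<in> Ht"
  shows "a \<cdot> b = b \<cdot> a"
proof -
  have l: "lcontr \<epsilon> (t \<odot> (\<one> \<otimes> y)) = lcontr \<epsilon> t \<cdot> y" "lcontr \<epsilon> ((\<one> \<otimes> y) \<odot> t) = y \<cdot> lcontr \<epsilon> t" for t y
    by (induction t rule: tensor_induct) (simp_all add: clinear_counit multilinear_simps)
  have "E \<odot> (\<one> \<otimes> a) = (\<one> \<otimes> a) \<odot> E"
    using a by (auto simp: Hs_def Ht_def)
  have "lcontr \<epsilon> (\<Delta> b \<odot> (\<one> \<otimes> a)) = lcontr \<epsilon> ((b \<otimes> \<one>) \<odot> (E \<odot> (\<one> \<otimes> a)))"
    using b by (simp add: Ht_def mul2_assoc[symmetric])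
  also have "\<dots> = lcontr \<epsilon> ((b \<otimes> \<one>) \<odot> ((\<one> \<otimes> a) \<odot> E))"
    by (simp only: \<open>E \<odot> (\<one> \<otimes> a) = (\<one> \<otimes> a) \<odot> E\<close>)
  also have "\<dots> = lcontr \<epsilon> ((\<one> \<otimes> a) \<odot> ((b \<otimes> \<one>) \<odot> E))"
    by (simp only: mul2_assoc[symmetric] mul2_elem one_mul mul_one)
  also have "\<dots> = lcontr \<epsilon> ((\<one> \<otimes> a) \<odot> \<Delta> b)"
    using b by (simp add: Ht_def)
  finally show ?thesis by (simp add: l counit_left)
qed

lemma one_in_bases: "\<one> \<in> Hs" "\<one> \<in> Ht"
  by (simp_all add: Hs_def Ht_def)

lemma Hs_add: "x \<in> Hs \<Longrightarrow> y \<in> Hs \<Longrightarrow> x + y \<in> Hs"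
  and Hs_scale: "x \<in> Hs \<Longrightarrow> c *\<^sub>C x \<in> Hs"
  and Ht_add: "x \<in> Ht \<Longrightarrow> y \<in> Ht \<Longrightarrow> x + y \<in> Ht"
  and Ht_scale: "x \<in> Ht \<Longrightarrow> c *\<^sub>C x \<in> Ht"
  unfolding Hs_def Ht_def by (simp_all add: multilinear_simps)

lemma Hs_mul:
  assumes "x \<in> Hs" "y \<in> Hs"
  shows "x \<cdot> y \<in> Hs"
proof -
  have "\<one> \<otimes> (x \<cdot> y) = (\<one> \<otimes> x) \<odot> (\<one> \<otimes> y)" by simp
  moreover have "E \<odot> (\<one> \<otimes> x) = (\<one> \<otimes> x) \<odot> E" "E \<odot> (\<one> \<otimes> y) = (\<one> \<otimes> y) \<odot> E"
    using assms by (auto simp: Hs_def)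
  ultimately show ?thesis
    using assms E_idem unfolding Hs_def mem_Collect_eq comult_mul by (smt (verit) mul2_assoc)
qed

lemma Ht_mul:
  assumes "x \<in> Ht" "y \<in> Ht"
  shows "x \<cdot> y \<in> Ht"
proof -
  have "(x \<cdot> y) \<otimes> \<one> = (x \<otimes> \<one>) \<odot> (y \<otimes> \<one>)" by simp
  moreover have "E \<odot> (x \<otimes> \<one>) = (x \<otimes> \<one>) \<odot> E" "E \<odot> (y \<otimes> \<one>) = (y \<otimes> \<one>) \<odot> E"
    using assms by (auto simp: Ht_def)
  ultimately show ?thesis
    using assms E_idem unfolding Ht_def mem_Collect_eq comult_mul by (smt (verit) mul2_assoc)
qed

end

section \<open>Idempotents in a three-dimensional algebra\<close>

locale weak_hopf_dim3 = weak_hopf H for H :: "'a::complex_vector weak_hopf_data" +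
  assumes dim3: "cdim (UNIV :: 'a set) = 3"
begin

text \<open>
  This says that the algebra is isomorphic to \<open>\<complex>\<^sup>3\<close>.
\<close>

definition split :: bool
  where "split \<longleftrightarrow> (\<exists>(p :: 3 \<Rightarrow> 'a) c. dual_basis p c \<and> (\<forall>i j. p i \<cdot> p j = (if i = j then p i else 0)))"

lemma coordinates:
  assumes "independent_triple u v (w :: 'a)"
  obtains f g h :: "'a \<Rightarrow> complex" where
    "clinear f" "clinear g" "clinear h"
    "f u = 1" "f v = 0" "f w = 0" "g u = 0" "g v = 1" "g w = 0" "h u = 0" "h v = 0" "h w = 1"
    "\<And>x. x = f x *\<^sub>C u + g x *\<^sub>C v + h x *\<^sub>C w"
  by (rule basis_of_independent_triple[OF dim3, of u v w])
    (use assms that in \<open>auto simp: independent_triple_def\<close>)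

lemma triple_spans:
  assumes "independent_triple u v (w :: 'a)"
  shows "\<exists>a b c. x = a *\<^sub>C u + b *\<^sub>C v + c *\<^sub>C w"
  by (rule coordinates[OF assms]) blast

lemma span_triple:
  assumes "independent_triple u v (w :: 'a)"
  obtains a b c where "x = a *\<^sub>C u + b *\<^sub>C v + c *\<^sub>C w"
  using triple_spans[OF assms, of x] that by blast

lemma outside_plane:
  fixes u v :: 'a
  shows "\<exists>w. \<forall>a b. w \<noteq> a *\<^sub>C u + b *\<^sub>C v"
proof (rule ccontr)
  assume "\<not> ?thesis"
  then have *: "\<exists>a b. w = a *\<^sub>C u + b *\<^sub>C v" for w :: 'a
    by blast
  have "w \<in> cspan {u, v}" for w :: 'a
  proof -
    from * obtain a b where "w = a *\<^sub>C u + b *\<^sub>C v" by blast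
    then show ?thesis
      by (simp only:) (intro complex_vector.span_add complex_vector.span_scale complex_vector.span_base; simp)
  qed
  then have "cdim (UNIV :: 'a set) \<le> card {u, v}"
    by (intro complex_vector.dim_le_card) auto
  also have "\<dots> \<le> 2" by (simp add: card_insert_if)
  finally show False using dim3 by simp
qed

lemma dual_basis_exists: obtains p :: "3 \<Rightarrow> 'a" and c where "dual_basis p c"
proof -
  obtain u :: 'a where u: "u \<noteq> 0" using outside_plane[of 0 0] by (metis add_0 complex_vector.scale_zero_right)
  obtain v :: 'a where v: "\<And>a. v \<noteq> a *\<^sub>C u"
    using outside_plane[of u 0] by (metis add.right_neutral complex_vector.scale_zero_right)
  obtain w :: 'a where w: "\<And>a b. w \<noteq> a *\<^sub>C u + b *\<^sub>C v" using outside_plane[of u v] by metis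
  have "a = 0 \<and> b = 0" if 0: "a *\<^sub>C u + b *\<^sub>C v = 0" for a b
  proof (cases "b = 0")
    case True
    with 0 u show ?thesis by simp
  next
    case False
    have "b *\<^sub>C v = - (a *\<^sub>C u)" using 0 by (simp add: add_eq_0_iff2 add.commute)
    from scaleC_cancel[OF this False] have "v = (- inverse b * a) *\<^sub>C u"
      by (simp add: scaleC_scaleC)
    with v show ?thesis by blast
  qed
  then have "independent_triple u v w" using w by (rule independent_tripleI)
  from coordinates[OF this] show thesis using dual_basis_triple[THEN that] by metis
qed

lemma splitI:
  assumes nz: "p \<noteq> 0" "q \<noteq> 0" "r \<noteq> 0"
    and idem: "p \<cdot> p = p" "q \<cdot> q = q" "r \<cdot> r = r"
    and orth: "p \<cdot> q = 0" "q \<cdot> p = 0" "p \<cdot> r = 0" "r \<cdot> p = 0" "q \<cdot> r = 0" "r \<cdot> q = 0"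
  shows split
proof -
  have "independent_triple p q r"
    unfolding independent_triple_def
  proof (intro allI impI)
    fix a b c
    assume 0: "a *\<^sub>C p + b *\<^sub>C q + c *\<^sub>C r = 0"
    have "x \<cdot> (a *\<^sub>C p + b *\<^sub>C q + c *\<^sub>C r) = 0" for x
      by (simp add: 0 mul_simps)
    from this[of p] this[of q] this[of r] show "a = 0 \<and> b = 0 \<and> c = 0"
      using nz by (simp add: mul_simps idem orth)
  qed
  then obtain f g h where "clinear f" "clinear g" "clinear h"
    "f p = 1" "f q = 0" "f r = 0" "g p = 0" "g q = 1" "g r = 0" "h p = 0" "h q = 0" "h r = 1"
    "\<And>x. x = f x *\<^sub>C p + g x *\<^sub>C q + h x *\<^sub>C r"
    by (rule coordinates) blast
  then have "dual_basis (triple p q r) (triple f g h)" by (rule dual_basis_triple)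
  moreover have "triple p q r i \<cdot> triple p q r j = (if i = j then triple p q r i else 0)" for i j
    using exhaust_3[of i] exhaust_3[of j] by (auto simp: idem orth)
  ultimately show ?thesis unfolding split_def by blast
qed

lemma idempotent_independent:
  assumes e: "e \<cdot> e = e" "e \<noteq> 0" "e \<noteq> \<one>" and 0: "a *\<^sub>C \<one> + b *\<^sub>C e = 0"
  shows "a = 0 \<and> b = 0"
proof -
  have "(a + b) *\<^sub>C e = (a *\<^sub>C \<one> + b *\<^sub>C e) \<cdot> e"
    by (simp add: mul_simps e scaleC_add_left)
  then have "a + b = 0" using 0 e(2) by (simp add: mul_simps)
  then have "b = - a" by (simp add: add_eq_0_iff)
  then have "a *\<^sub>C (\<one> - e) = 0" using 0 by (simp add: complex_vector.scale_right_diff_distrib)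
  with e(3) \<open>b = - a\<close> show ?thesis by simp
qed

text \<open>
  The product \<open>y \<cdot> y\<close> is a combination of \<open>e\<close> and \<open>y\<close>, so completing the square gives \<open>z\<close> with
  \<open>z \<cdot> z = n e\<close>. If \<open>n \<noteq> 0\<close>, then \<open>w = z / sqrt n\<close> is an involution of the corner \<open>eAe\<close>, and
  \<open>(e + w) / 2\<close>, \<open>(e - w) / 2\<close>, \<open>\<one> - e\<close> split the algebra.
\<close>

lemma split_or_square_zero:
  assumes e: "e \<cdot> e = e" "e \<noteq> 0" "e \<noteq> \<one>"
    and y: "e \<cdot> y = y" "y \<cdot> e = y" "\<And>a b. y \<noteq> a *\<^sub>C \<one> + b *\<^sub>C e"
  shows "split \<or> (\<exists>z c. z = y - c *\<^sub>C e \<and> z \<cdot> z = 0)"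
proof -
  have "independent_triple \<one> e y"
    using idempotent_independent[OF e] y(3) by (rule independent_tripleI)
  then obtain a b c where sq: "y \<cdot> y = a *\<^sub>C \<one> + b *\<^sub>C e + c *\<^sub>C y"
    by (rule span_triple)
  have "y \<cdot> y = e \<cdot> (y \<cdot> y)" by (simp add: mul_assoc[symmetric] y)
  also have "\<dots> = (a + b) *\<^sub>C e + c *\<^sub>C y"
    by (simp add: sq mul_simps e y scaleC_add_left)
  finally have sq: "y \<cdot> y = (a + b) *\<^sub>C e + c *\<^sub>C y" .
  define z where "z = y - (c / 2) *\<^sub>C e"
  define n where "n = a + b + (c / 2)^2"
  have ez: "e \<cdot> z = z" "z \<cdot> e = z" by (simp_all add: z_def mul_simps e y)
  have "z \<cdot> z = y \<cdot> y - (c/2 + c/2) *\<^sub>C y + (c/2 * (c/2)) *\<^sub>C e"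
    unfolding z_def scaleC_add_left
    by (simp add: mul_simps e y scaleC_scaleC complex_vector.scale_right_diff_distrib)
  also have "\<dots> = n *\<^sub>C e"
    by (simp add: sq n_def scaleC_add_left power2_eq_square)
  finally have zz: "z \<cdot> z = n *\<^sub>C e" .
  show ?thesis
  proof (cases "n = 0")
    case True
    with zz show ?thesis using z_def by auto
  next
    case False
    define w where "w = (inverse (csqrt n)) *\<^sub>C z"
    have "inverse (csqrt n) * (inverse (csqrt n) * n) = 1"
      using False power2_csqrt[of n] by (simp add: field_simps power2_eq_square)
    then have ww: "w \<cdot> w = e" "e \<cdot> w = w" "w \<cdot> e = w"
      by (simp_all add: w_def mul_simps zz ez scaleC_scaleC scaleC_one)
    have wne: "w \<noteq> k *\<^sub>C e" for k
    proof
      assume "w = k *\<^sub>C e"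
      then have "z = (csqrt n * k) *\<^sub>C e"
        using False unfolding w_def by (metis csqrt_eq_0 scaleC_cancel inverse_inverse_eq inverse_zero_imp_zero scaleC_scaleC)
      then have "y = 0 *\<^sub>C \<one> + (csqrt n * k + c/2) *\<^sub>C e"
        unfolding z_def by (simp add: scaleC_add_left algebra_simps)
      with y(3) show False by blast
    qed
    have h: "x = (1/2) *\<^sub>C (x + x)" for x :: 'a
      by (simp add: scaleC_add_right scaleC_add_left[symmetric] scaleC_one)
    define p where "p = (1/2) *\<^sub>C (e + w)"
    define q where "q = (1/2) *\<^sub>C (e - w)"
    have pw: "(e + w) \<cdot> (e + w) = (e + w) + (e + w)" "(e - w) \<cdot> (e - w) = (e - w) + (e - w)"
      "(e + w) \<cdot> (e - w) = 0" "(e - w) \<cdot> (e + w) = 0"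
      by (simp_all add: mul_simps ww e)
    have pq: "p \<cdot> p = p" "q \<cdot> q = q" "p \<cdot> q = 0" "q \<cdot> p = 0"
      by (simp_all only: p_def q_def mul_simps(2,8) pw h[symmetric] complex_vector.scale_zero_right)
    have "p \<noteq> 0" "q \<noteq> 0"
      using wne[of "-1"] wne[of 1] by (auto simp: p_def q_def scaleC_one add_eq_0_iff)
    moreover have "\<one> - e \<noteq> 0" using e by simp
    ultimately have split
      by (rule splitI) (simp_all add: pq, simp_all add: p_def q_def mul_simps e ww)
    then show ?thesis by blast
  qed
qed

text \<open>
  Peirce decomposition with respect to \<open>e\<close>: some corner contains a vector outside the span of
  \<open>\<one>\<close> and \<open>e\<close>, and after completing the square this vector splits the algebra or has square zero.
\<close>

lemma peirce:
  assumes e: "e \<cdot> e = e" "e \<noteq> 0" "e \<noteq> \<one>"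
  shows "split \<or> (\<exists>y \<alpha> \<beta>. independent_triple \<one> e y \<and> y \<cdot> y = 0 \<and>
    e \<cdot> y = \<alpha> *\<^sub>C y \<and> y \<cdot> e = \<beta> *\<^sub>C y \<and> \<alpha> \<in> {0, 1} \<and> \<beta> \<in> {0, 1})"
proof -
  define f where "f = \<one> - e"
  have f: "f \<cdot> f = f" "e \<cdot> f = 0" "f \<cdot> e = 0" "f \<noteq> 0" "f \<noteq> \<one>" "e + f = \<one>"
    using e by (auto simp: f_def mul_simps)
  have a2: "e \<cdot> (e \<cdot> x) = e \<cdot> x" "f \<cdot> (f \<cdot> x) = f \<cdot> x" "e \<cdot> (f \<cdot> x) = 0" "f \<cdot> (e \<cdot> x) = 0" for x
    by (simp_all only: mul_assoc[symmetric] e f, simp_all add: mul_simps)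
  let ?in = "\<lambda>x. \<exists>a b. x = a *\<^sub>C \<one> + b *\<^sub>C e"
  obtain z where "\<And>a b. z \<noteq> a *\<^sub>C \<one> + b *\<^sub>C e"
    using outside_plane[of \<one> e] by blast
  then have z: "\<not> ?in z" by simp
  have in_add: "?in (x + y)" if "?in x" "?in y" for x y
  proof -
    from that obtain a b c d where "x = a *\<^sub>C \<one> + b *\<^sub>C e" "y = c *\<^sub>C \<one> + d *\<^sub>C e" by blast
    then have "x + y = (a + c) *\<^sub>C \<one> + (b + d) *\<^sub>C e" by (simp add: scaleC_add_left)
    then show ?thesis by blast
  qed
  have "z = (e + f) \<cdot> z \<cdot> (e + f)" by (simp add: f)
  also have "\<dots> = e \<cdot> z \<cdot> e + e \<cdot> z \<cdot> f + (f \<cdot> z \<cdot> e + f \<cdot> z \<cdot> f)"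
    by (simp only: mul_simps ac_simps)
  finally have "\<not> ?in (e \<cdot> z \<cdot> e) \<or> \<not> ?in (e \<cdot> z \<cdot> f) \<or> \<not> ?in (f \<cdot> z \<cdot> e) \<or> \<not> ?in (f \<cdot> z \<cdot> f)"
    using z in_add by metis
  then consider (ee) y where "\<not> ?in y" "e \<cdot> y = y" "y \<cdot> e = y"
    | (ef) y where "\<not> ?in y" "e \<cdot> y = y" "y \<cdot> e = 0"
    | (fe) y where "\<not> ?in y" "e \<cdot> y = 0" "y \<cdot> e = y"
    | (ff) y where "\<not> ?in y" "f \<cdot> y = y" "y \<cdot> f = y"
  proof (elim disjE, goal_cases)
    case 1 then show ?case using ee by (simp add: mul_assoc a2 e f mul_simps)
  next
    case 2 then show ?case using ef by (simp add: mul_assoc a2 e f mul_simps)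
  next
    case 3 then show ?case using fe by (simp add: mul_assoc a2 e f mul_simps)
  next
    case 4 then show ?case using ff by (simp add: mul_assoc a2 e f mul_simps)
  qed
  then show ?thesis
  proof cases
    case ee
    from split_or_square_zero[OF e ee(2,3)] ee(1) consider split
      | c where "(y - c *\<^sub>C e) \<cdot> (y - c *\<^sub>C e) = 0" by blast
    then show ?thesis
    proof cases
      case (2 c)
      let ?y = "y - c *\<^sub>C e"
      have "?y \<noteq> a *\<^sub>C \<one> + b *\<^sub>C e" for a b
      proof
        assume "?y = a *\<^sub>C \<one> + b *\<^sub>C e"
        then have "y = a *\<^sub>C \<one> + (b + c) *\<^sub>C e" by (simp add: scaleC_add_left diff_eq_eq add.assoc)
        with ee(1) show False by blast
      qed
      with idempotent_independent[OF e] have "independent_triple \<one> e ?y"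
        by (intro independent_tripleI)
      moreover have "e \<cdot> ?y = 1 *\<^sub>C ?y" "?y \<cdot> e = 1 *\<^sub>C ?y"
        by (simp_all add: mul_simps ee e scaleC_one)
      ultimately show ?thesis using 2 by blast
    qed simp
  next
    case ef
    have "y \<cdot> y = 0"
      using mul_assoc[of y e y] by (simp add: ef mul_simps)
    moreover have "independent_triple \<one> e y"
      using idempotent_independent[OF e] ef(1) by (intro independent_tripleI) auto
    moreover have "e \<cdot> y = 1 *\<^sub>C y" "y \<cdot> e = 0 *\<^sub>C y" by (simp_all add: ef scaleC_one)
    ultimately show ?thesis by blast
  next
    case fe
    have "y \<cdot> y = 0"
      using mul_assoc[of y e y] by (simp add: fe mul_simps)
    moreover have "independent_triple \<one> e y"
      using idempotent_independent[OF e] fe(1) by (intro independent_tripleI) auto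
    moreover have "e \<cdot> y = 0 *\<^sub>C y" "y \<cdot> e = 1 *\<^sub>C y" by (simp_all add: fe scaleC_one)
    ultimately show ?thesis by blast
  next
    case ff
    have in_f: "?in x" if "x = a *\<^sub>C \<one> + b *\<^sub>C f" for x a b
    proof -
      have "x = (a + b) *\<^sub>C \<one> + (- b) *\<^sub>C e"
        using that by (simp add: f_def scaleC_add_left complex_vector.scale_right_diff_distrib)
      then show ?thesis by blast
    qed
    from split_or_square_zero[OF f(1,4,5) ff(2,3)] ff(1) in_f consider split
      | c where "(y - c *\<^sub>C f) \<cdot> (y - c *\<^sub>C f) = 0" by blast
    then show ?thesis
    proof cases
      case (2 c)
      let ?y = "y - c *\<^sub>C f"
      have "?y \<noteq> a *\<^sub>C \<one> + b *\<^sub>C e" for a b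
      proof
        assume "?y = a *\<^sub>C \<one> + b *\<^sub>C e"
        then have "y = (a + c) *\<^sub>C \<one> + (b - c) *\<^sub>C e"
          by (simp add: f_def scaleC_add_left complex_vector.scale_left_diff_distrib
              complex_vector.scale_right_diff_distrib algebra_simps)
        with ff(1) show False by blast
      qed
      with idempotent_independent[OF e] have "independent_triple \<one> e ?y"
        by (intro independent_tripleI)
      moreover have "e \<cdot> y = e \<cdot> (f \<cdot> y)" "y \<cdot> e = (y \<cdot> f) \<cdot> e" by (simp_all only: ff)
      then have "e \<cdot> y = 0" "y \<cdot> e = 0" by (simp_all add: a2 mul_assoc f mul_simps)
      then have "e \<cdot> ?y = 0 *\<^sub>C ?y" "?y \<cdot> e = 0 *\<^sub>C ?y"
        by (simp_all add: mul_simps f)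
      ultimately show ?thesis using 2 by blast
    qed simp
  qed
qed

text \<open>
  If \<open>k \<noteq> 0\<close>, then \<open>(a\<^sup>2 - l a) / k\<close> is a unit for the span of \<open>a\<close> and \<open>a\<^sup>2\<close>. If \<open>k = 0\<close> but
  \<open>l \<noteq> 0\<close>, then \<open>a\<close> acts on \<open>a\<^sup>2\<close> as the scalar \<open>l\<close>, so \<open>a\<^sup>2 / l\<^sup>2\<close> is idempotent.
\<close>

lemma cubic_idempotent:
  assumes ind: "independent_triple \<one> a (a \<cdot> a)"
    and cubic: "a \<cdot> (a \<cdot> a) = k *\<^sub>C a + l *\<^sub>C (a \<cdot> a)"
  shows "a \<cdot> (a \<cdot> a) = 0 \<or> (\<exists>e s t. e = s *\<^sub>C a + t *\<^sub>C (a \<cdot> a) \<and> e \<cdot> e = e \<and> e \<noteq> 0)"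
proof -
  have st: "s = 0 \<and> t = 0" if "s *\<^sub>C a + t *\<^sub>C (a \<cdot> a) = 0" for s t
    using ind that unfolding independent_triple_def
    by (metis add_0 complex_vector.scale_zero_left)
  have quart: "a \<cdot> (a \<cdot> (a \<cdot> a)) = k *\<^sub>C (a \<cdot> a) + l *\<^sub>C (a \<cdot> (a \<cdot> a))"
    by (subst cubic) (simp only: mul_simps)
  consider "k \<noteq> 0" | "k = 0" "l \<noteq> 0" | "k = 0" "l = 0" by blast
  then show ?thesis
  proof cases
    case 1
    define e where "e = (- l / k) *\<^sub>C a + (1 / k) *\<^sub>C (a \<cdot> a)"
    have ea: "e \<cdot> a = a" "e \<cdot> (a \<cdot> a) = a \<cdot> a"
    proof -
      have "e \<cdot> a = (- l / k) *\<^sub>C (a \<cdot> a) + (1 / k) *\<^sub>C (a \<cdot> (a \<cdot> a))"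
        by (simp only: e_def mul_simps mul_assoc)
      also have "\<dots> = (- l / k + l / k) *\<^sub>C (a \<cdot> a) + (k / k) *\<^sub>C a"
        unfolding cubic scaleC_add_left by (simp add: scaleC_add_right scaleC_scaleC)
      also have "\<dots> = a" using 1 by (simp add: scaleC_one)
      finally show "e \<cdot> a = a" .
      then show "e \<cdot> (a \<cdot> a) = a \<cdot> a" by (simp add: mul_assoc[symmetric])
    qed
    have "e \<cdot> ((- l / k) *\<^sub>C a + (1 / k) *\<^sub>C (a \<cdot> a)) = (- l / k) *\<^sub>C a + (1 / k) *\<^sub>C (a \<cdot> a)"
      by (simp only: mul_simps ea)
    then have "e \<cdot> e = e" by (simp only: e_def[symmetric])
    moreover have "e \<noteq> 0" using st[of "- l / k" "1 / k"] 1 by (auto simp: e_def)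
    ultimately show ?thesis using e_def by blast
  next
    case 2
    define e where "e = 0 *\<^sub>C a + (1 / (l * l)) *\<^sub>C (a \<cdot> a)"
    have "a \<cdot> (a \<cdot> (a \<cdot> a)) = (l * l) *\<^sub>C (a \<cdot> a)"
      using quart cubic 2 by (simp add: scaleC_scaleC)
    then have "e \<cdot> e = e"
      using 2 by (simp add: e_def mul_simps mul_assoc scaleC_scaleC)
    moreover have "e \<noteq> 0" using st[of 0 "1 / (l * l)"] 2 by (auto simp: e_def)
    ultimately show ?thesis using e_def by blast
  next
    case 3
    with cubic show ?thesis by simp
  qed
qed


section \<open>Nilpotents, idempotents and derivations\<close>

text \<open>
  Multiplication by \<open>a\<close> turns the second legs of \<open>E\<close> into multiples of \<open>a\<close>, so \<open>\<Delta> a = u \<otimes> a\<close>.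
  The counit makes \<open>u\<close> a multiple of \<open>a\<close>, hence of square zero, but \<open>u\<close> is idempotent because
  \<open>E\<close> is.
\<close>

lemma square_zero_not_in_Hs:
  assumes a: "a \<in> Hs" "a \<noteq> 0" "a \<cdot> a = 0" and sc: "\<And>x. x \<in> Ht \<Longrightarrow> \<exists>k. a \<cdot> x = k *\<^sub>C a"
  shows False
proof -
  obtain p :: "3 \<Rightarrow> 'a" and c where p: "dual_basis p c" by (rule dual_basis_exists)
  have "\<exists>k. a \<cdot> lcontr (c i) E = k *\<^sub>C a" for i
    by (intro sc lcontr_E_in_Ht dual_basisD(1)[OF p])
  then obtain k where k: "\<And>i. a \<cdot> lcontr (c i) E = k i *\<^sub>C a" by metis
  define u where "u = (\<Sum>i\<in>UNIV. k i *\<^sub>C p i)"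
  have "\<Delta> a = (\<one> \<otimes> a) \<odot> (\<Sum>i\<in>UNIV. p i \<otimes> lcontr (c i) E)"
    using a(1) by (simp add: Hs_def tensor_expand_left[OF p])
  also have "\<dots> = u \<otimes> a"
    by (simp add: mul2_simps k u_def tensor_simps)
  finally have Da: "\<Delta> a = u \<otimes> a" .
  have ua: "a = \<epsilon> a *\<^sub>C u"
    using counit_right[of a] by (simp add: Da clinear_counit)
  have "(u \<otimes> \<one>) \<odot> \<Delta> a = (u \<otimes> a) \<odot> E"
  proof -
    have "(u \<otimes> a) \<odot> E = (u \<otimes> \<one>) \<odot> ((\<one> \<otimes> a) \<odot> E)" by (simp add: mul2_assoc[symmetric])
    then show ?thesis using a(1) by (simp add: Hs_def)
  qed
  also have "\<dots> = u \<otimes> a"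
    using a(1) Da comult_mul[of a \<one>] by simp
  finally have "(u \<cdot> u) \<otimes> a = u \<otimes> a" by (simp add: Da)
  then have "rcontr \<epsilon> ((u \<cdot> u) \<otimes> a) = rcontr \<epsilon> (u \<otimes> a)" by simp
  then have "\<epsilon> a *\<^sub>C (u \<cdot> u) = a" using ua by (simp add: clinear_counit)
  then have "a = 0"
    using ua a(3) by (metis mul_simps(2,8) complex_vector.scale_zero_right complex_vector.scale_eq_0_iff)
  with a(2) show False ..
qed

lemma square_zero_not_in_Ht:
  assumes b: "b \<in> Ht" "b \<noteq> 0" "b \<cdot> b = 0" and sc: "\<And>x. x \<in> Hs \<Longrightarrow> \<exists>k. b \<cdot> x = k *\<^sub>C b"
  shows False
proof -
  obtain p :: "3 \<Rightarrow> 'a" and c where p: "dual_basis p c" by (rule dual_basis_exists)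
  have "\<exists>k. b \<cdot> rcontr (c i) E = k *\<^sub>C b" for i
    by (intro sc rcontr_E_in_Hs dual_basisD(1)[OF p])
  then obtain k where k: "\<And>i. b \<cdot> rcontr (c i) E = k i *\<^sub>C b" by metis
  define v where "v = (\<Sum>i\<in>UNIV. k i *\<^sub>C p i)"
  have "\<Delta> b = (b \<otimes> \<one>) \<odot> (\<Sum>i\<in>UNIV. rcontr (c i) E \<otimes> p i)"
    using b(1) by (simp add: Ht_def tensor_expand_right[OF p])
  also have "\<dots> = b \<otimes> v"
    by (simp add: mul2_simps k v_def tensor_simps)
  finally have Db: "\<Delta> b = b \<otimes> v" .
  have vb: "b = \<epsilon> b *\<^sub>C v"
    using counit_left[of b] by (simp add: Db clinear_counit)
  have "(\<one> \<otimes> v) \<odot> \<Delta> b = (b \<otimes> v) \<odot> E"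
  proof -
    have "(b \<otimes> v) \<odot> E = (\<one> \<otimes> v) \<odot> ((b \<otimes> \<one>) \<odot> E)" by (simp add: mul2_assoc[symmetric])
    then show ?thesis using b(1) by (simp add: Ht_def)
  qed
  also have "\<dots> = b \<otimes> v"
    using b(1) Db comult_mul[of b \<one>] by simp
  finally have "b \<otimes> (v \<cdot> v) = b \<otimes> v" by (simp add: Db)
  then have "lcontr \<epsilon> (b \<otimes> (v \<cdot> v)) = lcontr \<epsilon> (b \<otimes> v)" by simp
  then have "\<epsilon> b *\<^sub>C (v \<cdot> v) = b" using vb by (simp add: clinear_counit)
  then have "b = 0"
    using vb b(3) by (metis mul_simps(2,8) complex_vector.scale_zero_right complex_vector.scale_eq_0_iff)
  with b(2) show False ..
qed

text \<open>
  For \<open>e\<close> in both base algebras, \<open>\<Delta> e = (e \<otimes> e) \<odot> E\<close>. Minimality makes one leg a multiple of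
  \<open>e\<close>, and the counit then fixes \<open>\<Delta> e\<close> up to a scalar, which is \<open>1\<close> because \<open>\<Delta> e\<close> is idempotent.
  With \<open>e = \<one>\<close> this says that a weak Hopf algebra with a one-dimensional base is a Hopf algebra.
\<close>

lemma minimal_idempotent_grouplike:
  assumes e: "e \<in> Hs" "e \<in> Ht" "e \<cdot> e = e" "e \<noteq> 0"
    and min: "(\<forall>x\<in>Ht. \<exists>k. e \<cdot> x = k *\<^sub>C e) \<or> (\<forall>x\<in>Hs. \<exists>k. e \<cdot> x = k *\<^sub>C e)"
  shows "\<Delta> e = e \<otimes> e" "\<epsilon> e = 1"
proof -
  obtain p :: "3 \<Rightarrow> 'a" and c where p: "dual_basis p c" by (rule dual_basis_exists)
  have De: "\<Delta> e = (e \<otimes> e) \<odot> E"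
  proof -
    have "(e \<otimes> e) \<odot> E = (e \<otimes> \<one>) \<odot> ((\<one> \<otimes> e) \<odot> E)" by (simp add: mul2_assoc[symmetric])
    also have "\<dots> = (e \<otimes> \<one>) \<odot> ((e \<otimes> \<one>) \<odot> E)" using e by (simp add: Hs_def Ht_def)
    also have "\<dots> = (e \<otimes> \<one>) \<odot> E" by (simp add: mul2_assoc[symmetric] e)
    finally show ?thesis using e by (simp add: Ht_def)
  qed
  have "\<exists>k. \<Delta> e = k *\<^sub>C (e \<otimes> e)"
  proof (rule disjE[OF min])
    assume min: "\<forall>x\<in>Ht. \<exists>k. e \<cdot> x = k *\<^sub>C e"
    have "\<exists>k. e \<cdot> lcontr (c i) E = k *\<^sub>C e" for i
      using min lcontr_E_in_Ht dual_basisD(1)[OF p] by blast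
    then obtain k where k: "\<And>i. e \<cdot> lcontr (c i) E = k i *\<^sub>C e" by metis
    define u where "u = (\<Sum>i\<in>UNIV. k i *\<^sub>C (e \<cdot> p i))"
    have "\<Delta> e = (e \<otimes> e) \<odot> (\<Sum>i\<in>UNIV. p i \<otimes> lcontr (c i) E)"
      by (simp add: tensor_expand_left[OF p] De)
    also have "\<dots> = u \<otimes> e"
      by (simp add: mul2_simps k u_def tensor_simps)
    finally have De': "\<Delta> e = u \<otimes> e" .
    then have "\<epsilon> e *\<^sub>C u = e" using counit_right[of e] by (simp add: clinear_counit)
    moreover from this e(4) have "\<epsilon> e \<noteq> 0" by auto
    ultimately have "u = inverse (\<epsilon> e) *\<^sub>C e" by (rule scaleC_cancel)
    then show ?thesis using De' by (auto simp: tensor_simps)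
  next
    assume min: "\<forall>x\<in>Hs. \<exists>k. e \<cdot> x = k *\<^sub>C e"
    have "\<exists>k. e \<cdot> rcontr (c i) E = k *\<^sub>C e" for i
      using min rcontr_E_in_Hs dual_basisD(1)[OF p] by blast
    then obtain k where k: "\<And>i. e \<cdot> rcontr (c i) E = k i *\<^sub>C e" by metis
    define u where "u = (\<Sum>i\<in>UNIV. k i *\<^sub>C (e \<cdot> p i))"
    have "\<Delta> e = (e \<otimes> e) \<odot> (\<Sum>i\<in>UNIV. rcontr (c i) E \<otimes> p i)"
      by (simp add: tensor_expand_right[OF p] De)
    also have "\<dots> = e \<otimes> u"
      by (simp add: mul2_simps k u_def tensor_simps)
    finally have De': "\<Delta> e = e \<otimes> u" .
    then have "\<epsilon> e *\<^sub>C u = e" using counit_left[of e] by (simp add: clinear_counit)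
    moreover from this e(4) have "\<epsilon> e \<noteq> 0" by auto
    ultimately have "u = inverse (\<epsilon> e) *\<^sub>C e" by (rule scaleC_cancel)
    then show ?thesis using De' by (auto simp: tensor_simps)
  qed
  then obtain k where k: "\<Delta> e = k *\<^sub>C (e \<otimes> e)" by blast
  have 1: "(k * \<epsilon> e) *\<^sub>C e = 1 *\<^sub>C e"
    using counit_left[of e] by (simp add: k clinear_counit contraction_simps scaleC_scaleC scaleC_one)
  then have 2: "k * \<epsilon> e = 1" using e(4) by (simp only: complex_vector.scale_right_imp_eq)
  have "\<Delta> e = (k * k) *\<^sub>C (e \<otimes> e)"
    using comult_mul[of e e] by (simp add: k mul2_simps e scaleC_scaleC)
  then have "lcontr \<epsilon> (\<Delta> e) = lcontr \<epsilon> ((k * k) *\<^sub>C (e \<otimes> e))" by simp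
  then have "1 *\<^sub>C e = k *\<^sub>C e"
    using 2 by (simp add: counit_left clinear_counit contraction_simps scaleC_scaleC scaleC_one mult.assoc)
  then have "1 = k" using e(4) by (simp only: complex_vector.scale_right_imp_eq)
  with k 2 show "\<Delta> e = e \<otimes> e" "\<epsilon> e = 1" by (simp_all add: scaleC_one)
qed

text \<open>
  By the Leibniz rule in both legs, \<open>(d \<otimes> d)(t \<odot> t)\<close> is twice the product below, up to terms with
  the factor \<open>(\<kappa> \<otimes> \<kappa>)(t)\<close>, which vanishes when \<open>t \<odot> t = 0\<close>. For \<open>t = \<Delta> y\<close> with \<open>y \<cdot> y = 0\<close> both factors
  are \<open>d y\<close> when \<open>\<kappa>\<close> is the counit, so no derivation detects \<open>y\<close>. Characteristic zero
  enters here through the factor two.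
\<close>

lemma pairing_derivation_square:
  assumes lin: "clinear \<kappa>" "clinear d"
    and \<kappa>: "\<And>x y. \<kappa> (x \<cdot> y) = \<kappa> x * \<kappa> y" and d: "\<And>x y. d (x \<cdot> y) = d x * \<kappa> y + \<kappa> x * d y"
    and t: "t \<odot> t = 0"
  shows "pairing d \<kappa> t * pairing \<kappa> d t = 0"
proof -
  note [simp] = clinear_pairing pairing_elem lin
  have 1: "pairing \<kappa> \<kappa> (s \<odot> t) = pairing \<kappa> \<kappa> s * pairing \<kappa> \<kappa> t" for s t
  proof (induction s rule: tensor_induct)
    case (elem x y)
    show ?case by (induction t rule: tensor_induct) (simp_all add: \<kappa> mul2_simps contraction_simps algebra_simps)
  qed (simp add: mul2_simps contraction_simps algebra_simps)
  have 2: "pairing d d (s \<odot> t) = pairing d d s * pairing \<kappa> \<kappa> t + pairing d \<kappa> s * pairing \<kappa> d t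
      + pairing \<kappa> d s * pairing d \<kappa> t + pairing \<kappa> \<kappa> s * pairing d d t" for s t
  proof (induction s rule: tensor_induct)
    case (elem x y)
    show ?case by (induction t rule: tensor_induct) (simp_all add: d mul2_simps contraction_simps algebra_simps)
  qed (simp add: mul2_simps contraction_simps algebra_simps)
  have "pairing \<kappa> \<kappa> t * pairing \<kappa> \<kappa> t = 0"
    using 1[of t t] t by (simp add: contraction_simps)
  then show ?thesis using 2[of t t] t by (auto simp: contraction_simps)
qed

lemma lcontr_mul2:
  assumes lin: "clinear \<kappa>" and \<kappa>: "\<And>x y. \<kappa> (x \<cdot> y) = \<kappa> x * \<kappa> y"
  shows "lcontr \<kappa> (s \<odot> t) = lcontr \<kappa> s \<cdot> lcontr \<kappa> t"
proof (induction s rule: tensor_induct)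
  case (elem x y)
  show ?case by (induction t rule: tensor_induct) (simp_all add: lin \<kappa> multilinear_simps ac_simps)
qed (simp add: lin multilinear_simps)


section \<open>The case of a trivial base\<close>

text \<open>
  The functional \<open>\<kappa> \<circ> S\<close> is the convolution inverse of \<open>\<kappa>\<close>.
\<close>

lemma winding_injective:
  assumes E: "E = \<one> \<otimes> \<one>"
    and lin: "clinear \<kappa>" and \<kappa>: "\<And>x y. \<kappa> (x \<cdot> y) = \<kappa> x * \<kappa> y" "\<kappa> \<one> = 1"
    and 0: "lcontr \<kappa> (\<Delta> x) = 0"
  shows "x = 0"
proof -
  define \<psi> where "\<psi> = (\<lambda>x. \<kappa> (S x))"
  have lin': "clinear \<psi>" unfolding \<psi>_def by (rule clinear_compose[OF lin clinear_antipode])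
  have B: "cbilinear (\<lambda>u v. u \<cdot> S v)"
    by (rule cbilinear_compose[OF cbilinear_mul clinear_ident clinear_antipode])
  have "pairing \<kappa> \<psi> t = \<kappa> (tensor_lift (\<lambda>u v. u \<cdot> S v) t)" for t
    by (rule tensor_eqI[OF clinear_pairing[OF lin lin'] clinear_compose[OF lin clinear_tensor_lift[OF B]]])
      (simp only: tensor_lift_elem[OF B] pairing_elem[OF lin lin'] \<kappa>(1), simp only: \<psi>_def)
  then have "pairing \<kappa> \<psi> (\<Delta> z) = \<epsilon> z" for z
    by (simp add: antipode_right E clinear_counit clinear_rules[OF lin] \<kappa>)
  then have "x = lcontr (\<lambda>z. pairing \<kappa> \<psi> (\<Delta> z)) (\<Delta> x)"
    by (simp add: counit_left)
  also have "\<dots> = lcontr \<psi> (\<Delta> (lcontr \<kappa> (\<Delta> x)))"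
    by (rule lcontr_coassoc[OF lin lin', symmetric])
  also have "\<dots> = 0"
    by (simp add: 0 comult_simps contraction_simps lin')
  finally show ?thesis .
qed

lemma counit_multiplicative:
  assumes E: "E = \<one> \<otimes> \<one>"
  shows "\<epsilon> (x \<cdot> y) = \<epsilon> x * \<epsilon> y"
proof -
  have "clinear (\<lambda>u. \<epsilon> (x \<cdot> u))" "clinear (\<lambda>u. \<epsilon> (u \<cdot> y))"
    by (rule clinear_compose[OF clinear_counit cbilinear_right[OF cbilinear_mul]],
        rule clinear_compose[OF clinear_counit cbilinear_left[OF cbilinear_mul]])
  then show ?thesis using counit_weak[of x y] by (simp add: E)
qed

text \<open>
  Otherwise the Peirce decomposition yields \<open>y\<close> with \<open>y \<cdot> y = 0\<close> and \<open>e \<cdot> y = \<alpha> y\<close>, where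
  \<open>\<alpha>\<close> is \<open>0\<close> or \<open>1\<close>, and the algebra has a second character \<open>\<kappa>\<close> with \<open>\<kappa> e = 1\<close>. The winding
  \<open>\<phi> = lcontr \<kappa> \<circ> \<Delta>\<close> is an injective algebra endomorphism that exchanges the characters
  \<open>\<epsilon>\<close> and \<open>\<kappa>\<close>. It preserves the line of \<open>y\<close> and sends \<open>e\<close> to \<open>\<one> - e\<close> modulo this line, so
  applying it to \<open>e \<cdot> y = \<alpha> y\<close> gives \<open>1 - \<alpha> = \<alpha>\<close>.
\<close>

lemma hopf_idempotent_split:
  assumes E: "E = \<one> \<otimes> \<one>" and one: "\<epsilon> \<one> = 1"
    and e: "e \<cdot> e = e" "e \<noteq> 0" "\<epsilon> e = 0"
  shows split
proof (rule ccontr)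
  assume "\<not> split"
  note eps = counit_multiplicative[OF E]
  have e1: "e \<noteq> \<one>" using e one by auto
  from peirce[OF e(1,2) e1] \<open>\<not> split\<close> obtain y \<alpha> \<beta> where ind: "independent_triple \<one> e y"
    and y: "y \<cdot> y = 0" "e \<cdot> y = \<alpha> *\<^sub>C y" "y \<cdot> e = \<beta> *\<^sub>C y" "\<alpha> \<in> {0, 1}" by blast
  from ind obtain f g d where lin: "clinear f" "clinear g" "clinear d"
    and on: "f \<one> = 1" "f e = 0" "f y = 0" "g \<one> = 0" "g e = 1" "g y = 0" "d \<one> = 0" "d e = 0" "d y = 1"
    and ex: "\<And>x. x = f x *\<^sub>C \<one> + g x *\<^sub>C e + d x *\<^sub>C y" by (rule coordinates) blast
  have "\<epsilon> y * \<epsilon> y = 0" using eps[of y y] y(1) by (simp add: counit_simps)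
  then have "\<epsilon> y = 0" by simp
  have epsf: "\<epsilon> x = f x" for x
    by (subst ex) (simp add: counit_simps one e \<open>\<epsilon> y = 0\<close>)
  define \<kappa> where "\<kappa> = (\<lambda>x. f x + g x)"
  have lk: "clinear \<kappa>" unfolding \<kappa>_def by (rule clinear_plus[OF lin(1,2)])
  have k: "\<kappa> (u \<cdot> v) = \<kappa> u * \<kappa> v" for u v
    by (subst ex[of u], subst ex[of v])
      (simp add: \<kappa>_def mul_simps e y clinear_rules[OF lin(1)] clinear_rules[OF lin(2)] on algebra_simps)
  have k1: "\<kappa> \<one> = 1" "\<kappa> e = 1" "\<kappa> y = 0" by (simp_all add: \<kappa>_def on)
  have exk: "x = \<epsilon> x *\<^sub>C \<one> + (\<kappa> x - \<epsilon> x) *\<^sub>C e + d x *\<^sub>C y" for x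
    using ex[of x] by (simp add: epsf \<kappa>_def)
  define \<phi> where "\<phi> x = lcontr \<kappa> (\<Delta> x)" for x
  have mult: "\<phi> (u \<cdot> v) = \<phi> u \<cdot> \<phi> v" for u v
    unfolding \<phi>_def comult_mul by (rule lcontr_mul2[OF lk k])
  have scale: "\<phi> (c *\<^sub>C u) = c *\<^sub>C \<phi> u" "\<phi> (u - v) = \<phi> u - \<phi> v" "\<phi> 0 = 0" for c u v
    by (simp_all add: \<phi>_def comult_simps contraction_simps lk)
  have inj: "\<phi> x = 0 \<Longrightarrow> x = 0" for x
    unfolding \<phi>_def by (rule winding_injective[OF E lk k k1(1)])
  have phi1: "\<phi> \<one> = \<one>" by (simp add: \<phi>_def E lk k1 scaleC_one)
  have eps_phi: "\<epsilon> (\<phi> x) = \<kappa> x" for x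
    unfolding \<phi>_def using pairing_lcontr[OF lk clinear_counit, of "\<Delta> x"] pairing_rcontr[OF lk clinear_counit, of "\<Delta> x"]
    by (simp add: counit_right)
  have y0: "y \<noteq> 0" "e \<noteq> \<one>" using on e1 by (auto simp: clinear_zero[OF lin(3)])
  have "\<kappa> (\<phi> y) * \<kappa> (\<phi> y) = 0" using k[of "\<phi> y" "\<phi> y"] mult[of y y] y(1) by (simp add: scale clinear_rules[OF lk])
  then obtain c where c: "\<phi> y = c *\<^sub>C y" using exk[of "\<phi> y"] by (auto simp: eps_phi k1)
  have c0: "c \<noteq> 0" using inj[of y] y0 c by auto
  have "\<kappa> (\<phi> e) * \<kappa> (\<phi> e) = \<kappa> (\<phi> e)" using k[of "\<phi> e" "\<phi> e"] mult[of e e] e(1) by simp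
  then consider "\<kappa> (\<phi> e) = 1" | "\<kappa> (\<phi> e) = 0" by auto
  then show False
  proof cases
    case 1
    then obtain r where r: "\<phi> e = \<one> + r *\<^sub>C y" using exk[of "\<phi> e"] by (auto simp: eps_phi k1 scaleC_one)
    have "\<phi> e \<cdot> \<phi> e = \<phi> e" using mult[of e e] e(1) by simp
    then have "r *\<^sub>C y = 0" by (simp add: r mul_simps y)
    then have "\<phi> (e - \<one>) = 0" by (simp add: scale phi1 r)
    then show False using inj y0 by fastforce
  next
    case 2
    then obtain r where r: "\<phi> e = \<one> - e + r *\<^sub>C y"
      using exk[of "\<phi> e"] by (auto simp: eps_phi k1 scaleC_one)
    have "\<phi> e \<cdot> \<phi> y = \<alpha> *\<^sub>C \<phi> y" using mult[of e y] y(2) by (simp add: scale)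
    then have "(c * (1 - \<alpha>)) *\<^sub>C y = (c * \<alpha>) *\<^sub>C y"
      by (simp add: r c mul_simps y scaleC_scaleC algebra_simps complex_vector.scale_left_diff_distrib)
    then have "c * (1 - \<alpha>) = c * \<alpha>" using y0(1) by (simp only: complex_vector.scale_right_imp_eq)
    then show False using c0 y(4) by auto
  qed
qed

text \<open>
  Without idempotents the augmentation ideal is nilpotent: either it is spanned by \<open>x\<close> and \<open>x\<^sup>2\<close>
  with \<open>x\<^sup>3 = 0\<close>, or its multiplication is zero. In both cases the dual of the Hopf algebra contains
  a primitive element whose powers would have to be linearly independent.
\<close>

lemma hopf_split:
  assumes E: "E = \<one> \<otimes> \<one>" and one: "\<epsilon> \<one> = 1"
  shows split
proof (rule ccontr)
  assume ns: "\<not> split"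
  note eps = counit_multiplicative[OF E]
  have no_idem: "e = 0" if "e \<cdot> e = e" "\<epsilon> e = 0" for e
    using hopf_idempotent_split[OF E one that(1) _ that(2)] ns by blast
  have aug: "\<exists>y. \<epsilon> y = 0 \<and> (\<forall>a. y \<noteq> a *\<^sub>C x)" if "\<epsilon> x = 0" for x
  proof -
    obtain w where w: "\<And>a b. w \<noteq> a *\<^sub>C \<one> + b *\<^sub>C x" using outside_plane[of \<one> x] by blast
    have "\<epsilon> (w - \<epsilon> w *\<^sub>C \<one>) = 0" by (simp add: counit_simps one)
    moreover have "w - \<epsilon> w *\<^sub>C \<one> \<noteq> a *\<^sub>C x" for a
      using w[of "\<epsilon> w" a] by (auto simp: algebra_simps)
    ultimately show ?thesis by blast
  qed
  have indK: "independent_triple \<one> x y" if "\<epsilon> x = 0" "x \<noteq> 0" "\<epsilon> y = 0" "\<And>a. y \<noteq> a *\<^sub>C x" for x y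
  proof (rule independent_tripleI)
    fix a b
    show "a = 0 \<and> b = 0" if 0: "a *\<^sub>C \<one> + b *\<^sub>C x = 0"
    proof -
      have "\<epsilon> (a *\<^sub>C \<one> + b *\<^sub>C x) = a"
        using \<open>\<epsilon> x = 0\<close> by (simp add: counit_simps one)
      then have "a = 0" by (simp add: 0 counit_simps)
      with 0 \<open>x \<noteq> 0\<close> show ?thesis by simp
    qed
    show "y \<noteq> a *\<^sub>C \<one> + b *\<^sub>C x"
    proof
      assume y: "y = a *\<^sub>C \<one> + b *\<^sub>C x"
      have "\<epsilon> (a *\<^sub>C \<one> + b *\<^sub>C x) = a"
        using \<open>\<epsilon> x = 0\<close> by (simp add: counit_simps one)
      then have "a = 0" using \<open>\<epsilon> y = 0\<close> y by simp
      with y that(4)[of b] show False by simp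
    qed
  qed
  have coords: "\<exists>b c. z = b *\<^sub>C x + c *\<^sub>C y" if ind: "independent_triple \<one> x y"
    and "\<epsilon> x = 0" "\<epsilon> y = 0" "\<epsilon> z = 0" for x y z
  proof -
    obtain a b c where z: "z = a *\<^sub>C \<one> + b *\<^sub>C x + c *\<^sub>C y" by (rule span_triple[OF ind])
    then have "\<epsilon> z = a" using that by (simp add: counit_simps one)
    with z that show ?thesis by auto
  qed
  show False
  proof (cases "\<exists>x. \<epsilon> x = 0 \<and> (\<forall>l. x \<cdot> x \<noteq> l *\<^sub>C x)")
    case True
    then obtain x where x: "\<epsilon> x = 0" "\<And>l. x \<cdot> x \<noteq> l *\<^sub>C x" by blast
    have "x \<noteq> 0" using x(2)[of 0] by (auto simp: mul_simps)
    have exx: "\<epsilon> (x \<cdot> x) = 0" "\<epsilon> (x \<cdot> (x \<cdot> x)) = 0" using eps x(1) by simp_all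
    have ind: "independent_triple \<one> x (x \<cdot> x)"
      by (rule indK[OF x(1) \<open>x \<noteq> 0\<close> exx(1) x(2)])
    obtain k l where cubic: "x \<cdot> (x \<cdot> x) = k *\<^sub>C x + l *\<^sub>C (x \<cdot> x)"
      using coords[OF ind x(1) exx] by blast
    from cubic_idempotent[OF ind cubic] have x3: "x \<cdot> (x \<cdot> x) = 0"
    proof
      assume "\<exists>e s t. e = s *\<^sub>C x + t *\<^sub>C (x \<cdot> x) \<and> e \<cdot> e = e \<and> e \<noteq> 0"
      then obtain e s t where e: "e = s *\<^sub>C x + t *\<^sub>C (x \<cdot> x)" "e \<cdot> e = e" "e \<noteq> 0" by blast
      then have "\<epsilon> e = 0" using x(1) exx by (simp add: counit_simps)
      with no_idem e show ?thesis by blast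
    qed
    from ind obtain f d1 d2 where lin: "clinear f" "clinear d1" "clinear d2"
      and on: "f \<one> = 1" "f x = 0" "f (x \<cdot> x) = 0" "d1 \<one> = 0" "d1 x = 1" "d1 (x \<cdot> x) = 0"
        "d2 \<one> = 0" "d2 x = 0" "d2 (x \<cdot> x) = 1"
      and ex: "\<And>z. z = f z *\<^sub>C \<one> + d1 z *\<^sub>C x + d2 z *\<^sub>C (x \<cdot> x)" by (rule coordinates) blast
    have x4: "x \<cdot> (x \<cdot> (x \<cdot> x)) = 0" by (simp add: x3 mul_simps)
    have epsf: "\<epsilon> z = f z" for z
      by (subst ex) (simp add: counit_simps one x(1) exx)
    have D1: "d1 (u \<cdot> v) = d1 u * \<epsilon> v + \<epsilon> u * d1 v" for u v
      unfolding epsf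
      by (subst ex[of u], subst ex[of v]) (simp add: mul_simps mul_assoc x3 x4 clinear_rules[OF lin(2)] on)
    have D2: "d2 (u \<cdot> v) = d2 u * \<epsilon> v + d1 u * d1 v + \<epsilon> u * d2 v" for u v
      unfolding epsf
      by (subst ex[of u], subst ex[of v]) (simp add: mul_simps mul_assoc x3 x4 clinear_rules[OF lin(3)] on)
    note [simp] = clinear_pairing pairing_elem lin clinear_counit
    \<comment> \<open>Modulo higher terms \<open>\<Delta> x = x \<otimes> \<one> + \<one> \<otimes> x\<close>, so the coefficients of \<open>x \<otimes> x\<close> in
      \<open>\<Delta>(x\<^sup>2)\<close> and of \<open>x \<otimes> x\<^sup>2\<close> in \<open>\<Delta>(x\<^sup>3)\<close> are the binomial coefficients \<open>2\<close> and \<open>3\<close>.\<close>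
    have P11: "pairing d1 d1 (s \<odot> t) = pairing d1 d1 s * pairing \<epsilon> \<epsilon> t + pairing d1 \<epsilon> s * pairing \<epsilon> d1 t
        + pairing \<epsilon> d1 s * pairing d1 \<epsilon> t + pairing \<epsilon> \<epsilon> s * pairing d1 d1 t" for s t
    proof (induction s rule: tensor_induct)
      case (elem x y)
      show ?case by (induction t rule: tensor_induct) (simp_all add: D1 eps mul2_simps contraction_simps algebra_simps)
    qed (simp add: mul2_simps contraction_simps algebra_simps)
    have P12: "pairing d1 d2 (s \<odot> t) =
        pairing d1 d2 s * pairing \<epsilon> \<epsilon> t + pairing d1 d1 s * pairing \<epsilon> d1 t + pairing d1 \<epsilon> s * pairing \<epsilon> d2 t
        + pairing \<epsilon> d2 s * pairing d1 \<epsilon> t + pairing \<epsilon> d1 s * pairing d1 d1 t + pairing \<epsilon> \<epsilon> s * pairing d1 d2 t" for s t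
    proof (induction s rule: tensor_induct)
      case (elem x y)
      show ?case by (induction t rule: tensor_induct) (simp_all add: D1 D2 eps mul2_simps contraction_simps algebra_simps)
    qed (simp add: mul2_simps contraction_simps algebra_simps)
    have pe: "pairing \<epsilon> h (\<Delta> z) = h z" "pairing h \<epsilon> (\<Delta> z) = h z" if "clinear h" for h z
      using pairing_lcontr[OF clinear_counit that] pairing_rcontr[OF that clinear_counit]
      by (simp_all only: counit_left counit_right)
    have pe': "pairing \<epsilon> \<epsilon> (\<Delta> z) = \<epsilon> z" for z by (rule pe) simp
    have w: "pairing d1 d1 (\<Delta> (x \<cdot> x)) = 2"
      unfolding comult_mul P11 by (simp add: pe pe' on x(1))
    have "pairing d1 d2 (\<Delta> (x \<cdot> (x \<cdot> x))) = 3"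
      unfolding comult_mul[of x "x \<cdot> x"] P12 by (simp add: pe pe' on x(1) exx w)
    then show False by (simp add: x3 comult_simps contraction_simps)
  next
    case False
    have sq: "x \<cdot> x = 0" if "\<epsilon> x = 0" for x
    proof -
      from False that obtain l where l: "x \<cdot> x = l *\<^sub>C x" by blast
      show ?thesis
      proof (cases "l = 0")
        case False
        have "(inverse l *\<^sub>C x) \<cdot> (inverse l *\<^sub>C x) = inverse l *\<^sub>C x"
          using False by (simp add: mul_simps l scaleC_scaleC)
        moreover have "\<epsilon> (inverse l *\<^sub>C x) = 0" using that by (simp add: counit_simps)
        ultimately have "inverse l *\<^sub>C x = 0" by (rule no_idem)
        with False l show ?thesis by simp
      qed (simp add: l)
    qed
    obtain x where x: "\<epsilon> x = 0" "x \<noteq> 0" using aug[of 0] by (auto simp: counit_simps)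
    obtain y where y: "\<epsilon> y = 0" "\<And>a. y \<noteq> a *\<^sub>C x" using aug[OF x(1)] by blast
    have ind: "independent_triple \<one> x y" by (rule indK[OF x y])
    have xy0: "x \<cdot> y = 0"
    proof -
      have "\<epsilon> (x \<cdot> y) = 0" by (simp add: eps x)
      then obtain b c where bc: "x \<cdot> y = b *\<^sub>C x + c *\<^sub>C y" using coords[OF ind x(1) y(1)] by blast
      have "x \<cdot> (x \<cdot> y) = 0" "(x \<cdot> y) \<cdot> y = 0"
        by (simp_all only: mul_assoc[of x x y, symmetric] mul_assoc[of x y y] sq x y mul_simps)
      then have "c *\<^sub>C (x \<cdot> y) = 0" "b *\<^sub>C (x \<cdot> y) = 0"
        using bc by (simp_all add: mul_simps sq x y)
      then show ?thesis using bc by auto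
    qed
    have "(x + y) \<cdot> (x + y) = 0" by (rule sq) (simp add: counit_simps x y)
    then have yx0: "y \<cdot> x = 0" by (simp add: mul_simps sq x y xy0)
    from ind obtain f d d' where lin: "clinear f" "clinear d" "clinear d'"
      and on: "f \<one> = 1" "f x = 0" "f y = 0" "d \<one> = 0" "d x = 1" "d y = 0" "d' \<one> = 0" "d' x = 0" "d' y = 1"
      and ex: "\<And>z. z = f z *\<^sub>C \<one> + d z *\<^sub>C x + d' z *\<^sub>C y" by (rule coordinates) blast
    have epsf: "\<epsilon> z = f z" for z
      by (subst ex) (simp add: counit_simps one x(1) y(1))
    have D: "d (u \<cdot> v) = d u * \<epsilon> v + \<epsilon> u * d v" for u v
      unfolding epsf
      by (subst ex[of u], subst ex[of v]) (simp add: mul_simps xy0 yx0 sq x y clinear_rules[OF lin(2)] on)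
    have "\<Delta> x \<odot> \<Delta> x = 0" using comult_mul[of x x] sq[OF x(1)] by (simp add: comult_simps)
    from pairing_derivation_square[OF clinear_counit lin(2) eps D this] show False
      by (simp add: pairing_lcontr[OF clinear_counit lin(2)] pairing_rcontr[OF lin(2) clinear_counit]
          counit_left counit_right on)
  qed
qed


section \<open>The case of a two-dimensional base\<close>

text \<open>
  The corner \<open>eAf\<close> is the line of \<open>y\<close>, so \<open>\<Delta> y\<close> is a multiple of \<open>y \<otimes> y\<close>. The antipode axiom
  puts a nonzero multiple of \<open>e\<close> into \<open>yA\<close>, which is again the line of \<open>y\<close>: an arrow between
  the two objects would have to be invertible, and there is no room for its inverse.
\<close>

lemma no_single_arrow:
  assumes ef: "e \<cdot> e = e" "e \<noteq> 0" "e \<cdot> f = 0" "f \<cdot> e = 0" "f \<cdot> f = f"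
    and E: "E = e \<otimes> e + f \<otimes> f"
    and De: "\<Delta> e = e \<otimes> e" "\<Delta> f = f \<otimes> f"
    and y: "y \<noteq> 0" "y \<cdot> y = 0" "e \<cdot> y = y" "y \<cdot> f = y"
    and span: "\<And>x. \<exists>a b c. x = a *\<^sub>C e + b *\<^sub>C f + c *\<^sub>C y"
  shows False
proof -
  have ye: "y \<cdot> e = 0" using mul_assoc[of y f e] by (simp add: y ef mul_simps)
  have fy: "f \<cdot> y = 0" using mul_assoc[of f e y] by (simp add: y ef mul_simps)
  have corner: "\<exists>l. e \<cdot> x \<cdot> f = l *\<^sub>C y" for x
  proof -
    obtain a b c where "x = a *\<^sub>C e + b *\<^sub>C f + c *\<^sub>C y" using span by blast
    then have "e \<cdot> x \<cdot> f = c *\<^sub>C y" by (simp add: mul_simps ef y)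
    then show ?thesis ..
  qed
  have "\<exists>l. (e \<otimes> e) \<odot> t \<odot> (f \<otimes> f) = l *\<^sub>C (y \<otimes> y)" for t
  proof (induction t rule: tensor_induct)
    case (elem u v)
    obtain k l where "e \<cdot> u \<cdot> f = k *\<^sub>C y" "e \<cdot> v \<cdot> f = l *\<^sub>C y" using corner by metis
    then have "(e \<otimes> e) \<odot> (u \<otimes> v) \<odot> (f \<otimes> f) = (k * l) *\<^sub>C (y \<otimes> y)"
      by (simp add: tensor_simps scaleC_scaleC)
    then show ?case ..
  next
    case (add s t)
    then obtain k l where "(e \<otimes> e) \<odot> s \<odot> (f \<otimes> f) = k *\<^sub>C (y \<otimes> y)" "(e \<otimes> e) \<odot> t \<odot> (f \<otimes> f) = l *\<^sub>C (y \<otimes> y)"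
      by blast
    then have "(e \<otimes> e) \<odot> (s + t) \<odot> (f \<otimes> f) = (k + l) *\<^sub>C (y \<otimes> y)"
      by (simp add: mul2_simps scaleC_add_left)
    then show ?case ..
  qed
  moreover have "\<Delta> y = (e \<otimes> e) \<odot> \<Delta> y \<odot> (f \<otimes> f)"
    using comult_mul[of "e \<cdot> y" f] comult_mul[of e y] by (simp add: y De)
  ultimately obtain l where l: "\<Delta> y = l *\<^sub>C (y \<otimes> y)" by metis
  have "(l * \<epsilon> y) *\<^sub>C y = y"
    using counit_left[of y] by (simp add: l clinear_counit contraction_simps scaleC_scaleC)
  then have nz: "l \<noteq> 0" "\<epsilon> y \<noteq> 0" using y(1) by auto
  have B: "cbilinear (\<lambda>u v. u \<cdot> S v)"
    by (rule cbilinear_compose[OF cbilinear_mul clinear_ident clinear_antipode])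
  have "tensor_lift (\<lambda>u v. u \<cdot> S v) (\<Delta> y) = l *\<^sub>C (y \<cdot> S y)"
    by (simp add: l clinear_scale[OF clinear_tensor_lift[OF B]] tensor_lift_elem[OF B])
  moreover have "lcontr \<epsilon> (E \<odot> (y \<otimes> \<one>)) = \<epsilon> y *\<^sub>C e"
    by (simp add: E mul2_simps y fy tensor_simps clinear_counit)
  ultimately have 1: "\<epsilon> y *\<^sub>C e = l *\<^sub>C (y \<cdot> S y)"
    using antipode_right[of y] by simp
  obtain a b c where "S y = a *\<^sub>C e + b *\<^sub>C f + c *\<^sub>C y" using span by blast
  then have "y \<cdot> S y = b *\<^sub>C y" by (simp add: mul_simps ye y)
  with 1 have "e = inverse (\<epsilon> y) *\<^sub>C (l * b) *\<^sub>C y"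
    using nz by (intro scaleC_cancel) (simp_all add: scaleC_scaleC)
  then obtain k where "e = k *\<^sub>C y" by (auto simp: scaleC_scaleC)
  then have "e \<cdot> e = 0" by (simp add: mul_simps y)
  with ef show False by simp
qed

text \<open>
  The corner \<open>eAe\<close> is a bialgebra with counit \<open>\<kappa>\<close>, the coordinate of \<open>e\<close>. The coordinate \<open>d\<close> of
  \<open>y\<close> is a derivation along \<open>\<kappa>\<close> with \<open>d y = 1\<close>, which a vector of square zero does not admit.
\<close>

lemma no_nilpotent_loop:
  assumes ef: "e \<cdot> e = e" "e \<cdot> f = 0" "f \<cdot> e = 0" "f \<cdot> f = f"
    and E: "E = e \<otimes> e + f \<otimes> f"
    and De: "\<Delta> e = e \<otimes> e" "\<epsilon> e = 1" "\<epsilon> f = 1"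
    and y: "y \<cdot> y = 0" "e \<cdot> y = y" "y \<cdot> e = y"
    and ind: "independent_triple e f y"
  shows False
proof -
  have yf: "y \<cdot> f = 0" using mul_assoc[of y e f] by (simp add: y ef mul_simps)
  have fy: "f \<cdot> y = 0" using mul_assoc[of f e y] by (simp add: y ef mul_simps)
  have "clinear (\<lambda>u. \<epsilon> (y \<cdot> u))" "clinear (\<lambda>u. \<epsilon> (u \<cdot> y))"
    by (rule clinear_compose[OF clinear_counit cbilinear_right[OF cbilinear_mul]],
        rule clinear_compose[OF clinear_counit cbilinear_left[OF cbilinear_mul]])
  then have "\<epsilon> y * \<epsilon> y = 0"
    using counit_weak[of y y] by (simp add: E y yf fy contraction_simps counit_simps)
  then have ey: "\<epsilon> y = 0" by simp
  from ind obtain \<kappa> g d where lin: "clinear \<kappa>" "clinear g" "clinear d"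
    and on: "\<kappa> e = 1" "\<kappa> f = 0" "\<kappa> y = 0" "g e = 0" "g f = 1" "g y = 0" "d e = 0" "d f = 0" "d y = 1"
    and ex: "\<And>x. x = \<kappa> x *\<^sub>C e + g x *\<^sub>C f + d x *\<^sub>C y" by (rule coordinates) blast
  have eps: "\<epsilon> x = \<kappa> x + g x" for x
    by (subst ex) (simp add: counit_simps De ey)
  have k: "\<kappa> (u \<cdot> v) = \<kappa> u * \<kappa> v" for u v
    by (subst ex[of u], subst ex[of v]) (simp add: mul_simps ef y yf fy clinear_rules[OF lin(1)] on)
  have D: "d (u \<cdot> v) = d u * \<kappa> v + \<kappa> u * d v" for u v
    by (subst ex[of u], subst ex[of v]) (simp add: mul_simps ef y yf fy clinear_rules[OF lin(3)] on)
  have G: "g (e \<cdot> v) = 0" for v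
    by (subst ex[of v]) (simp add: mul_simps ef y clinear_rules[OF lin(2)] on)
  have "pairing d g ((e \<otimes> e) \<odot> t) = 0 \<and> pairing g d ((e \<otimes> e) \<odot> t) = 0" for t
    by (induction t rule: tensor_induct) (simp_all add: lin G mul2_simps contraction_simps)
  moreover have "(e \<otimes> e) \<odot> \<Delta> y = \<Delta> y" using comult_mul[of e y] by (simp add: y De)
  ultimately have 0: "pairing d g (\<Delta> y) = 0" "pairing g d (\<Delta> y) = 0" by metis+
  have "pairing d \<epsilon> t = pairing d \<kappa> t + pairing d g t" "pairing \<epsilon> d t = pairing \<kappa> d t + pairing g d t" for t
    by (induction t rule: tensor_induct) (simp_all add: lin clinear_counit eps contraction_simps algebra_simps)
  moreover have "pairing d \<epsilon> (\<Delta> y) = 1" "pairing \<epsilon> d (\<Delta> y) = 1"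
    by (simp_all only: pairing_lcontr[OF clinear_counit lin(3)] pairing_rcontr[OF lin(3) clinear_counit]
        counit_left counit_right on)
  ultimately have "pairing d \<kappa> (\<Delta> y) = 1" "pairing \<kappa> d (\<Delta> y) = 1" using 0 by simp_all
  moreover have "\<Delta> y \<odot> \<Delta> y = 0" using comult_mul[of y y] y by (simp add: comult_simps)
  ultimately show False
    using pairing_derivation_square[OF lin(1,3) k D, of "\<Delta> y"] by simp
qed

text \<open>
  Here \<open>\<Delta>(1) = e \<otimes> e + f \<otimes> f\<close> with \<open>f = \<one> - e\<close>. With \<open>e\<close> and \<open>f\<close> as objects, the corners of
  the Peirce decomposition are spaces of arrows, and the remaining basis vector is an arrow in one of
  two directions or a loop at one of the two objects.
\<close>

lemma base_of_two_idempotents_split: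
  assumes e: "e \<in> Hs" "e \<in> Ht" "e \<cdot> e = e" "e \<noteq> 0" "e \<noteq> \<one>"
    and Ht: "\<And>x. x \<in> Ht \<Longrightarrow> \<exists>a b. x = a *\<^sub>C \<one> + b *\<^sub>C e"
  shows split
proof (rule ccontr)
  assume ns: "\<not> split"
  define f where "f = \<one> - e"
  have f: "f \<cdot> f = f" "e \<cdot> f = 0" "f \<cdot> e = 0" "f \<noteq> 0" "f \<noteq> \<one>" and one: "\<one> = e + f"
    using e by (auto simp: f_def mul_simps)
  have f': "f = \<one> + (-1) *\<^sub>C e" by (simp add: f_def scaleC_one)
  have fH: "f \<in> Hs" "f \<in> Ht"
    unfolding f'
    by (rule Hs_add[OF one_in_bases(1) Hs_scale[OF e(1)]], rule Ht_add[OF one_in_bases(2) Ht_scale[OF e(2)]])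
  have "\<exists>k. e \<cdot> x = k *\<^sub>C e" if x: "x \<in> Ht" for x
  proof -
    obtain a b where "x = a *\<^sub>C \<one> + b *\<^sub>C e" using Ht[OF x] by blast
    then have "e \<cdot> x = (a + b) *\<^sub>C e" by (simp add: mul_simps e scaleC_add_left)
    then show ?thesis ..
  qed
  then have De: "\<Delta> e = e \<otimes> e" "\<epsilon> e = 1"
    using minimal_idempotent_grouplike[OF e(1-4)] by blast+
  have "\<exists>k. f \<cdot> x = k *\<^sub>C f" if x: "x \<in> Ht" for x
  proof -
    obtain a b where "x = a *\<^sub>C \<one> + b *\<^sub>C e" using Ht[OF x] by blast
    then have "f \<cdot> x = a *\<^sub>C f" by (simp add: mul_simps f)
    then show ?thesis ..
  qed
  then have Df: "\<Delta> f = f \<otimes> f" "\<epsilon> f = 1"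
    using minimal_idempotent_grouplike[OF fH f(1,4)] by blast+
  have E: "E = e \<otimes> e + f \<otimes> f" "E = f \<otimes> f + e \<otimes> e"
    by (simp_all add: one comult_simps De Df)
  from peirce[OF e(3-5)] ns obtain y \<alpha> \<beta> where ind: "independent_triple \<one> e y"
    and y: "y \<cdot> y = 0" "e \<cdot> y = \<alpha> *\<^sub>C y" "y \<cdot> e = \<beta> *\<^sub>C y" and ab: "\<alpha> \<in> {0, 1}" "\<beta> \<in> {0, 1}" by blast
  have fy: "f \<cdot> y = (1 - \<alpha>) *\<^sub>C y" "y \<cdot> f = (1 - \<beta>) *\<^sub>C y"
    by (simp_all add: f_def mul_simps y complex_vector.scale_left_diff_distrib scaleC_one)
  have y0: "y \<noteq> 0" by (rule independent_triple_nonzero[OF ind])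
  have ind_ef: "independent_triple e f y"
    unfolding independent_triple_def
  proof (intro allI impI)
    fix a b c
    assume "a *\<^sub>C e + b *\<^sub>C f + c *\<^sub>C y = 0"
    then have "b *\<^sub>C \<one> + (a - b) *\<^sub>C e + c *\<^sub>C y = 0"
      by (simp add: f_def complex_vector.scale_left_diff_distrib complex_vector.scale_right_diff_distrib algebra_simps)
    with ind have "b = 0 \<and> a - b = 0 \<and> c = 0" unfolding independent_triple_def by blast
    then show "a = 0 \<and> b = 0 \<and> c = 0" by simp
  qed
  have ind_fe: "independent_triple f e y"
    unfolding independent_triple_def
  proof (intro allI impI)
    fix a b c
    assume "a *\<^sub>C f + b *\<^sub>C e + c *\<^sub>C y = 0"
    then have "b *\<^sub>C e + a *\<^sub>C f + c *\<^sub>C y = 0" by (simp add: add.commute)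
    with ind_ef show "a = 0 \<and> b = 0 \<and> c = 0" unfolding independent_triple_def by blast
  qed
  have span: "\<exists>a b c. x = a *\<^sub>C e + b *\<^sub>C f + c *\<^sub>C y" "\<exists>a b c. x = a *\<^sub>C f + b *\<^sub>C e + c *\<^sub>C y" for x
    by (rule triple_spans[OF ind_ef], rule triple_spans[OF ind_fe])
  from ab consider "\<alpha> = 1" "\<beta> = 0" | "\<alpha> = 0" "\<beta> = 1" | "\<alpha> = 1" "\<beta> = 1" | "\<alpha> = 0" "\<beta> = 0" by auto
  then show False
  proof cases
    case 1
    with y fy show False
      by (intro no_single_arrow[OF e(3,4) f(2,3,1) E(1) De(1) Df(1) y0 y(1) _ _ span(1)]) (simp_all add: scaleC_one)
  next
    case 2
    with y fy show False
      by (intro no_single_arrow[OF f(1,4,3,2) e(3) E(2) Df(1) De(1) y0 y(1) _ _ span(2)]) (simp_all add: scaleC_one)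
  next
    case 3
    with y fy show False
      by (intro no_nilpotent_loop[OF e(3) f(2,3,1) E(1) De Df(2) y(1) _ _ ind_ef]) (simp_all add: scaleC_one)
  next
    case 4
    with y fy show False
      by (intro no_nilpotent_loop[OF f(1,3,2) e(3) E(2) Df De(2) y(1) _ _ ind_fe]) (simp_all add: scaleC_one)
  qed
qed


section \<open>The algebra splits\<close>

text \<open>
  The cubic equation of \<open>a\<close> has a root \<open>z\<close>, and the equation of \<open>b = a - z \<one>\<close> has no constant
  term, so \<open>cubic_idempotent\<close> applies to \<open>b\<close>.
\<close>

lemma commutative_power_basis:
  assumes comm: "\<And>x y. x \<cdot> y = y \<cdot> x" and ind: "independent_triple \<one> a (a \<cdot> a)"
  shows "split \<or> (\<exists>y. y \<noteq> 0 \<and> y \<cdot> y = 0 \<and> (\<forall>x. \<exists>k. y \<cdot> x = k *\<^sub>C y))"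
proof -
  obtain c0 c1 c2 where a3: "a \<cdot> (a \<cdot> a) = c0 *\<^sub>C \<one> + c1 *\<^sub>C a + c2 *\<^sub>C (a \<cdot> a)"
    by (rule span_triple[OF ind])
  have "\<not> constant (poly [: - c0, - c1, - c2, 1 :])"
    by (simp add: constant_degree)
  then obtain z where "poly [: - c0, - c1, - c2, 1 :] z = 0"
    using fundamental_theorem_of_algebra by blast
  then have z: "c0 + c1 * z + c2 * z * z - z * z * z = 0"
    by (simp add: algebra_simps)
  define b where "b = a - z *\<^sub>C \<one>"
  have b: "b = (- z) *\<^sub>C \<one> + a" by (simp add: b_def)
  from ind obtain f g h where lin: "clinear f" "clinear g" "clinear h"
    and on: "f \<one> = 1" "f a = 0" "f (a \<cdot> a) = 0" "g \<one> = 0" "g a = 1" "g (a \<cdot> a) = 0"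
      "h \<one> = 0" "h a = 0" "h (a \<cdot> a) = 1"
    and ex: "\<And>x. x = f x *\<^sub>C \<one> + g x *\<^sub>C a + h x *\<^sub>C (a \<cdot> a)" by (rule coordinates) blast
  have eqI: "x = y" if "f x = f y" "g x = g y" "h x = h y" for x y
    using ex[of x] ex[of y] that by metis
  note coord_simps = clinear_rules[OF lin(1)] clinear_rules[OF lin(2)] clinear_rules[OF lin(3)] on
  have bb: "b \<cdot> b = a \<cdot> a - (z + z) *\<^sub>C a + (z * z) *\<^sub>C \<one>"
    by (rule eqI) (simp_all add: b mul_simps coord_simps)
  have cubic: "b \<cdot> (b \<cdot> b) = (c1 + 2 * z * c2 - 3 * z * z) *\<^sub>C b + (c2 - 3 * z) *\<^sub>C (b \<cdot> b)"
    unfolding bb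
    by (rule eqI) (use z in \<open>simp_all add: b mul_simps a3 coord_simps algebra_simps\<close>)
  have indb: "independent_triple \<one> b (b \<cdot> b)"
    unfolding independent_triple_def
  proof (intro allI impI)
    fix r s t
    assume "r *\<^sub>C \<one> + s *\<^sub>C b + t *\<^sub>C (b \<cdot> b) = 0"
    then have "(r - s * z + t * z * z) *\<^sub>C \<one> + (s - t * z - t * z) *\<^sub>C a + t *\<^sub>C (a \<cdot> a) = 0"
      unfolding bb
      by (simp add: b_def scaleC_add_left scaleC_add_right scaleC_scaleC complex_vector.scale_left_diff_distrib
          complex_vector.scale_right_diff_distrib algebra_simps)
    with ind have "r - s * z + t * z * z = 0 \<and> s - t * z - t * z = 0 \<and> t = 0"
      unfolding independent_triple_def by blast
    then show "r = 0 \<and> s = 0 \<and> t = 0" by auto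
  qed
  from cubic_idempotent[OF indb cubic] show ?thesis
  proof
    assume b3: "b \<cdot> (b \<cdot> b) = 0"
    have "b \<cdot> b \<noteq> 0" by (rule independent_triple_nonzero[OF indb])
    moreover have "(b \<cdot> b) \<cdot> (b \<cdot> b) = 0" by (simp add: mul_assoc b3 mul_simps)
    moreover have "\<exists>k. (b \<cdot> b) \<cdot> x = k *\<^sub>C (b \<cdot> b)" for x
    proof -
      obtain r s t where "x = r *\<^sub>C \<one> + s *\<^sub>C b + t *\<^sub>C (b \<cdot> b)" by (rule span_triple[OF indb])
      then have "(b \<cdot> b) \<cdot> x = r *\<^sub>C (b \<cdot> b)" by (simp add: mul_simps mul_assoc b3)
      then show ?thesis ..
    qed
    ultimately show ?thesis by blast
  next
    assume "\<exists>e s t. e = s *\<^sub>C b + t *\<^sub>C (b \<cdot> b) \<and> e \<cdot> e = e \<and> e \<noteq> 0"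
    then obtain e s t where e: "e = s *\<^sub>C b + t *\<^sub>C (b \<cdot> b)" "e \<cdot> e = e" "e \<noteq> 0" by blast
    have "e \<noteq> \<one>"
    proof
      assume "e = \<one>"
      with e(1) have "(-1) *\<^sub>C \<one> + s *\<^sub>C b + t *\<^sub>C (b \<cdot> b) = 0" by (simp add: scaleC_one add.assoc)
      with indb have "(-1 :: complex) = 0" unfolding independent_triple_def by blast
      then show False by simp
    qed
    from peirce[OF e(2,3) this] show ?thesis
    proof (elim disjE exE conjE)
      fix y \<alpha> \<beta>
      assume iy: "independent_triple \<one> e y" and y: "y \<cdot> y = 0" "y \<cdot> e = \<beta> *\<^sub>C y"
      have "y \<noteq> 0" by (rule independent_triple_nonzero[OF iy])
      moreover have "\<exists>k. y \<cdot> x = k *\<^sub>C y" for x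
      proof -
        obtain r s t where "x = r *\<^sub>C \<one> + s *\<^sub>C e + t *\<^sub>C y" by (rule span_triple[OF iy])
        then have "y \<cdot> x = (r + s * \<beta>) *\<^sub>C y" by (simp add: mul_simps y scaleC_add_left scaleC_scaleC)
        then show ?thesis ..
      qed
      ultimately show ?thesis using y by blast
    qed simp
  qed
qed

lemma one_nonzero: "\<one> \<noteq> 0"
proof
  assume "\<one> = 0"
  then have "x = 0" for x :: 'a using one_mul[of x] by (simp add: mul_simps)
  then show False using outside_plane[of 0 0] by (metis add_0 complex_vector.scale_zero_right)
qed

lemma independent_oneI:
  assumes "\<And>k. a \<noteq> k *\<^sub>C \<one>" and "r *\<^sub>C \<one> + s *\<^sub>C a = 0"
  shows "r = 0 \<and> s = 0"
proof (cases "s = 0")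
  case True
  with assms(2) one_nonzero show ?thesis by simp
next
  case False
  have "s *\<^sub>C a = - (r *\<^sub>C \<one>)" using assms(2) by (simp add: add_eq_0_iff2 add.commute)
  from scaleC_cancel[OF this False] have "a = (- inverse s * r) *\<^sub>C \<one>" by (simp add: scaleC_scaleC)
  with assms(1) show ?thesis by blast
qed

text \<open>
  Translating \<open>a\<close> and \<open>b\<close> by scalars makes \<open>a \<cdot> b\<close> a scalar. If \<open>a\<close> or \<open>b\<close> generates the
  algebra, then the algebra is a base algebra and contains no suitable nilpotent. Otherwise
  \<open>a\<close> and \<open>b\<close> satisfy quadratic equations, associativity forces \<open>a \<cdot> b = 0\<close>, \<open>a\<^sup>2 = k a\<close> and
  \<open>b\<^sup>2 = l b\<close>, and \<open>k\<close>, \<open>l\<close> are not zero because \<open>a\<close> and \<open>b\<close> are not nilpotent.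
\<close>

lemma distinct_bases_split:
  assumes a: "a \<in> Hs" and b: "b \<in> Ht" and ind: "independent_triple \<one> a b"
  shows split
proof (rule ccontr)
  assume ns: "\<not> split"
  have ab: "a \<cdot> b = b \<cdot> a" by (rule Hs_Ht_commute[OF a b])
  have comm: "x \<cdot> y = y \<cdot> x" for x y
  proof -
    obtain r s t where x: "x = r *\<^sub>C \<one> + s *\<^sub>C a + t *\<^sub>C b" by (rule span_triple[OF ind])
    obtain r' s' t' where y: "y = r' *\<^sub>C \<one> + s' *\<^sub>C a + t' *\<^sub>C b" by (rule span_triple[OF ind])
    show ?thesis
      by (simp add: x y mul_simps ab scaleC_add_right scaleC_scaleC algebra_simps)
  qed
  obtain c0 \<alpha> \<beta> where abc: "a \<cdot> b = c0 *\<^sub>C \<one> + \<alpha> *\<^sub>C a + \<beta> *\<^sub>C b" by (rule span_triple[OF ind])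
  define a' where "a' = a + (- \<beta>) *\<^sub>C \<one>"
  define b' where "b' = b + (- \<alpha>) *\<^sub>C \<one>"
  define c where "c = c0 + \<alpha> * \<beta>"
  have a': "a' \<in> Hs" and b': "b' \<in> Ht"
    unfolding a'_def b'_def
    by (rule Hs_add[OF a Hs_scale[OF one_in_bases(1)]], rule Ht_add[OF b Ht_scale[OF one_in_bases(2)]])
  have c: "a' \<cdot> b' = c *\<^sub>C \<one>"
    by (simp add: a'_def b'_def c_def mul_simps abc scaleC_add_left scaleC_scaleC algebra_simps)
  have ind': "independent_triple \<one> a' b'"
    unfolding independent_triple_def
  proof (intro allI impI)
    fix r s t
    assume "r *\<^sub>C \<one> + s *\<^sub>C a' + t *\<^sub>C b' = 0"
    then have "(r - s * \<beta> - t * \<alpha>) *\<^sub>C \<one> + s *\<^sub>C a + t *\<^sub>C b = 0"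
      by (simp add: a'_def b'_def scaleC_add_right scaleC_scaleC complex_vector.scale_left_diff_distrib
          complex_vector.scale_right_diff_distrib algebra_simps)
    with ind have "r - s * \<beta> - t * \<alpha> = 0 \<and> s = 0 \<and> t = 0"
      unfolding independent_triple_def by blast
    then show "r = 0 \<and> s = 0 \<and> t = 0" by auto
  qed
  have zero: "r = 0 \<and> s = 0 \<and> t = 0" if "r *\<^sub>C \<one> + s *\<^sub>C a' + t *\<^sub>C b' = 0" for r s t
    using ind' that unfolding independent_triple_def by blast
  have na: "a' \<noteq> k *\<^sub>C \<one>" and nb: "b' \<noteq> k *\<^sub>C \<one>" for k
    using zero[of k "-1" 0] zero[of k 0 "-1"] by (auto simp: scaleC_one)
  have nz: "a' \<noteq> 0" "b' \<noteq> 0" using na[of 0] nb[of 0] by auto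
  have nota: "\<not> independent_triple \<one> a' (a' \<cdot> a')"
  proof
    assume i: "independent_triple \<one> a' (a' \<cdot> a')"
    from commutative_power_basis[OF comm i] ns obtain y where y: "y \<noteq> 0" "y \<cdot> y = 0" "\<And>x. \<exists>k. y \<cdot> x = k *\<^sub>C y"
      by blast
    obtain r s t where "y = r *\<^sub>C \<one> + s *\<^sub>C a' + t *\<^sub>C (a' \<cdot> a')" by (rule span_triple[OF i])
    then have "y \<in> Hs" using one_in_bases a' by (auto intro!: Hs_add Hs_scale Hs_mul)
    from square_zero_not_in_Hs[OF this y] show False .
  qed
  have notb: "\<not> independent_triple \<one> b' (b' \<cdot> b')"
  proof
    assume i: "independent_triple \<one> b' (b' \<cdot> b')"
    from commutative_power_basis[OF comm i] ns obtain y where y: "y \<noteq> 0" "y \<cdot> y = 0" "\<And>x. \<exists>k. y \<cdot> x = k *\<^sub>C y"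
      by blast
    obtain r s t where "y = r *\<^sub>C \<one> + s *\<^sub>C b' + t *\<^sub>C (b' \<cdot> b')" by (rule span_triple[OF i])
    then have "y \<in> Ht" using one_in_bases b' by (auto intro!: Ht_add Ht_scale Ht_mul)
    from square_zero_not_in_Ht[OF this y] show False .
  qed
  obtain \<nu> k where ak: "a' \<cdot> a' = \<nu> *\<^sub>C \<one> + k *\<^sub>C a'"
    using nota independent_tripleI[of \<one> a' "a' \<cdot> a'"] independent_oneI[OF na] by blast
  obtain \<sigma> l where bl: "b' \<cdot> b' = \<sigma> *\<^sub>C \<one> + l *\<^sub>C b'"
    using notb independent_tripleI[of \<one> b' "b' \<cdot> b'"] independent_oneI[OF nb] by blast
  have "(- k * c) *\<^sub>C \<one> + c *\<^sub>C a' + (- \<nu>) *\<^sub>C b' = 0"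
    using mul_assoc[of a' a' b'] by (simp add: ak c mul_simps scaleC_scaleC algebra_simps)
  then have c0: "c = 0" and \<nu>: "\<nu> = 0" using zero[of "- k * c" c "- \<nu>"] by auto
  have "0 *\<^sub>C \<one> + (- \<sigma>) *\<^sub>C a' + 0 *\<^sub>C b' = 0"
    using mul_assoc[of a' b' b'] by (simp add: bl c c0 mul_simps)
  then have \<sigma>: "\<sigma> = 0" using zero[of 0 "- \<sigma>" 0] by auto
  have aa: "a' \<cdot> a' = k *\<^sub>C a'" "a' \<cdot> b' = 0" "b' \<cdot> a' = 0" "b' \<cdot> b' = l *\<^sub>C b'"
    using ak bl c c0 \<nu> \<sigma> comm[of b' a'] by simp_all
  have "k \<noteq> 0"
  proof
    assume "k = 0"
    have "\<exists>m. a' \<cdot> x = m *\<^sub>C a'" for x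
    proof -
      obtain r s t where "x = r *\<^sub>C \<one> + s *\<^sub>C a' + t *\<^sub>C b'" by (rule span_triple[OF ind'])
      then have "a' \<cdot> x = r *\<^sub>C a'" by (simp add: mul_simps aa \<open>k = 0\<close>)
      then show ?thesis ..
    qed
    then show False using square_zero_not_in_Hs[OF a' nz(1)] aa(1) \<open>k = 0\<close> by auto
  qed
  have "l \<noteq> 0"
  proof
    assume "l = 0"
    have "\<exists>m. b' \<cdot> x = m *\<^sub>C b'" for x
    proof -
      obtain r s t where "x = r *\<^sub>C \<one> + s *\<^sub>C a' + t *\<^sub>C b'" by (rule span_triple[OF ind'])
      then have "b' \<cdot> x = r *\<^sub>C b'" by (simp add: mul_simps aa \<open>l = 0\<close>)
      then show ?thesis ..
    qed
    then show False using square_zero_not_in_Ht[OF b' nz(2)] aa(4) \<open>l = 0\<close> by auto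
  qed
  define p where "p = inverse k *\<^sub>C a'"
  define q where "q = inverse l *\<^sub>C b'"
  have pq: "p \<cdot> p = p" "q \<cdot> q = q" "p \<cdot> q = 0" "q \<cdot> p = 0"
    using \<open>k \<noteq> 0\<close> \<open>l \<noteq> 0\<close> by (simp_all add: p_def q_def mul_simps aa scaleC_scaleC)
  have "p \<noteq> 0" "q \<noteq> 0" using nz \<open>k \<noteq> 0\<close> \<open>l \<noteq> 0\<close> by (simp_all add: p_def q_def)
  moreover have "\<one> - p - q \<noteq> 0"
  proof
    assume "\<one> - p - q = 0"
    then have "1 *\<^sub>C \<one> + (- inverse k) *\<^sub>C a' + (- inverse l) *\<^sub>C b' = 0"
      by (simp add: p_def q_def scaleC_one)
    then show False using zero[of 1 "- inverse k" "- inverse l"] by auto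
  qed
  ultimately have split by (rule splitI) (simp_all add: pq mul_simps)
  with ns show False ..
qed

text \<open>
  Unless a base algebra is trivial or the two base algebras together span the algebra, both are equal
  to the span of \<open>\<one>\<close> and a vector \<open>w\<close> with scalar square. This square is not zero, so the base is
  spanned by two orthogonal idempotents.
\<close>

theorem algebra_splits: split
proof -
  have trivial: split if "(\<forall>x\<in>Ht. \<exists>k. x = k *\<^sub>C \<one>) \<or> (\<forall>x\<in>Hs. \<exists>k. x = k *\<^sub>C \<one>)"
    using minimal_idempotent_grouplike[OF one_in_bases _ one_nonzero] that hopf_split by simp
  show ?thesis
  proof (rule ccontr)
    assume ns: "\<not> split"
    with trivial obtain a b where a: "a \<in> Hs" "\<And>k. a \<noteq> k *\<^sub>C \<one>" and b: "b \<in> Ht" "\<And>k. b \<noteq> k *\<^sub>C \<one>"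
      by blast
    have dep: "\<not> independent_triple \<one> x y" if "x \<in> Hs" "y \<in> Ht" for x y
      using distinct_bases_split[OF that] ns by blast
    have Ht: "\<exists>r s. y = r *\<^sub>C \<one> + s *\<^sub>C a" if "y \<in> Ht" for y
      using dep[OF a(1) that] independent_tripleI[of \<one> a y] independent_oneI[OF a(2)] by blast
    then obtain r s where rs: "b = r *\<^sub>C \<one> + s *\<^sub>C a" using b(1) by blast
    have "s \<noteq> 0" using b(2)[of r] rs by auto
    have "s *\<^sub>C a = b + (- r) *\<^sub>C \<one>" by (simp add: rs)
    from scaleC_cancel[OF this \<open>s \<noteq> 0\<close>] have aT: "a \<in> Ht"
      using Ht_scale[OF Ht_add[OF b(1) Ht_scale[OF one_in_bases(2)]]] by metis
    then have "a \<cdot> a \<in> Ht" by (simp add: Ht_mul)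
    then obtain u t where aa: "a \<cdot> a = u *\<^sub>C \<one> + t *\<^sub>C a" using Ht by blast
    define w where "w = a + (- (t / 2)) *\<^sub>C \<one>"
    define n where "n = u + (t / 2) * (t / 2)"
    have wH: "w \<in> Hs" "w \<in> Ht"
      unfolding w_def
      by (rule Hs_add[OF a(1) Hs_scale[OF one_in_bases(1)]], rule Ht_add[OF aT Ht_scale[OF one_in_bases(2)]])
    have "w \<cdot> w = a \<cdot> a - (t / 2 + t / 2) *\<^sub>C a + (t / 2 * (t / 2)) *\<^sub>C \<one>"
      unfolding w_def scaleC_add_left by (simp add: mul_simps scaleC_scaleC complex_vector.scale_right_diff_distrib)
    then have ww: "w \<cdot> w = n *\<^sub>C \<one>" by (simp add: aa n_def scaleC_add_left)
    have Htw: "\<exists>r s. y = r *\<^sub>C \<one> + s *\<^sub>C w" if y: "y \<in> Ht" for y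
    proof -
      obtain r s where "y = r *\<^sub>C \<one> + s *\<^sub>C a" using Ht[OF y] by blast
      then have "y = (r + s * (t / 2)) *\<^sub>C \<one> + s *\<^sub>C w"
        by (simp add: w_def scaleC_add_left scaleC_add_right scaleC_scaleC complex_vector.scale_right_diff_distrib)
      then show ?thesis by blast
    qed
    have nw: "w \<noteq> k *\<^sub>C \<one>" for k
    proof
      assume "w = k *\<^sub>C \<one>"
      then have "a = (k + t / 2) *\<^sub>C \<one>" by (simp add: w_def scaleC_add_left algebra_simps)
      with a(2) show False by blast
    qed
    show False
    proof (cases "n = 0")
      case True
      have "\<exists>k. w \<cdot> x = k *\<^sub>C w" if x: "x \<in> Ht" for x
      proof -
        obtain r s where "x = r *\<^sub>C \<one> + s *\<^sub>C w" using Htw[OF x] by blast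
        then have "w \<cdot> x = r *\<^sub>C w" by (simp add: mul_simps ww True)
        then show ?thesis ..
      qed
      moreover have "w \<noteq> 0" using nw[of 0] by simp
      moreover have "w \<cdot> w = 0" by (simp add: ww True)
      ultimately show False using square_zero_not_in_Hs[OF wH(1)] by blast
    next
      case False
      define m where "m = csqrt n"
      have m: "m \<noteq> 0" "m * m = n"
        using False power2_csqrt[of n] by (auto simp: m_def power2_eq_square)
      define e where "e = (1 / 2) *\<^sub>C \<one> + (inverse (2 * m)) *\<^sub>C w"
      have eH: "e \<in> Hs" "e \<in> Ht"
        unfolding e_def
        by (rule Hs_add[OF Hs_scale[OF one_in_bases(1)] Hs_scale[OF wH(1)]],
            rule Ht_add[OF Ht_scale[OF one_in_bases(2)] Ht_scale[OF wH(2)]])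
      have "e \<cdot> e = (1/4 + inverse (2 * m) * inverse (2 * m) * n) *\<^sub>C \<one>
          + (inverse (2 * m) / 2 + inverse (2 * m) / 2) *\<^sub>C w"
        unfolding e_def scaleC_add_left by (simp add: mul_simps ww scaleC_scaleC scaleC_add_right)
      also have "1/4 + inverse (2 * m) * inverse (2 * m) * n = 1/2"
        using m(1) by (simp add: m(2)[symmetric] field_simps)
      finally have ee: "e \<cdot> e = e" by (simp add: e_def)
      have e_scal: "e \<noteq> k *\<^sub>C \<one>" for k
      proof
        assume "e = k *\<^sub>C \<one>"
        then have "inverse (2 * m) *\<^sub>C w = (k - 1 / 2) *\<^sub>C \<one>"
          by (simp add: e_def complex_vector.scale_left_diff_distrib algebra_simps)
        from scaleC_cancel[OF this] m(1) nw show False by (auto simp: scaleC_scaleC)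
      qed
      have "\<exists>r s. x = r *\<^sub>C \<one> + s *\<^sub>C e" if x: "x \<in> Ht" for x
      proof -
        obtain r s where "x = r *\<^sub>C \<one> + s *\<^sub>C w" using Htw[OF x] by blast
        moreover have "s *\<^sub>C w = (- (s * m)) *\<^sub>C \<one> + (s * (2 * m)) *\<^sub>C e"
          using m(1) by (simp add: e_def scaleC_add_right scaleC_scaleC)
        ultimately have "x = (r - s * m) *\<^sub>C \<one> + (s * (2 * m)) *\<^sub>C e"
          by (simp add: complex_vector.scale_left_diff_distrib)
        then show ?thesis by blast
      qed
      moreover have "e \<noteq> 0" "e \<noteq> \<one>" using e_scal[of 0] e_scal[of 1] by (auto simp: scaleC_one)
      ultimately have split using base_of_two_idempotents_split[OF eH ee] by blast
      with ns show False ..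
    qed
  qed
qed

end

section \<open>Weak Hopf structures on a split commutative algebra\<close>

lemma dual_basis_eq_iff:
  assumes "dual_basis p c"
  shows "x = y \<longleftrightarrow> (\<forall>i. c i x = c i y)"
  using dual_basis_eqI[OF assms] by metis

definition comult_const where "comult_const H p c i j k = pairing (c j) (c k) (comult H (p i))"
definition counit_const where "counit_const H p i = counit H (p i)"
definition antipode_const where "antipode_const H p c i j = (c j (antipode H (p i)) :: complex)"

text \<open>
  If \<open>\<Delta>(p\<^sub>i) = \<Sum> T\<^sub>i\<^sub>j\<^sub>k p\<^sub>j \<otimes> p\<^sub>k\<close>, \<open>\<epsilon>(p\<^sub>i) = e\<^sub>i\<close> and \<open>S(p\<^sub>i) = \<Sum> s\<^sub>i\<^sub>j p\<^sub>j\<close> for orthogonal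
  idempotents \<open>p\<^sub>i\<close> with sum \<open>1\<close>, these are the axioms of a weak Hopf algebra, coordinate by
  coordinate: coassociativity, the two counit laws, multiplicativity of \<open>\<Delta>\<close>, the axiom on
  \<open>(\<Delta> \<otimes> id) \<Delta>(1)\<close>, weak multiplicativity of \<open>\<epsilon>\<close>, and the three antipode axioms.
  Multiplicativity of \<open>\<Delta>\<close> makes each \<open>T\<^sub>i\<^sub>j\<^sub>k\<close> either \<open>0\<close> or \<open>1\<close>, so that \<open>T\<close> is the graph of a partial
  operation with \<open>j \<circ> k = i\<close> iff \<open>T\<^sub>i\<^sub>j\<^sub>k = 1\<close>; its identities are the \<open>i\<close> with \<open>e\<^sub>i = 1\<close>.
\<close>

definition groupoid_constants ::
  "('n::finite \<Rightarrow> 'n \<Rightarrow> 'n \<Rightarrow> complex) \<Rightarrow> ('n \<Rightarrow> complex) \<Rightarrow> ('n \<Rightarrow> 'n \<Rightarrow> complex) \<Rightarrow> bool"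
  where "groupoid_constants T e s \<longleftrightarrow>
     (\<forall>i j k l. (\<Sum>a\<in>UNIV. T i a l * T a j k) = (\<Sum>a\<in>UNIV. T i j a * T a k l))
   \<and> (\<forall>i k. (\<Sum>j\<in>UNIV. e j * T i j k) = of_bool (i = k))
   \<and> (\<forall>i j. (\<Sum>k\<in>UNIV. e k * T i j k) = of_bool (i = j))
   \<and> (\<forall>i i' j k. of_bool (i = i') * T i j k = T i j k * T i' j k)
   \<and> (\<forall>j k l. (\<Sum>a\<in>UNIV. (\<Sum>i\<in>UNIV. T i a l) * T a j k) = (\<Sum>i\<in>UNIV. T i j k) * (\<Sum>i\<in>UNIV. T i k l))
   \<and> (\<forall>a b c. of_bool (a = b \<and> b = c) * e a = T b a c * (e a * e c))
   \<and> (\<forall>i j. (\<Sum>k\<in>UNIV. T i j k * s k j) = (\<Sum>a\<in>UNIV. T a i j) * e i)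
   \<and> (\<forall>i k. (\<Sum>j\<in>UNIV. T i j k * s j k) = (\<Sum>a\<in>UNIV. T a k i) * e i)
   \<and> (\<forall>i b. (\<Sum>a\<in>UNIV. \<Sum>d\<in>UNIV. (\<Sum>x\<in>UNIV. T i x d * T x a b) * (s a b * s d b)) = s i b)"

locale diagonal_data =
  fixes H :: "'a::complex_vector weak_hopf_data" and p :: "'n::finite \<Rightarrow> 'a" and c :: "'n \<Rightarrow> 'a \<Rightarrow> complex"
  assumes basis: "dual_basis p c"
    and linear_mult: "clinear (mult H)" and linear_unit: "clinear (unit_map H)"
    and linear_comult: "clinear (comult H)" and linear_counit: "clinear (counit H)"
    and linear_antipode: "clinear (antipode H)"
    and mult_basis: "\<And>i j. mult H (p i \<otimes> p j) = (if i = j then p i else 0)"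
    and unit_basis: "unit_map H 1 = (\<Sum>i\<in>UNIV. p i)"
begin

abbreviation "T \<equiv> comult_const H p c"
abbreviation "e \<equiv> counit_const H p"
abbreviation "s \<equiv> antipode_const H p c"

abbreviation mul where "mul \<equiv> \<lambda>x y. mult H (x \<otimes> y)"
abbreviation mul2 where "mul2 \<equiv> tensor_mult mul mul"
abbreviation mul3 where "mul3 \<equiv> tensor_mult mul2 mul"
abbreviation one where "one \<equiv> unit_map H 1"

abbreviation P where "P j k \<equiv> pairing (c j) (c k)"
abbreviation Q where "Q j k l \<equiv> pairing (P j k) (c l)"

lemmas lin_c = dual_basisD(1)[OF basis]
lemmas c_p = dual_basisD(2)[OF basis]
lemmas expand = dual_basisD(3)[OF basis]

lemma lin_P: "clinear (P j k)" by (intro clinear_pairing lin_c)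

lemma P_elem: "P j k (x \<otimes> y) = c j x * c k y" by (simp add: lin_c)
lemma Q_elem: "Q j k l (t \<otimes> y) = P j k t * c l y" by (simp add: lin_c lin_P)

lemmas P_simps = clinear_rules[OF lin_P] P_elem
lemmas Q_simps = clinear_rules[OF clinear_pairing[OF lin_P lin_c]] Q_elem

lemma bilinear_mul: "cbilinear mul"
  by (rule cbilinear_post[OF cbilinear_tensor_elem linear_mult])

lemma bilinear_mul2: "cbilinear mul2" by (intro cbilinear_tensor_mult bilinear_mul)
lemma bilinear_mul3: "cbilinear mul3" by (intro cbilinear_tensor_mult bilinear_mul bilinear_mul2)

lemmas mul_linear = cbilinear_rules[OF bilinear_mul]

lemma c_mul: "c i (mult H (x \<otimes> y)) = c i x * c i y"
proof -
  have "mult H ((\<Sum>i\<in>UNIV. c i x *\<^sub>C p i) \<otimes> (\<Sum>i\<in>UNIV. c i y *\<^sub>C p i)) = (\<Sum>i\<in>UNIV. (c i x * c i y) *\<^sub>C p i)"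
    by (simp add: mul_linear mult_basis scaleC_scaleC if_distrib[of "\<lambda>z. _ *\<^sub>C z"] sum.delta' cong: if_cong)
      (simp add: mult.commute)
  then have "mult H (x \<otimes> y) = (\<Sum>i\<in>UNIV. (c i x * c i y) *\<^sub>C p i)" by (simp only: expand)
  then show ?thesis
    by (simp add: clinear_rules[OF lin_c] c_p)
qed

lemma c_one: "c i one = 1"
  by (simp add: unit_basis clinear_rules[OF lin_c] c_p)

lemma P_mul2: "P j k (mul2 t u) = P j k t * P j k u"
proof (induction t rule: tensor_induct)
  case (elem x y)
  show ?case
    by (induction u rule: tensor_induct)
      (simp_all add: tensor_mult_elem[OF bilinear_mul bilinear_mul] cbilinear_rules[OF bilinear_mul2] P_simps c_mul algebra_simps)
qed (simp add: cbilinear_rules[OF bilinear_mul2] P_simps algebra_simps)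

lemma Q_mul3: "Q j k l (mul3 t u) = Q j k l t * Q j k l u"
proof (induction t rule: tensor_induct)
  case (elem x y)
  show ?case
    by (induction u rule: tensor_induct)
      (simp_all add: tensor_mult_elem[OF bilinear_mul2 bilinear_mul] cbilinear_rules[OF bilinear_mul3] Q_simps P_mul2 c_mul algebra_simps)
qed (simp add: cbilinear_rules[OF bilinear_mul3] Q_simps algebra_simps)

lemma linear_expand:
  assumes "clinear f"
  shows "f x = (\<Sum>i\<in>UNIV. c i x *\<^sub>C f (p i))"
proof -
  have "f (\<Sum>i\<in>UNIV. c i x *\<^sub>C p i) = (\<Sum>i\<in>UNIV. c i x *\<^sub>C f (p i))"
    by (simp add: clinear_rules[OF assms])
  then show ?thesis by (simp only: expand)
qed

lemma P_comult: "P j k (comult H x) = (\<Sum>i\<in>UNIV. c i x * T i j k)"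
  using linear_expand[OF clinear_compose[OF lin_P linear_comult], of j k x] by (simp add: comult_const_def)

lemma counit_expand: "counit H x = (\<Sum>i\<in>UNIV. c i x * e i)"
  using linear_expand[OF linear_counit, of x] by (simp add: counit_const_def)

lemma c_antipode: "c j (antipode H x) = (\<Sum>i\<in>UNIV. c i x * s i j)"
  using linear_expand[OF clinear_compose[OF lin_c linear_antipode], of j x] by (simp add: antipode_const_def)

lemma Q_comult_left: "Q j k l (tensor_map (comult H) id t) = (\<Sum>a\<in>UNIV. P a l t * T a j k)"
proof (induction t rule: tensor_induct)
  case (elem x y)
  show ?case
    by (simp only: tensor_map_id_right[OF linear_comult] Q_elem P_comult P_elem)
      (simp add: sum_distrib_left sum_distrib_right mult_ac)
next
  case (add t u)
  then show ?case
    by (simp only: clinear_add[OF clinear_tensor_map[OF linear_comult clinear_id]] Q_simps P_simps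
        distrib_right sum.distrib)
qed

lemma Q_assoc: "Q j k l (assoc (x \<otimes> t)) = c j x * P k l t"
  by (induction t rule: tensor_induct)
    (simp_all add: tensor_simps clinear_rules[OF clinear_assoc] P_simps Q_simps algebra_simps)

lemma Q_comult_right: "Q j k l (assoc (tensor_map id (comult H) t)) = (\<Sum>a\<in>UNIV. P j a t * T a k l)"
proof (induction t rule: tensor_induct)
  case (elem x y)
  show ?case
    by (simp only: tensor_map_id_left[OF linear_comult] Q_assoc P_comult P_elem)
      (simp add: sum_distrib_left sum_distrib_right mult_ac)
next
  case (add t u)
  then show ?case
    by (simp only: clinear_add[OF clinear_tensor_map[OF clinear_id linear_comult]]
        clinear_add[OF clinear_assoc] Q_simps P_simps distrib_right sum.distrib)
qed

lemma pairing_counit_left: "pairing (counit H) (c k) t = (\<Sum>a\<in>UNIV. P a k t * e a)"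
proof (induction t rule: tensor_induct)
  case (elem x y)
  show ?case
    by (rule trans[OF pairing_elem[OF linear_counit lin_c]])
      (simp add: counit_expand P_elem sum_distrib_right sum_distrib_left mult_ac)
next
  case (add t u)
  then show ?case
    by (simp only: clinear_add[OF clinear_pairing[OF linear_counit lin_c]] P_simps distrib_right sum.distrib)
qed

lemma pairing_counit_right: "pairing (c j) (counit H) t = (\<Sum>a\<in>UNIV. P j a t * e a)"
proof (induction t rule: tensor_induct)
  case (elem x y)
  show ?case
    by (rule trans[OF pairing_elem[OF lin_c linear_counit]])
      (simp add: counit_expand P_elem sum_distrib_right sum_distrib_left mult_ac)
next
  case (add t u)
  then show ?case
    by (simp only: clinear_add[OF clinear_pairing[OF lin_c linear_counit]] P_simps distrib_right sum.distrib)
qed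

lemma c_left_unitor: "c k (left_unitor (tensor_map (counit H) id t)) = (\<Sum>a\<in>UNIV. P a k t * e a)"
  using pairing_lcontr[OF linear_counit lin_c, of k t]
  by (simp only: left_unitor_tensor_map[OF linear_counit] pairing_counit_left)

lemma c_right_unitor: "c j (right_unitor (tensor_map id (counit H) t)) = (\<Sum>a\<in>UNIV. P j a t * e a)"
  using pairing_rcontr[OF lin_c linear_counit, of j t]
  by (simp only: right_unitor_tensor_map[OF linear_counit] pairing_counit_right)

lemma c_mult_antipode_right:
  "c j (mult H (tensor_map id (antipode H) t)) = (\<Sum>k\<in>UNIV. P j k t * s k j)"
proof (induction t rule: tensor_induct)
  case (elem x y)
  show ?case
    by (simp only: tensor_map_id_left[OF linear_antipode] c_mul c_antipode P_elem)
      (simp add: sum_distrib_left mult_ac)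
next
  case (add t u)
  then show ?case
    by (simp only: clinear_add[OF clinear_tensor_map[OF clinear_id linear_antipode]]
        clinear_add[OF linear_mult] clinear_add[OF lin_c] P_simps distrib_right sum.distrib)
qed

lemma c_mult_antipode_left:
  "c k (mult H (tensor_map (antipode H) id t)) = (\<Sum>j\<in>UNIV. P j k t * s j k)"
proof (induction t rule: tensor_induct)
  case (elem x y)
  show ?case
    by (simp only: tensor_map_id_right[OF linear_antipode] c_mul c_antipode P_elem)
      (simp add: sum_distrib_left sum_distrib_right mult_ac)
next
  case (add t u)
  then show ?case
    by (simp only: clinear_add[OF clinear_tensor_map[OF linear_antipode clinear_id]]
        clinear_add[OF linear_mult] clinear_add[OF lin_c] P_simps distrib_right sum.distrib)
qed

lemma c_antipode_triple:
  "c b (mult H (tensor_map (mult H) id (tensor_map (tensor_map (antipode H) id) (antipode H) u)))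
    = (\<Sum>a\<in>UNIV. \<Sum>d\<in>UNIV. Q a b d u * (s a b * s d b))"
proof (induction u rule: tensor_induct)
  case (elem t y)
  have "c b (mult H (tensor_map (antipode H) id t)) * c b (antipode H y)
      = (\<Sum>a\<in>UNIV. P a b t * s a b) * (\<Sum>d\<in>UNIV. c d y * s d b)"
    by (simp only: c_mult_antipode_left c_antipode)
  also have "\<dots> = (\<Sum>a\<in>UNIV. \<Sum>d\<in>UNIV. Q a b d (t \<otimes> y) * (s a b * s d b))"
    unfolding sum_product Q_elem by (intro sum.cong refl) (simp only: mult_ac)
  finally show ?case
    by (simp only: tensor_map_elem[OF clinear_tensor_map[OF linear_antipode clinear_id] linear_antipode]
        tensor_map_id_right[OF linear_mult] c_mul)
next
  case (add t u)
  then show ?case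
    by (simp only: clinear_add[OF clinear_tensor_map[OF clinear_tensor_map[OF linear_antipode clinear_id] linear_antipode]]
        clinear_add[OF clinear_tensor_map[OF linear_mult clinear_id]]
        clinear_add[OF linear_mult] clinear_add[OF lin_c] Q_simps distrib_right sum.distrib)
qed

lemma tensor_eq_iff: "t = u \<longleftrightarrow> (\<forall>j k. P j k t = P j k u)"
  using dual_basis_eq_iff[OF dual_basis_tensor[OF basis basis], of t u] by auto

lemma tensor3_eq_iff: "t = u \<longleftrightarrow> (\<forall>j k l. Q j k l t = Q j k l u)"
  using dual_basis_eq_iff[OF dual_basis_tensor[OF dual_basis_tensor[OF basis basis] basis], of t u] by auto

lemma basis_all_iff:
  assumes "clinear f" "clinear g"
  shows "(\<forall>x. f x = g x) \<longleftrightarrow> (\<forall>i. f (p i) = g (p i))"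
  by (rule dual_basis_clinear_eq_iff[OF basis assms])

text \<open>
  Evaluation of an expansion at a basis vector. With \<open>one_sum\<close> below it reduces each axiom, which is
  linear in its variables, to an identity between structure constants.
\<close>

lemma delta_sum: "(\<Sum>i\<in>UNIV. c i (p a) * f i) = f a"
  by (simp add: c_p of_bool_def if_distrib[of "\<lambda>z. z * _"] sum.delta cong: if_cong)

lemma one_sum: "(\<Sum>i\<in>UNIV. c i one * f i) = sum f UNIV"
  by (simp add: c_one)

lemma unital: "unital_algebra (mult H) (unit_map H)"
  unfolding unital_algebra_def
  by (intro conjI allI linear_mult linear_unit)
    (simp_all add: dual_basis_eq_iff[OF basis] c_mul c_one mult.assoc)

lemma coassoc_iff: "(\<forall>x. tensor_map (comult H) id (comult H x) = assoc (tensor_map id (comult H) (comult H x)))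
    \<longleftrightarrow> (\<forall>i j k l. (\<Sum>a\<in>UNIV. T i a l * T a j k) = (\<Sum>a\<in>UNIV. T i j a * T a k l))"
  (is "(\<forall>x. ?f x = ?g x) \<longleftrightarrow> _")
proof -
  have lin: "clinear ?f" "clinear ?g"
    by (rule clinear_compose[OF clinear_tensor_map[OF linear_comult clinear_id] linear_comult],
        rule clinear_compose[OF clinear_assoc clinear_compose[OF clinear_tensor_map[OF clinear_id linear_comult] linear_comult]])
  show ?thesis
    unfolding basis_all_iff[OF lin]
    by (simp only: tensor3_eq_iff Q_comult_left Q_comult_right P_comult delta_sum)
qed

lemma counit_iff: "(\<forall>x. left_unitor (tensor_map (counit H) id (comult H x)) = x
      \<and> right_unitor (tensor_map id (counit H) (comult H x)) = x)
    \<longleftrightarrow> (\<forall>i k. (\<Sum>j\<in>UNIV. e j * T i j k) = of_bool (i = k)) \<and> (\<forall>i j. (\<Sum>k\<in>UNIV. e k * T i j k) = of_bool (i = j))"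
  (is "(\<forall>x. ?f x = x \<and> ?g x = x) \<longleftrightarrow> _")
proof -
  have lin: "clinear ?f" "clinear ?g"
    by (rule clinear_compose[OF clinear_left_unitor clinear_compose[OF clinear_tensor_map[OF linear_counit clinear_id] linear_comult]],
        rule clinear_compose[OF clinear_right_unitor clinear_compose[OF clinear_tensor_map[OF clinear_id linear_counit] linear_comult]])
  have "(\<forall>x. ?f x = x) \<longleftrightarrow> (\<forall>i k. (\<Sum>j\<in>UNIV. T i j k * e j) = c k (p i))"
    "(\<forall>x. ?g x = x) \<longleftrightarrow> (\<forall>i j. (\<Sum>k\<in>UNIV. T i j k * e k) = c j (p i))"
    unfolding basis_all_iff[OF lin(1) clinear_ident] basis_all_iff[OF lin(2) clinear_ident]
    by (simp_all only: dual_basis_eq_iff[OF basis]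
        c_left_unitor c_right_unitor P_comult delta_sum)
  then show ?thesis
    by (simp add: all_conj_distrib c_p mult.commute eq_commute)
qed

lemma comult_mult_iff: "(\<forall>x y. comult H (mult H (x \<otimes> y)) = mul2 (comult H x) (comult H y))
    \<longleftrightarrow> (\<forall>i i' j k. of_bool (i = i') * T i j k = T i j k * T i' j k)"
proof -
  have "(\<forall>y. comult H (mult H (x \<otimes> y)) = mul2 (comult H x) (comult H y))
      \<longleftrightarrow> (\<forall>i. comult H (mult H (x \<otimes> p i)) = mul2 (comult H x) (comult H (p i)))" for x
    by (rule basis_all_iff[OF clinear_compose[OF linear_comult cbilinear_right[OF bilinear_mul]]
          clinear_compose[OF cbilinear_right[OF bilinear_mul2] linear_comult]])
  moreover have "(\<forall>x. comult H (mult H (x \<otimes> y)) = mul2 (comult H x) (comult H y))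
      \<longleftrightarrow> (\<forall>i. comult H (mult H (p i \<otimes> y)) = mul2 (comult H (p i)) (comult H y))" for y
    by (rule basis_all_iff[OF clinear_compose[OF linear_comult cbilinear_left[OF bilinear_mul]]
          clinear_compose[OF cbilinear_left[OF bilinear_mul2] linear_comult]])
  ultimately have "(\<forall>x y. comult H (mult H (x \<otimes> y)) = mul2 (comult H x) (comult H y))
    \<longleftrightarrow> (\<forall>i i'. comult H (mult H (p i \<otimes> p i')) = mul2 (comult H (p i)) (comult H (p i')))"
    by blast
  also have "\<dots> \<longleftrightarrow> (\<forall>i i' j k. of_bool (i = i') * T i j k = T i j k * T i' j k)"
  proof -
    have "P j k (comult H (mult H (p i \<otimes> p i'))) = of_bool (i = i') * T i j k" for i i' j k
      by (simp add: mult_basis clinear_zero[OF linear_comult] P_simps comult_const_def)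
    then show ?thesis by (simp only: tensor_eq_iff P_mul2 P_comult delta_sum)
  qed
  finally show ?thesis .
qed

lemma comult_one_iff:
  "(tensor_map (comult H) id (comult H one) = mul3 (comult H one \<otimes> one) (assoc (one \<otimes> comult H one))
    \<and> tensor_map (comult H) id (comult H one) = mul3 (assoc (one \<otimes> comult H one)) (comult H one \<otimes> one))
  \<longleftrightarrow> (\<forall>j k l. (\<Sum>a\<in>UNIV. (\<Sum>i\<in>UNIV. T i a l) * T a j k) = (\<Sum>i\<in>UNIV. T i j k) * (\<Sum>i\<in>UNIV. T i k l))"
  unfolding tensor3_eq_iff Q_mul3 Q_comult_left Q_assoc Q_elem P_comult one_sum c_one mult_1_left mult_1_right
  by (auto simp: mult.commute)

lemma counit_mult_iff: "(\<forall>x y z. counit H (mult H (mult H (x \<otimes> y) \<otimes> z))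
      = tensor_lift (\<lambda>y\<^sub>1 y\<^sub>2. counit H (mult H (x \<otimes> y\<^sub>1)) * counit H (mult H (y\<^sub>2 \<otimes> z))) (comult H y))
    \<longleftrightarrow> (\<forall>a b c. of_bool (a = b \<and> b = c) * e a = T b a c * (e a * e c))"
proof -
  let ?l = "\<lambda>x u. counit H (mult H (x \<otimes> u))" and ?r = "\<lambda>z v. counit H (mult H (v \<otimes> z))"
  have lin: "clinear (?l x)" "clinear (?r x)" for x
    by (rule clinear_compose[OF linear_counit cbilinear_right[OF bilinear_mul]],
        rule clinear_compose[OF linear_counit cbilinear_left[OF bilinear_mul]])
  have c3: "counit H (mult H (mult H (x \<otimes> y) \<otimes> z)) = (\<Sum>a\<in>UNIV. c a x * c a y * c a z * e a)" for x y z
    by (simp add: counit_expand c_mul)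
  have pr: "pairing (?l x) (?r z) t = (\<Sum>a\<in>UNIV. \<Sum>d\<in>UNIV. P a d t * (c a x * e a * (c d z * e d)))" for x z t
  proof (induction t rule: tensor_induct)
    case (elem u v)
    have "?l x u * ?r z v = (\<Sum>a\<in>UNIV. \<Sum>d\<in>UNIV. P a d (u \<otimes> v) * (c a x * e a * (c d z * e d)))"
      unfolding counit_expand c_mul sum_product P_elem
      by (intro sum.cong refl) (simp only: mult_ac)
    then show ?case by (rule trans[OF pairing_elem[OF lin]])
  next
    case (add t u)
    then show ?case
      by (simp only: clinear_add[OF clinear_pairing[OF lin]] P_simps distrib_right sum.distrib)
  qed
  have "tensor_lift (\<lambda>y\<^sub>1 y\<^sub>2. counit H (mult H (x \<otimes> y\<^sub>1)) * counit H (mult H (y\<^sub>2 \<otimes> z))) t = pairing (?l x) (?r z) t" for x z t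
    by (simp add: pairing_def)
  then have reduce: "?thesis \<longleftrightarrow> ((\<forall>x y z. (\<Sum>a\<in>UNIV. c a x * c a y * c a z * e a)
      = (\<Sum>a\<in>UNIV. \<Sum>d\<in>UNIV. (\<Sum>b\<in>UNIV. c b y * T b a d) * (c a x * e a * (c d z * e d))))
    \<longleftrightarrow> (\<forall>a b c. of_bool (a = b \<and> b = c) * e a = T b a c * (e a * e c)))"
    by (simp only: c3 pr P_comult)
  show ?thesis
    unfolding reduce
  proof
    assume *: "\<forall>x y z. (\<Sum>a\<in>UNIV. c a x * c a y * c a z * e a)
      = (\<Sum>a\<in>UNIV. \<Sum>d\<in>UNIV. (\<Sum>b\<in>UNIV. c b y * T b a d) * (c a x * e a * (c d z * e d)))"
    show "\<forall>a b c. of_bool (a = b \<and> b = c) * e a = T b a c * (e a * e c)"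
    proof (intro allI)
      fix i j k
      have "(\<Sum>a\<in>UNIV. c a (p i) * c a (p j) * c a (p k) * e a) = of_bool (i = j \<and> j = k) * e i"
        using delta_sum[of i "\<lambda>a. c a (p j) * c a (p k) * e a"] by (simp add: mult.assoc) (auto simp: c_p)
      moreover have "(\<Sum>a\<in>UNIV. \<Sum>d\<in>UNIV. T j a d * (c a (p i) * e a * (c d (p k) * e d))) = T j i k * (e i * e k)"
      proof -
        have "(\<Sum>a\<in>UNIV. \<Sum>d\<in>UNIV. T j a d * (c a (p i) * e a * (c d (p k) * e d)))
          = (\<Sum>a\<in>UNIV. c a (p i) * (\<Sum>d\<in>UNIV. c d (p k) * (T j a d * e a * e d)))"
          unfolding sum_distrib_left by (intro sum.cong refl) (simp only: mult_ac)
        then show ?thesis by (simp only: delta_sum mult.assoc)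
      qed
      ultimately show "of_bool (i = j \<and> j = k) * e i = T j i k * (e i * e k)"
        using *[rule_format, of "p i" "p j" "p k"] by (simp only: delta_sum)
    qed
  next
    assume *: "\<forall>a b c. of_bool (a = b \<and> b = c) * e a = T b a c * (e a * e c)"
    show "\<forall>x y z. (\<Sum>a\<in>UNIV. c a x * c a y * c a z * e a)
      = (\<Sum>a\<in>UNIV. \<Sum>d\<in>UNIV. (\<Sum>b\<in>UNIV. c b y * T b a d) * (c a x * e a * (c d z * e d)))"
    proof (intro allI)
      fix x y z
      have "(\<Sum>b\<in>UNIV. c b y * T b a d) * (c a x * e a * (c d z * e d)) = (if a = d then c a x * c a y * c a z * e a else 0)" for a d
      proof -
        have "(\<Sum>b\<in>UNIV. c b y * T b a d) * (c a x * e a * (c d z * e d))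
          = (\<Sum>b\<in>UNIV. c b y * c a x * c d z * (T b a d * (e a * e d)))"
          unfolding sum_distrib_right by (intro sum.cong refl) (simp only: mult_ac)
        also have "\<dots> = (\<Sum>b\<in>UNIV. if b = a then (if a = d then c a x * c a y * c a z * e a else 0) else 0)"
          by (intro sum.cong refl) (simp only: *[rule_format, symmetric], auto simp: mult_ac)
        finally show ?thesis by simp
      qed
      then show "(\<Sum>a\<in>UNIV. c a x * c a y * c a z * e a)
        = (\<Sum>a\<in>UNIV. \<Sum>d\<in>UNIV. (\<Sum>b\<in>UNIV. c b y * T b a d) * (c a x * e a * (c d z * e d)))"
        by simp
    qed
  qed
qed

lemma antipode_right_iff: "(\<forall>x. mult H (tensor_map id (antipode H) (comult H x))
      = left_unitor (tensor_map (counit H) id (mul2 (comult H one) (x \<otimes> one))))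
    \<longleftrightarrow> (\<forall>i j. (\<Sum>k\<in>UNIV. T i j k * s k j) = (\<Sum>a\<in>UNIV. T a i j) * e i)"
  (is "(\<forall>x. ?f x = ?g x) \<longleftrightarrow> _")
proof -
  have lin: "clinear ?f" "clinear ?g"
    by (rule clinear_compose[OF linear_mult clinear_compose[OF clinear_tensor_map[OF clinear_id linear_antipode] linear_comult]],
        rule clinear_compose[OF clinear_left_unitor clinear_compose[OF clinear_tensor_map[OF linear_counit clinear_id]
          clinear_compose[OF cbilinear_right[OF bilinear_mul2] cbilinear_left[OF cbilinear_tensor_elem]]]])
  have "(\<Sum>a\<in>UNIV. (\<Sum>d\<in>UNIV. T d a j) * c a (p i) * e a) = (\<Sum>a\<in>UNIV. T a i j) * e i" for i j
    using delta_sum[of i "\<lambda>a. (\<Sum>d\<in>UNIV. T d a j) * e a"] by (simp only: mult_ac mult_1_left mult_1_right)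
  then show ?thesis
    unfolding basis_all_iff[OF lin]
    by (simp only: dual_basis_eq_iff[OF basis] c_mult_antipode_right c_left_unitor P_mul2 P_elem
        P_comult delta_sum c_one mult_1_left mult_1_right)
qed

lemma antipode_left_iff: "(\<forall>x. mult H (tensor_map (antipode H) id (comult H x))
      = right_unitor (tensor_map id (counit H) (mul2 (one \<otimes> x) (comult H one))))
    \<longleftrightarrow> (\<forall>i k. (\<Sum>j\<in>UNIV. T i j k * s j k) = (\<Sum>a\<in>UNIV. T a k i) * e i)"
  (is "(\<forall>x. ?f x = ?g x) \<longleftrightarrow> _")
proof -
  have lin: "clinear ?f" "clinear ?g"
    by (rule clinear_compose[OF linear_mult clinear_compose[OF clinear_tensor_map[OF linear_antipode clinear_id] linear_comult]],
        rule clinear_compose[OF clinear_right_unitor clinear_compose[OF clinear_tensor_map[OF clinear_id linear_counit]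
          clinear_compose[OF cbilinear_left[OF bilinear_mul2] cbilinear_right[OF cbilinear_tensor_elem]]]])
  have "(\<Sum>a\<in>UNIV. c a (p i) * (\<Sum>d\<in>UNIV. T d k a) * e a) = (\<Sum>a\<in>UNIV. T a k i) * e i" for i k
    using delta_sum[of i "\<lambda>a. (\<Sum>d\<in>UNIV. T d k a) * e a"] by (simp only: mult_ac mult_1_left mult_1_right)
  then show ?thesis
    unfolding basis_all_iff[OF lin]
    by (simp only: dual_basis_eq_iff[OF basis] c_mult_antipode_left c_right_unitor P_mul2 P_elem
        P_comult delta_sum c_one mult_1_left mult_1_right)
qed

lemma antipode_triple_iff: "(\<forall>x. mult H (tensor_map (mult H) id
      (tensor_map (tensor_map (antipode H) id) (antipode H) (tensor_map (comult H) id (comult H x)))) = antipode H x)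
    \<longleftrightarrow> (\<forall>i b. (\<Sum>a\<in>UNIV. \<Sum>d\<in>UNIV. (\<Sum>x\<in>UNIV. T i x d * T x a b) * (s a b * s d b)) = s i b)"
  (is "(\<forall>x. ?f x = ?g x) \<longleftrightarrow> _")
proof -
  have lin: "clinear ?f"
    by (rule clinear_compose[OF linear_mult clinear_compose[OF clinear_tensor_map[OF linear_mult clinear_id]
          clinear_compose[OF clinear_tensor_map[OF clinear_tensor_map[OF linear_antipode clinear_id] linear_antipode]
            clinear_compose[OF clinear_tensor_map[OF linear_comult clinear_id] linear_comult]]]])
  show ?thesis
    unfolding basis_all_iff[OF lin linear_antipode]
    by (simp only: dual_basis_eq_iff[OF basis] c_antipode_triple Q_comult_left P_comult c_antipode delta_sum)
qed

text \<open>
  Two elements of a tensor power of \<open>H\<close> are equal iff their coordinates are, and the multiplication of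
  tensor powers is componentwise in these coordinates.
\<close>

theorem weak_hopf_iff: "weak_hopf_algebra H \<longleftrightarrow> groupoid_constants T e s"
  unfolding weak_hopf_algebra_def weak_bialgebra_def counital_coalgebra_def Let_def groupoid_constants_def
  by (simp only: unital coassoc_iff counit_iff comult_mult_iff counit_mult_iff antipode_right_iff antipode_left_iff
      antipode_triple_iff linear_comult linear_counit linear_antipode simp_thms comult_one_iff[symmetric])
    (auto simp only:)

lemma permute:
  assumes "bij \<pi>"
  shows "diagonal_data H (\<lambda>i. p (\<pi> i)) (\<lambda>i. c (\<pi> i))"
proof (rule diagonal_data.intro)
  have reindex: "(\<Sum>i\<in>UNIV. f (\<pi> i)) = sum f UNIV" for f :: "'n \<Rightarrow> 'a"
    using sum.reindex_bij_betw[of \<pi> UNIV UNIV f] assms by simp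
  show "dual_basis (\<lambda>i. p (\<pi> i)) (\<lambda>i. c (\<pi> i))" "unit_map H 1 = (\<Sum>i\<in>UNIV. p (\<pi> i))"
    using assms reindex[of p] reindex[of "\<lambda>i. c i _ *\<^sub>C p i"]
    by (simp_all add: dual_basis_def lin_c c_p expand unit_basis bij_def inj_eq)
  show "mult H (p (\<pi> i) \<otimes> p (\<pi> j)) = (if i = j then p (\<pi> i) else 0)" for i j
    using assms by (simp add: mult_basis bij_def inj_eq)
qed (rule linear_mult linear_unit linear_comult linear_counit linear_antipode)+

end

text \<open>
  The linear map that matches the two bases preserves all coordinates.
\<close>

lemma isomorphic_if_same_constants:
  assumes H: "diagonal_data H p c" and K: "diagonal_data K q d"
    and T: "comult_const H p c = comult_const K q d" and e: "counit_const H p = counit_const K q"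
    and s: "antipode_const H p c = antipode_const K q d"
  shows "weak_hopf_isomorphic H K"
proof -
  interpret H: diagonal_data H p c by (rule H)
  interpret K: diagonal_data K q d by (rule K)
  define \<phi> where "\<phi> x = (\<Sum>i\<in>UNIV. c i x *\<^sub>C q i)" for x
  have lin: "clinear \<phi>"
    by (rule clinearI)
      (simp_all add: \<phi>_def clinear_rules[OF H.lin_c] scaleC_add_left sum.distrib complex_vector.scale_sum_right scaleC_scaleC)
  have d: "d i (\<phi> x) = c i x" for i x
    by (simp add: \<phi>_def clinear_rules[OF K.lin_c] K.c_p)
  have "bij \<phi>"
  proof (rule bijI')
    show "(\<phi> x = \<phi> y) = (x = y)" for x y
      by (simp add: dual_basis_eq_iff[OF K.basis] dual_basis_eq_iff[OF H.basis] d)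
    show "\<exists>x. y = \<phi> x" for y
    proof
      show "y = \<phi> (\<Sum>i\<in>UNIV. d i y *\<^sub>C p i)"
        by (simp add: dual_basis_eq_iff[OF K.basis] d clinear_rules[OF H.lin_c] H.c_p)
    qed
  qed
  have P: "K.P j k (tensor_map \<phi> \<phi> t) = H.P j k t" for j k t
    by (induction t rule: tensor_induct)
      (simp_all only: tensor_map_elem[OF lin lin] K.P_simps H.P_simps d clinear_add[OF clinear_tensor_map[OF lin lin]])
  have "\<phi> (mult H t) = mult K (tensor_map \<phi> \<phi> t)" for t
    by (rule tensor_eqI[OF clinear_compose[OF lin H.linear_mult]
          clinear_compose[OF K.linear_mult clinear_tensor_map[OF lin lin]]])
      (simp only: dual_basis_eq_iff[OF K.basis] d H.c_mul K.c_mul tensor_map_elem[OF lin lin] simp_thms)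
  moreover have "tensor_map \<phi> \<phi> (comult H x) = comult K (\<phi> x)" for x
    by (simp only: K.tensor_eq_iff P H.P_comult K.P_comult d T simp_thms)
  moreover have "counit H x = counit K (\<phi> x)" for x
    by (simp only: H.counit_expand K.counit_expand d e)
  moreover have "\<phi> (antipode H x) = antipode K (\<phi> x)" for x
    by (simp only: dual_basis_eq_iff[OF K.basis] d H.c_antipode K.c_antipode s simp_thms)
  ultimately show ?thesis
    unfolding weak_hopf_isomorphic_def using lin \<open>bij \<phi>\<close> by blast
qed

section \<open>Groupoids with three arrows\<close>

text \<open>
  The multiplication tables of the groupoids with three arrows: the cyclic group of order three with
  identity \<open>1\<close>, an isolated object \<open>1\<close> together with a group of order two with identity \<open>2\<close>, and
  three isolated objects. As above, the first argument is the composite of the other two.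
\<close>

definition Z3_table :: "3 \<Rightarrow> 3 \<Rightarrow> 3 \<Rightarrow> bool"
  where "Z3_table i j k \<longleftrightarrow> (i, j, k) \<in> {(1,1,1), (2,1,2), (2,2,1), (3,1,3), (3,3,1), (1,2,3), (1,3,2), (2,3,3), (3,2,2)}"

definition Z2_point_table :: "3 \<Rightarrow> 3 \<Rightarrow> 3 \<Rightarrow> bool"
  where "Z2_point_table i j k \<longleftrightarrow> (i, j, k) \<in> {(1,1,1), (2,2,2), (3,2,3), (3,3,2), (2,3,3)}"

definition points_table :: "3 \<Rightarrow> 3 \<Rightarrow> 3 \<Rightarrow> bool"
  where "points_table i j k \<longleftrightarrow> i = j \<and> j = k"

text \<open>
  The relation \<open>R i j k\<close> says that \<open>j\<close> and \<open>k\<close> are composable with composite \<open>i\<close>, and \<open>U\<close> is the set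
  of identities. A category in which every arrow has a right inverse is a groupoid.
\<close>

locale groupoid_table =
  fixes R :: "3 \<Rightarrow> 3 \<Rightarrow> 3 \<Rightarrow> bool" and U :: "3 \<Rightarrow> bool"
  assumes single: "R i j k \<Longrightarrow> R i' j k \<Longrightarrow> i = i'"
    and assoc: "(\<exists>a. R i a l \<and> R a j k) \<longleftrightarrow> (\<exists>a. R i j a \<and> R a k l)"
    and unit_left: "U j \<Longrightarrow> R i j k \<Longrightarrow> i = k" and unit_right: "U k \<Longrightarrow> R i j k \<Longrightarrow> i = j"
    and ex_unit_left: "\<exists>j. U j \<and> R k j k" and ex_unit_right: "\<exists>k. U k \<and> R j j k"
    and unit_self: "U a \<Longrightarrow> R a a a" and unit_orth: "U a \<Longrightarrow> U b \<Longrightarrow> R i a b \<Longrightarrow> a = b"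
    and inverse: "U i \<Longrightarrow> R j i j \<Longrightarrow> \<exists>k. R i j k"
begin

text \<open>
  With a single identity all arrows are composable, and right inverses make right translations
  injective. This leaves \<open>x\<close> and \<open>z\<close> as candidates for \<open>y \<circ> y\<close>, and associativity excludes \<open>x\<close>.
\<close>

lemma group_case:
  assumes xyz: "UNIV = {x, y, z}" "x \<noteq> y" "x \<noteq> z" "y \<noteq> z" and U: "U x" "\<not> U y" "\<not> U z"
  shows "R i j k \<longleftrightarrow> (i, j, k) \<in> {(x,x,x), (y,x,y), (y,y,x), (z,x,z), (z,z,x), (x,y,z), (x,z,y), (y,z,z), (z,y,y)}"
proof -
  have cov: "a = x \<or> a = y \<or> a = z" for a using xyz(1) by blast
  have l: "R k x k" and r: "R k k x" for k
    using ex_unit_left[of k] ex_unit_right[of k] U cov by metis+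
  have inv: "\<exists>k. R x j k" for j using inverse[OF U(1) l[of j]] .
  have "\<exists>a. R a u v" for u v
    using inv[of v] r[of u] assoc[of u _ u v] by blast
  then obtain m where m0: "\<And>u v. R (m u v) u v" by metis
  then have m: "R i u v \<longleftrightarrow> i = m u v" for i u v using single by blast
  have mx: "m k x = k" "m x k = k" for k using l r m by metis+
  have ma: "m (m u v) w = m u (m v w)" for u v w
    using assoc[of "m (m u v) w" w u v] by (simp add: m)
  have minv: "\<exists>k. m j k = x" for j using inv[of j] by (metis m)
  have cancel: "m a v = m b v \<Longrightarrow> a = b" for a b v
    using minv[of v] ma mx by metis
  have yy: "m y y = z"
  proof (rule ccontr)
    assume "m y y \<noteq> z"
    then have 1: "m y y = x" using cov[of "m y y"] cancel[of y y x] mx xyz by metis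
    then have 2: "m z y = z" using cov[of "m z y"] cancel[of z y x] cancel[of z y y] mx xyz by metis
    then have 3: "m z z = x" using minv[of z] cov mx xyz by metis
    then have "m y z = y" using cov[of "m y z"] cancel[of y z x] cancel[of y z z] mx xyz by metis
    then show False using ma[of z y z] 2 3 xyz by metis
  qed
  then have zy: "m z y = x" using cov[of "m z y"] cancel[of z y x] cancel[of z y y] mx xyz by metis
  have zz: "m z z = y"
  proof (rule ccontr)
    assume "m z z \<noteq> y"
    then have 1: "m z z = x" using cov[of "m z z"] cancel[of z z x] mx xyz by metis
    then have "m y z = y" using cov[of "m y z"] cancel[of y z x] cancel[of y z z] mx xyz by metis
    then show False using ma[of z y z] zy mx xyz by metis
  qed
  then have yz: "m y z = x" using cov[of "m y z"] cancel[of y z x] cancel[of y z z] mx xyz by metis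
  show ?thesis
    using cov[of j] cov[of k]
    by (elim disjE) (simp_all (no_asm_simp) add: xyz(2-4) xyz(2-4)[symmetric] m mx yy yz zy zz)
qed

text \<open>
  An identity cannot be inverse to \<open>z\<close>, so \<open>z \<circ> z = y\<close>. By associativity \<open>y\<close> is then an identity for
  \<open>z\<close> on the right as well, and \<open>z\<close> is a loop at \<open>y\<close>.
\<close>

lemma loop_case:
  assumes xyz: "UNIV = {x, y, z}" "x \<noteq> y" "x \<noteq> z" "y \<noteq> z" and U: "U x" "U y" "\<not> U z"
    and z: "R z y z"
  shows "R i j k \<longleftrightarrow> (i, j, k) \<in> {(x,x,x), (y,y,y), (z,y,z), (z,z,y), (y,z,z)}"
proof -
  have cov: "a = x \<or> a = y \<or> a = z" for a using xyz(1) by blast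
  have xx: "R x x x" "R y y y" using unit_self U by blast+
  have xy: "\<not> R a x y" "\<not> R a y x" for a using unit_orth U xyz by metis+
  obtain w where w: "R y z w" using inverse[OF U(2) z] by blast
  have "w \<noteq> x" "w \<noteq> y" using w unit_right[OF U(1)] unit_right[OF U(2)] xyz by metis+
  then have zz: "R y z z" using w cov by metis
  have "\<exists>a. R z a z \<and> R a z z" using z zz by blast
  then have "\<exists>a. R z z a \<and> R a z z" using assoc[of z z z z] by blast
  then have zy: "R z z y" using zz single by metis
  have xz: "\<not> R a x z" for a
  proof
    assume a: "R a x z"
    then have "R z x z" using unit_left[OF U(1)] by metis
    then have "\<exists>a. R z x a \<and> R a y z" using z by blast
    then have "\<exists>a. R z a z \<and> R a x y" using assoc[of z z x y] by blast
    with xy show False by blast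
  qed
  have zx: "\<not> R a z x" for a
  proof
    assume a: "R a z x"
    then have "R z z x" using unit_right[OF U(1)] by metis
    then have "\<exists>a. R z a x \<and> R a z y" using zy by blast
    then have "\<exists>a. R z z a \<and> R a y x" using assoc[of z x z y] by blast
    with xy show False by blast
  qed
  have tab: "R i x x \<longleftrightarrow> i = x" "R i y y \<longleftrightarrow> i = y" "R i y z \<longleftrightarrow> i = z" "R i z y \<longleftrightarrow> i = z" "R i z z \<longleftrightarrow> i = y"
    using xx z zy zz single by metis+
  show ?thesis
    using cov[of j] cov[of k]
    by (elim disjE) (simp_all (no_asm_simp) add: xyz(2-4) xyz(2-4)[symmetric] tab xy xz zx)
qed

lemma points_case:
  assumes "\<And>a. U a"
  shows "R i j k \<longleftrightarrow> i = j \<and> j = k"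
  using assms unit_self unit_orth unit_left by metis

lemma bij_triple:
  assumes "UNIV = {x, y, z :: 3}" "x \<noteq> y" "x \<noteq> z" "y \<noteq> z"
  shows "bij (triple x y z)"
proof -
  have "inj (triple x y z)"
    unfolding inj_def using assms by (simp add: forall_3)
  then show ?thesis by (simp add: bij_def finite_UNIV_inj_surj)
qed

theorem classification:
  obtains \<pi> where "bij \<pi>" "\<And>i j k. R (\<pi> i) (\<pi> j) (\<pi> k) = Z3_table i j k" "\<And>i. U (\<pi> i) = (i = 1)"
  | \<pi> where "bij \<pi>" "\<And>i j k. R (\<pi> i) (\<pi> j) (\<pi> k) = Z2_point_table i j k" "\<And>i. U (\<pi> i) = (i \<noteq> 3)"
  | "\<And>i j k. R i j k = points_table i j k" "\<And>i. U i"
proof -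
  note cases = that
  have group: thesis if xyz: "UNIV = {x, y, z}" "x \<noteq> y" "x \<noteq> z" "y \<noteq> z" and U: "U x" "\<not> U y" "\<not> U z" for x y z
  proof (rule cases(1))
    show "bij (triple x y z)" by (rule bij_triple[OF xyz])
    show "U (triple x y z i) = (i = 1)" for i
      using exhaust_3[of i] U by auto
    show "R (triple x y z i) (triple x y z j) (triple x y z k) = Z3_table i j k" for i j k
      unfolding group_case[OF xyz U] Z3_table_def
      using exhaust_3[of i] exhaust_3[of j] exhaust_3[of k] xyz by (elim disjE) simp_all
  qed
  have loop: thesis if xyz: "UNIV = {x, y, z}" "x \<noteq> y" "x \<noteq> z" "y \<noteq> z" and U: "U x" "U y" "\<not> U z" for x y z
  proof -
    have *: thesis if xyz: "UNIV = {x, y, z}" "x \<noteq> y" "x \<noteq> z" "y \<noteq> z" and U: "U x" "U y" "\<not> U z"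
      and z: "R z y z" for x y z
    proof (rule cases(2))
      show "bij (triple x y z)" by (rule bij_triple[OF xyz])
      show "U (triple x y z i) = (i \<noteq> 3)" for i
        using exhaust_3[of i] U by auto
      show "R (triple x y z i) (triple x y z j) (triple x y z k) = Z2_point_table i j k" for i j k
        unfolding loop_case[OF xyz U z] Z2_point_table_def
        using exhaust_3[of i] exhaust_3[of j] exhaust_3[of k] xyz by (elim disjE) simp_all
    qed
    from ex_unit_left[of z] U xyz(1) have "R z y z \<or> R z x z" by (metis UNIV_I insertE singletonD)
    then show thesis
    proof
      assume "R z y z"
      from *[OF xyz U this] show thesis .
    next
      assume z: "R z x z"
      have "UNIV = {y, x, z}" using xyz by blast
      from *[OF this _ xyz(4,3) U(2,1,3) z] xyz show thesis by auto
    qed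
  qed
  have perms: "UNIV = {1, 2, 3 :: 3}" "UNIV = {1, 3, 2 :: 3}" "UNIV = {2, 3, 1 :: 3}" "UNIV = {2, 1, 3 :: 3}"
    "UNIV = {3, 1, 2 :: 3}"
    using exhaust_3 by blast+
  have distinct: "(1 :: 3) \<noteq> 2" "(1 :: 3) \<noteq> 3" "(2 :: 3) \<noteq> 3" "(2 :: 3) \<noteq> 1" "(3 :: 3) \<noteq> 1" "(3 :: 3) \<noteq> 2"
    by simp_all
  obtain a where "U a" using ex_unit_left by blast
  then have "U 1 \<or> U 2 \<or> U 3" using exhaust_3[of a] by auto
  then consider "U 1" "U 2" "U 3" | "U 1" "U 2" "\<not> U 3" | "U 1" "\<not> U 2" "U 3" | "\<not> U 1" "U 2" "U 3"
    | "U 1" "\<not> U 2" "\<not> U 3" | "\<not> U 1" "U 2" "\<not> U 3" | "\<not> U 1" "\<not> U 2" "U 3"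
    by argo
  then show thesis
  proof cases
    case 1
    then have U: "U a" for a using exhaust_3[of a] by auto
    show thesis by (rule cases(3)) (simp_all add: U points_case[OF U] points_table_def)
  next
    case 2 show ?thesis by (rule loop[OF perms(1) distinct(1) distinct(2) distinct(3)]; fact)
  next
    case 3 show ?thesis by (rule loop[OF perms(2) distinct(2) distinct(1) distinct(6)]; fact)
  next
    case 4 show ?thesis by (rule loop[OF perms(3) distinct(3) distinct(4) distinct(5)]; fact)
  next
    case 5 show ?thesis by (rule group[OF perms(1) distinct(1) distinct(2) distinct(3)]; fact)
  next
    case 6 show ?thesis by (rule group[OF perms(4) distinct(4) distinct(3) distinct(2)]; fact)
  next
    case 7 show ?thesis by (rule group[OF perms(5) distinct(5) distinct(6) distinct(1)]; fact)
  qed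
qed

end

lemma sum_of_bool_card:
  "(\<Sum>a\<in>UNIV. of_bool (Q a) :: complex) = of_nat (card {a::'n::finite. Q a})"
  by (simp add: of_bool_def sum.If_cases)

lemma card_Collect_pos: "0 < card {a::'n::finite. Q a} \<longleftrightarrow> (\<exists>a. Q a)"
  by (simp add: card_gt_0_iff)

text \<open>
  Once all constants are \<open>0\<close> or \<open>1\<close>, the sums in the axioms count arrows. The counit laws say that an
  arrow has exactly one identity on each side, coassociativity is associativity, and the first
  antipode axiom, evaluated at an identity, produces inverses.
\<close>

lemma groupoid_constants_table:
  fixes T :: "3 \<Rightarrow> 3 \<Rightarrow> 3 \<Rightarrow> complex"
  assumes G: "groupoid_constants T e s"
  shows "groupoid_table (\<lambda>i j k. T i j k = 1) (\<lambda>i. e i = 1)"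
    and "T i j k = of_bool (T i j k = 1)" and "e i = of_bool (e i = 1)"
proof -
  let ?R = "\<lambda>i j k. T i j k = 1" and ?U = "\<lambda>i. e i = 1"
  note ax = G[unfolded groupoid_constants_def]
  have mult: "of_bool (i = i') * T i j k = T i j k * T i' j k" for i i' j k
    by (rule ax[THEN conjunct2, THEN conjunct2, THEN conjunct2, THEN conjunct1, rule_format])
  have coassoc: "(\<Sum>a\<in>UNIV. T i a l * T a j k) = (\<Sum>a\<in>UNIV. T i j a * T a k l)" for i j k l
    by (rule ax[THEN conjunct1, rule_format])
  have counit1: "(\<Sum>j\<in>UNIV. e j * T i j k) = of_bool (i = k)" for i k
    by (rule ax[THEN conjunct2, THEN conjunct1, rule_format])
  have counit2: "(\<Sum>k\<in>UNIV. e k * T i j k) = of_bool (i = j)" for i j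
    by (rule ax[THEN conjunct2, THEN conjunct2, THEN conjunct1, rule_format])
  have weak: "of_bool (a = b \<and> b = c) * e a = T b a c * (e a * e c)" for a b c
    by (rule ax[THEN conjunct2, THEN conjunct2, THEN conjunct2, THEN conjunct2, THEN conjunct2, THEN conjunct1, rule_format])
  have anti: "(\<Sum>k\<in>UNIV. T i j k * s k j) = (\<Sum>a\<in>UNIV. T a i j) * e i" for i j
    by (rule ax[THEN conjunct2, THEN conjunct2, THEN conjunct2, THEN conjunct2, THEN conjunct2, THEN conjunct2, THEN conjunct1, rule_format])
  have T: "T i j k = of_bool (?R i j k)" for i j k
    using mult[of i i j k] by auto
  have e: "e i = of_bool (?U i)" and self: "?U i \<Longrightarrow> ?R i i i" for i
  proof -
    have *: "e i = T i i i * (e i * e i)" using weak[of i i i] by simp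
    show "e i = of_bool (?U i)"
    proof (cases "?R i i i")
      case True
      then have "e i * (e i - 1) = 0" using * by (simp add: algebra_simps)
      then show ?thesis by auto
    next
      case False
      then show ?thesis using * T[of i i i] by simp
    qed
    show "?R i i i" if "?U i" using * that by simp
  qed
  show "T i j k = of_bool (?R i j k)" "e i = of_bool (?U i)" by (rule T, rule e)
  have prod: "T i j k * T i' j' k' = of_bool (?R i j k \<and> ?R i' j' k')" "e a * T i j k = of_bool (?U a \<and> ?R i j k)"
    for i j k i' j' k' a
    by (subst (1 2) T, simp, subst T, subst e, simp)
  have c1: "card {j. ?U j \<and> ?R i j k} = of_bool (i = k)" for i k
  proof -
    have "(of_nat (card {j. ?U j \<and> ?R i j k}) :: complex) = of_nat (of_bool (i = k))"
      using counit1[of i k] unfolding prod sum_of_bool_card of_nat_of_bool .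
    then show ?thesis by (simp only: of_nat_eq_iff)
  qed
  have c2: "card {k. ?U k \<and> ?R i j k} = of_bool (i = j)" for i j
  proof -
    have "(of_nat (card {k. ?U k \<and> ?R i j k}) :: complex) = of_nat (of_bool (i = j))"
      using counit2[of i j] unfolding prod sum_of_bool_card of_nat_of_bool .
    then show ?thesis by (simp only: of_nat_eq_iff)
  qed
  have c3: "card {a. ?R i a l \<and> ?R a j k} = card {a. ?R i j a \<and> ?R a k l}" for i j k l
    using coassoc[of i l j k] unfolding prod sum_of_bool_card of_nat_eq_iff .
  show "groupoid_table ?R ?U"
  proof
    show "i = i'" if "?R i j k" "?R i' j k" for i i' j k
      using mult[of i i' j k] that by (auto split: if_splits)
    show "(\<exists>a. ?R i a l \<and> ?R a j k) \<longleftrightarrow> (\<exists>a. ?R i j a \<and> ?R a k l)" for i j k l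
      unfolding card_Collect_pos[symmetric] c3[of i l j k] ..
    show "i = k" if "?U j" "?R i j k" for i j k
    proof -
      have "\<exists>j. ?U j \<and> ?R i j k" using that by (intro exI conjI)
      then show ?thesis unfolding card_Collect_pos[symmetric] c1 by (cases "i = k") simp_all
    qed
    show "i = j" if "?U k" "?R i j k" for i j k
    proof -
      have "\<exists>k. ?U k \<and> ?R i j k" using that by (intro exI conjI)
      then show ?thesis unfolding card_Collect_pos[symmetric] c2 by (cases "i = j") simp_all
    qed
    show "\<exists>j. ?U j \<and> ?R k j k" "\<exists>j. ?U j \<and> ?R k k j" for k
      unfolding card_Collect_pos[symmetric] c1 c2 by simp_all
    show "?R a a a" if "?U a" for a using self that .
    show "a = b" if "?U a" "?U b" "?R i a b" for a b i
      using weak[of a i b] that by (auto split: if_splits)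
    show "\<exists>k. ?R i j k" if "?U i" "?R j i j" for i j
    proof (rule ccontr)
      assume "\<nexists>k. ?R i j k"
      then have "T i j k = 0" for k using T[of i j k] by auto
      then have "(\<Sum>a\<in>UNIV. T a i j) = 0" using anti[of i j] that by simp
      moreover have "(\<Sum>a\<in>UNIV. T a i j) = of_nat (card {a. ?R a i j})"
        by (subst T) (rule sum_of_bool_card)
      ultimately have "\<not> 0 < card {a. ?R a i j}" by simp
      then have "\<not> (\<exists>a. ?R a i j)" unfolding card_Collect_pos .
      moreover have "\<exists>a. ?R a i j" using that(2) by (rule exI)
      ultimately show False by (rule notE)
    qed
  qed
qed

section \<open>The three weak Hopf algebras\<close>

abbreviation "Z3_consts \<equiv> (\<lambda>i j k. of_bool (Z3_table i j k) :: complex)"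
abbreviation "Z2_point_consts \<equiv> (\<lambda>i j k. of_bool (Z2_point_table i j k) :: complex)"
abbreviation "points_consts \<equiv> (\<lambda>i j k. of_bool (points_table i j k) :: complex)"

lemma groupoid_constants_Z3:
  "groupoid_constants Z3_consts (\<lambda>i. of_bool (i = 1)) (\<lambda>i j. of_bool (Z3_table 1 i j))"
  unfolding groupoid_constants_def
  by (intro conjI) (simp_all add: forall_3 sum_3 Z3_table_def)

lemma groupoid_constants_Z2_point:
  "groupoid_constants Z2_point_consts (\<lambda>i. of_bool (i \<noteq> 3)) (\<lambda>i j. of_bool (i = j))"
  unfolding groupoid_constants_def
  by (intro conjI) (simp_all add: forall_3 sum_3 Z2_point_table_def)

lemma groupoid_constants_points:
  "groupoid_constants points_consts (\<lambda>i. 1) (\<lambda>i j. of_bool (i = j))"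
  unfolding groupoid_constants_def
  by (intro conjI) (simp_all add: forall_3 sum_3 points_table_def)

lemma groupoid_constants_antipode:
  assumes "groupoid_constants T e s"
  shows "\<And>i j. (\<Sum>k\<in>UNIV. T i j k * s k j) = (\<Sum>a\<in>UNIV. T a i j) * e i"
    and "\<And>i b. (\<Sum>a\<in>UNIV. \<Sum>d\<in>UNIV. (\<Sum>x\<in>UNIV. T i x d * T x a b) * (s a b * s d b)) = s i b"
  by (rule assms[unfolded groupoid_constants_def, THEN conjunct2, THEN conjunct2, THEN conjunct2, THEN conjunct2, THEN conjunct2, THEN conjunct2, THEN conjunct1, rule_format],
      rule assms[unfolded groupoid_constants_def, THEN conjunct2, THEN conjunct2, THEN conjunct2, THEN conjunct2, THEN conjunct2, THEN conjunct2, THEN conjunct2, THEN conjunct2, rule_format])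

text \<open>
  The antipode axioms determine the antipode, which is the inversion of the groupoid.
\<close>

lemma antipode_Z3:
  assumes "groupoid_constants Z3_consts (\<lambda>i. of_bool (i = 1)) s"
  shows "s = (\<lambda>i j. of_bool (Z3_table 1 i j))"
proof -
  have "\<forall>i j. s i j = of_bool (Z3_table 1 i j)"
    using groupoid_constants_antipode(1)[OF assms, of 1 1] groupoid_constants_antipode(1)[OF assms, of 1 2]
      groupoid_constants_antipode(1)[OF assms, of 1 3] groupoid_constants_antipode(1)[OF assms, of 2 1]
      groupoid_constants_antipode(1)[OF assms, of 2 2] groupoid_constants_antipode(1)[OF assms, of 2 3]
      groupoid_constants_antipode(1)[OF assms, of 3 1] groupoid_constants_antipode(1)[OF assms, of 3 2]
      groupoid_constants_antipode(1)[OF assms, of 3 3]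
    by (simp add: forall_3 sum_3 Z3_table_def)
  then show ?thesis by blast
qed

lemma antipode_Z2_point:
  assumes "groupoid_constants Z2_point_consts (\<lambda>i. of_bool (i \<noteq> 3)) s"
  shows "s = (\<lambda>i j. of_bool (i = j))"
proof -
  have "\<forall>i j. s i j = of_bool (i = j)"
    using groupoid_constants_antipode(1)[OF assms, of 1 1] groupoid_constants_antipode(1)[OF assms, of 2 2]
      groupoid_constants_antipode(1)[OF assms, of 2 3] groupoid_constants_antipode(1)[OF assms, of 3 2]
      groupoid_constants_antipode(1)[OF assms, of 3 3]
      groupoid_constants_antipode(2)[OF assms, of 1 2] groupoid_constants_antipode(2)[OF assms, of 1 3]
      groupoid_constants_antipode(2)[OF assms, of 2 1] groupoid_constants_antipode(2)[OF assms, of 3 1]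
    by (simp add: forall_3 sum_3 Z2_point_table_def)
  then show ?thesis by blast
qed

lemma antipode_points:
  assumes "groupoid_constants points_consts (\<lambda>i. 1) s"
  shows "s = (\<lambda>i j. of_bool (i = j))"
proof -
  have "s i i = 1" for i
    using groupoid_constants_antipode(1)[OF assms, of i i] exhaust_3[of i]
    by (auto simp: sum_3 points_table_def)
  moreover have "s i j = 0" if "i \<noteq> j" for i j
    using groupoid_constants_antipode(2)[OF assms, of i j] that exhaust_3[of i] exhaust_3[of j]
    by (auto simp: sum_3 points_table_def)
  ultimately show ?thesis by (intro ext) (simp add: of_bool_def)
qed

text \<open>
  The minimal idempotents of \<open>\<A>\<close>: since \<open>e\<^sub>1\<close>, \<open>e\<^sub>2\<close>, \<open>e\<^sub>3\<close> are a decreasing chain of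
  idempotents, their successive differences are orthogonal.
\<close>

definition std_basis :: "3 \<Rightarrow> complex^3"
  where "std_basis = triple (\<e> 1 - \<e> 2) (\<e> 2 - \<e> 3) (\<e> 3)"

definition std_coord :: "3 \<Rightarrow> complex^3 \<Rightarrow> complex"
  where "std_coord = triple (\<lambda>x. x $ 1) (\<lambda>x. x $ 1 + x $ 2) (\<lambda>x. x $ 1 + x $ 2 + x $ 3)"

lemma clinear_std_coord: "clinear (std_coord i)"
  using exhaust_3[of i] by (elim disjE) (simp_all add: std_coord_def clinear_iff scaleC_vec_def algebra_simps)

lemma std_coord_basis:
  "std_coord 1 (\<e> 1) = 1" "std_coord 1 (\<e> 2) = 0" "std_coord 1 (\<e> 3) = 0"
  "std_coord 2 (\<e> 1) = 1" "std_coord 2 (\<e> 2) = 1" "std_coord 2 (\<e> 3) = 0"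
  "std_coord 3 (\<e> 1) = 1" "std_coord 3 (\<e> 2) = 1" "std_coord 3 (\<e> 3) = 1"
  by (simp_all add: std_coord_def del: One_nat_def)

lemma dual_basis_std: "dual_basis std_basis std_coord"
proof -
  have "std_coord i (std_basis j) = of_bool (i = j)" for i j
    using exhaust_3[of i] exhaust_3[of j]
    by (elim disjE) (simp_all add: std_basis_def clinear_diff[OF clinear_std_coord] std_coord_basis del: One_nat_def)
  moreover have "(\<Sum>i\<in>UNIV. std_coord i x *\<^sub>C std_basis i) = x" for x
    by (simp add: sum_3 std_basis_def std_coord_def vec_eq_iff forall_3 scaleC_vec_def algebra_simps del: One_nat_def)
  ultimately show ?thesis by (simp add: dual_basis_def clinear_std_coord)
qed

lemma clinear_A_mult: "clinear A_mult"
proof -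
  have nth: "(c *\<^sub>C x) $ i = c * x $ i" for c and x :: "complex^3" and i
    by (simp add: scaleC_vec_def)
  have "cbilinear (\<lambda>(x::complex^3) (y::complex^3).
      \<Sum>i\<in>{1..3}. \<Sum>j\<in>{1..3}. (x $ of_nat i * y $ of_nat j) *\<^sub>C \<e> (max i j))"
    by (simp add: cbilinear_def clinear_iff nth algebra_simps
        scaleC_add_left sum.distrib complex_vector.scale_sum_right scaleC_scaleC)
  then show ?thesis unfolding A_mult_def by (rule clinear_tensor_lift)
qed

lemma A_mult_std: "A_mult (std_basis i \<otimes> std_basis j) = (if i = j then std_basis i else 0)"
proof -
  have "A_mult (\<e> 1 \<otimes> \<e> 1) = \<e> 1" "A_mult (\<e> 1 \<otimes> \<e> 2) = \<e> 2" "A_mult (\<e> 1 \<otimes> \<e> 3) = \<e> 3"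
    "A_mult (\<e> 2 \<otimes> \<e> 1) = \<e> 2" "A_mult (\<e> 2 \<otimes> \<e> 2) = \<e> 2" "A_mult (\<e> 2 \<otimes> \<e> 3) = \<e> 3"
    "A_mult (\<e> 3 \<otimes> \<e> 1) = \<e> 3" "A_mult (\<e> 3 \<otimes> \<e> 2) = \<e> 3" "A_mult (\<e> 3 \<otimes> \<e> 3) = \<e> 3"
    by (simp_all add: A_mult_basis max_def del: One_nat_def)
  then show ?thesis
    using exhaust_3[of i] exhaust_3[of j]
    by (elim disjE) (simp_all add: std_basis_def tensor_simps clinear_rules[OF clinear_A_mult] del: One_nat_def)
qed

lemma diagonal_data_std:
  assumes "mult H = A_mult" "unit_map H = A_unit" "clinear (comult H)" "clinear (counit H)" "clinear (antipode H)"
  shows "diagonal_data H std_basis std_coord"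
proof (rule diagonal_data.intro)
  show "clinear (unit_map H)"
    by (simp add: assms A_unit_def[abs_def] clinear_iff scaleC_add_left scaleC_scaleC del: One_nat_def)
  show "unit_map H 1 = (\<Sum>i\<in>UNIV. std_basis i)"
    by (simp add: assms A_unit_def scaleC_one sum_3 std_basis_def del: One_nat_def)
qed (simp_all add: assms dual_basis_std clinear_A_mult A_mult_std)

lemmas std_simps = std_basis_def triple_simps clinear_diff[OF clinear_on_basis] on_basis_basis
  clinear_rules[OF clinear_pairing[OF clinear_std_coord clinear_std_coord]]
  pairing_elem[OF clinear_std_coord clinear_std_coord] clinear_rules[OF clinear_std_coord] std_coord_basis
  tensor_simps weak_hopf_data.simps

lemma diagonal_weak_hopf_1: "diagonal_data weak_hopf_1 std_basis std_coord"
  and diagonal_weak_hopf_2: "diagonal_data weak_hopf_2 std_basis std_coord"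
  and diagonal_weak_hopf_3: "diagonal_data weak_hopf_3 std_basis std_coord"
  by (rule diagonal_data_std; simp add: weak_hopf_1_def weak_hopf_2_def weak_hopf_3_def clinear_on_basis)+

lemma constants_weak_hopf_1:
  "comult_const weak_hopf_1 std_basis std_coord = Z3_consts"
  "counit_const weak_hopf_1 std_basis = (\<lambda>i. of_bool (i = 1))"
  "antipode_const weak_hopf_1 std_basis std_coord = (\<lambda>i j. of_bool (Z3_table 1 i j))"
  unfolding fun_eq_iff forall_3 comult_const_def counit_const_def antipode_const_def weak_hopf_1_def
  by (simp_all add: std_simps Z3_table_def del: One_nat_def)

lemma constants_weak_hopf_2:
  "comult_const weak_hopf_2 std_basis std_coord = Z2_point_consts"
  "counit_const weak_hopf_2 std_basis = (\<lambda>i. of_bool (i \<noteq> 3))"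
  "antipode_const weak_hopf_2 std_basis std_coord = (\<lambda>i j. of_bool (i = j))"
  unfolding fun_eq_iff forall_3 comult_const_def counit_const_def antipode_const_def weak_hopf_2_def
  by (simp_all add: std_simps Z2_point_table_def del: One_nat_def)

lemma constants_weak_hopf_3:
  "comult_const weak_hopf_3 std_basis std_coord = points_consts"
  "counit_const weak_hopf_3 std_basis = (\<lambda>i. 1)"
  "antipode_const weak_hopf_3 std_basis std_coord = (\<lambda>i j. of_bool (i = j))"
  unfolding fun_eq_iff forall_3 comult_const_def counit_const_def antipode_const_def weak_hopf_3_def
  by (simp_all add: std_simps points_table_def del: One_nat_def)

text \<open>
  Orthogonal idempotents that form a basis sum to \<open>1\<close>, because \<open>\<one> \<cdot> p\<^sub>i = p\<^sub>i\<close> shows that all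
  coordinates of \<open>\<one>\<close> are \<open>1\<close>.
\<close>

lemma (in weak_hopf_dim3) diagonal_data_exists: "\<exists>(p :: 3 \<Rightarrow> 'a) c. diagonal_data H p c"
proof -
  obtain p :: "3 \<Rightarrow> 'a" and c where p: "dual_basis p c"
    and pp: "\<And>i j. p i \<cdot> p j = (if i = j then p i else 0)"
    using algebra_splits unfolding split_def by blast
  have "c i \<one> = 1" for i
  proof -
    have "p i = (\<Sum>j\<in>UNIV. c j \<one> *\<^sub>C p j) \<cdot> p i" by (simp add: dual_basisD(3)[OF p])
    also have "\<dots> = (\<Sum>j\<in>UNIV. if j = i then c j \<one> *\<^sub>C p j else 0)"
      by (simp only: mul_simps pp) (rule sum.cong; simp)
    also have "\<dots> = c i \<one> *\<^sub>C p i" by simp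
    finally have "c i (p i) = c i (c i \<one> *\<^sub>C p i)" by simp
    then show ?thesis by (simp add: clinear_scale[OF dual_basisD(1)[OF p]] dual_basisD(2)[OF p])
  qed
  then have one: "\<one> = (\<Sum>i\<in>UNIV. p i)"
    using dual_basisD(3)[OF p, of \<one>] by (simp add: scaleC_one)
  have "clinear (unit_map H)"
    using weak_hopf unfolding weak_hopf_algebra_def weak_bialgebra_def unital_algebra_def Let_def by blast
  then have "diagonal_data H p c"
    using p pp one
    by (intro diagonal_data.intro clinear_mult clinear_comult clinear_counit clinear_antipode)
      (simp_all add: mul_def one_def)
  then show ?thesis by blast
qed

text \<open>
  The classification of groupoids renumbers the idempotent basis so that its structure constants are
  those of one of the three weak Hopf algebras.
\<close>

lemma dim3_weak_hopf_classification:
  fixes H :: "'a::complex_vector weak_hopf_data"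
  assumes dim: "cdim (UNIV :: 'a set) = 3" and H: "weak_hopf_algebra H"
  shows "weak_hopf_isomorphic H weak_hopf_1 \<or> weak_hopf_isomorphic H weak_hopf_2
    \<or> weak_hopf_isomorphic H weak_hopf_3"
proof -
  interpret weak_hopf_dim3 H by unfold_locales (rule H, rule dim)
  obtain p :: "3 \<Rightarrow> 'a" and c where D: "diagonal_data H p c" using diagonal_data_exists by blast
  let ?T = "comult_const H p c" and ?e = "counit_const H p"
  have G: "groupoid_constants ?T ?e (antipode_const H p c)"
    using diagonal_data.weak_hopf_iff[OF D] H by simp
  have T: "?T i j k = of_bool (?T i j k = 1)" and e: "?e i = of_bool (?e i = 1)" for i j k
    by (rule groupoid_constants_table[OF G])+
  have perm: "diagonal_data H (\<lambda>i. p (\<pi> i)) (\<lambda>i. c (\<pi> i))"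
    "groupoid_constants (\<lambda>i j k. ?T (\<pi> i) (\<pi> j) (\<pi> k)) (\<lambda>i. ?e (\<pi> i)) (antipode_const H (\<lambda>i. p (\<pi> i)) (\<lambda>i. c (\<pi> i)))"
    "comult_const H (\<lambda>i. p (\<pi> i)) (\<lambda>i. c (\<pi> i)) = (\<lambda>i j k. ?T (\<pi> i) (\<pi> j) (\<pi> k))"
    "counit_const H (\<lambda>i. p (\<pi> i)) = (\<lambda>i. ?e (\<pi> i))"
    if "bij \<pi>" for \<pi>
  proof -
    show 1: "diagonal_data H (\<lambda>i. p (\<pi> i)) (\<lambda>i. c (\<pi> i))"
      by (rule diagonal_data.permute[OF D that])
    show 2: "comult_const H (\<lambda>i. p (\<pi> i)) (\<lambda>i. c (\<pi> i)) = (\<lambda>i j k. ?T (\<pi> i) (\<pi> j) (\<pi> k))"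
      "counit_const H (\<lambda>i. p (\<pi> i)) = (\<lambda>i. ?e (\<pi> i))"
      by (simp_all add: fun_eq_iff comult_const_def counit_const_def)
    show "groupoid_constants (\<lambda>i j k. ?T (\<pi> i) (\<pi> j) (\<pi> k)) (\<lambda>i. ?e (\<pi> i)) (antipode_const H (\<lambda>i. p (\<pi> i)) (\<lambda>i. c (\<pi> i)))"
      using diagonal_data.weak_hopf_iff[OF 1] H unfolding 2 by simp
  qed
  show ?thesis
  proof (cases rule: groupoid_table.classification[OF groupoid_constants_table(1)[OF G]])
    case (1 \<pi>)
    have c: "(\<lambda>i j k. ?T (\<pi> i) (\<pi> j) (\<pi> k)) = Z3_consts" "(\<lambda>i. ?e (\<pi> i)) = (\<lambda>i. of_bool (i = 1))"
      by (intro ext, subst T, simp only: 1(2)) (intro ext, subst e, simp only: 1(3))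
    have "weak_hopf_isomorphic H weak_hopf_1"
      using perm[OF 1(1)] antipode_Z3 unfolding c
      by (intro isomorphic_if_same_constants[OF _ diagonal_weak_hopf_1]) (simp_all add: constants_weak_hopf_1)
    then show ?thesis by blast
  next
    case (2 \<pi>)
    have c: "(\<lambda>i j k. ?T (\<pi> i) (\<pi> j) (\<pi> k)) = Z2_point_consts" "(\<lambda>i. ?e (\<pi> i)) = (\<lambda>i. of_bool (i \<noteq> 3))"
      by (intro ext, subst T, simp only: 2(2)) (intro ext, subst e, simp only: 2(3))
    have "weak_hopf_isomorphic H weak_hopf_2"
      using perm[OF 2(1)] antipode_Z2_point unfolding c
      by (intro isomorphic_if_same_constants[OF _ diagonal_weak_hopf_2]) (simp_all add: constants_weak_hopf_2)
    then show ?thesis by blast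
  next
    case 3
    have c: "?T = points_consts" "?e = (\<lambda>i. 1)"
      by (intro ext, subst T, simp only: 3(1)) (intro ext, rule 3(2))
    have "weak_hopf_isomorphic H weak_hopf_3"
      using G antipode_points unfolding c
      by (intro isomorphic_if_same_constants[OF D diagonal_weak_hopf_3]) (simp_all add: constants_weak_hopf_3 c)
    then show ?thesis by blast
  qed
qed

theorem proposition4p6:
  shows "weak_hopf_algebra weak_hopf_1 \<and> weak_hopf_algebra weak_hopf_2 \<and> weak_hopf_algebra weak_hopf_3
    \<and> (\<forall>H :: 'a::complex_vector weak_hopf_data.
         cdim (UNIV :: 'a set) = 3 \<and> weak_hopf_algebra H \<longrightarrow>
         weak_hopf_isomorphic H weak_hopf_1 \<or> weak_hopf_isomorphic H weak_hopf_2
           \<or> weak_hopf_isomorphic H weak_hopf_3)"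
proof (intro conjI allI impI)
  show "weak_hopf_algebra weak_hopf_1"
    unfolding diagonal_data.weak_hopf_iff[OF diagonal_weak_hopf_1] constants_weak_hopf_1
    by (rule groupoid_constants_Z3)
  show "weak_hopf_algebra weak_hopf_2"
    unfolding diagonal_data.weak_hopf_iff[OF diagonal_weak_hopf_2] constants_weak_hopf_2
    by (rule groupoid_constants_Z2_point)
  show "weak_hopf_algebra weak_hopf_3"
    unfolding diagonal_data.weak_hopf_iff[OF diagonal_weak_hopf_3] constants_weak_hopf_3
    by (rule groupoid_constants_points)
qed (elim conjE, rule dim3_weak_hopf_classification)

end
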